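(* Let $M=\mathrm{SL}(n+1,\mathbb H)/(\mathrm{GL}(1,\mathbb H)\mathrm{SL}(n,\mathbb H))$ with its invariant quaternionic skew-Hermitian structure $(Q,\omega)$, and for $\mathbb K=\mathbb R,\mathbb C$ let $N_{\mathbb K}=\mathrm{SL}(n+1,\mathbb K)/(\mathrm{GL}(1,\mathbb K)\mathrm{SL}(n,\mathbb K))$, viewed as a submanifold of $M$ through the inclusion $\mathrm{SL}(n+1,\mathbb K)\subset\mathrm{SL}(n+1,\mathbb H)$. For $\mathbb K=\mathbb R$, the manifold $N_{\mathbb R}$ is a symplectic submanifold of $M$. For $\mathbb K=\mathbb C$, the manifold $N_{\mathbb C}$ is a pseudo-Kähler submanifold of $M$.
   Context: Notation: $\mathrm{GL}(1,\mathbb F)\mathrm{SL}(n,\mathbb F):=\mathrm S(\mathrm{GL}(1,\mathbb F)\times\mathrm{GL}(n,\mathbb F))$ (block-diagonal elements of $\mathrm{SL}(n+1,\mathbb F)$) for $\mathbb F=\mathbb R,\mathbb C,\mathbb H$. $L=\mathrm{GL}(1,\mathbb H)\mathrm{SL}(n,\mathbb H)$ has Lie algebra $\mathfrak l=\mathfrak{sp}(1)\oplus\mathbb R\oplus\mathfrak{sl}(n,\mathbb H)$, and $M$ is a symmetric space of real dimension $8n$ with canonical decomposition $\mathfrak{sl}(n+1,\mathbb H)=\mathfrak l\oplus\mathfrak m$, where $\mathfrak m\cong T_oM$ consists of the off-diagonal block matrices $\begin{pmatrix}0&u^t\\ w&0\end{pmatrix}$, $u,w\in\mathbb H^n$. Invariant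 structures on $M$: $Q$ is the invariant quaternionic structure with $Q_o=\mathrm{ad}(\mathfrak{sp}(1))|_{\mathfrak m}$, where $\mathfrak{sp}(1)\subset\mathfrak{gl}(1,\mathbb H)$. Let $I$ be the invariant paracomplex structure ($I^2=\mathrm{Id}$) with $I_o=\mathrm{ad}(Z_0)|_{\mathfrak m}$, $Z_0$ a (suitably normalized) generator of the center $Z(\mathfrak l)\cong\mathbb R$. Let $\omega$ be the invariant 2-form defined by $B_{\mathfrak m}(X,Y)=\omega_o(X,I_oY)$, $X,Y\in\mathfrak m$, where $B_{\mathfrak m}$ is the restriction to $\mathfrak m$ of the Killing form of $\mathfrak{sl}(n+1,\mathbb H)$. $(M,Q,\omega)$ is a (torsion-free) quaternionic skew-Hermitian manifold: $\omega$ is closed, non-degenerate, and $\omega(JX,JY)=\omega(X,Y)$ for all almost complex structures $J\in Q$. One has $\mathrm{SL}(n+1,\mathbb K)\cap L=\mathrm{GL}(1,\mathbb K)\mathrm{SL}(n,\mathbb K)$, so $N_{\mathbb K}$ is the $\mathrm{SL}(n+1,\mathbb K)$-orbit of $o=eL$. A submanifold $\iota:N\to M$ is symplectic if $\hat\omega=\iota^*\omega$ is non-degenerate and closed. It is a pseudo-Kähler submanifold if $N$ carries an almost complex structure $\hat J$ which is the restriction to $TN$ of a section of $Q$ along $N$, $\hat\omega$ is non-degenerate, and, with $\hat g(X,Y)=\hat\omega(X,\hat JY)$, the almost pseudo-Hermitian structure $(\hat J,\hat g)$ is pseudo-Kähler ($\hat J$ integrable and $d\hat\omega=0$). *)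

theory Defs
  imports "HOL-Analysis.Analysis"
begin

section \<open>Quaternions\<close>

datatype quat = Quat (qre: real) (qi: real) (qj: real) (qk: real)

lemma quat_eq_iff: "x = y \<longleftrightarrow> qre x = qre y \<and> qi x = qi y \<and> qj x = qj y \<and> qk x = qk y"
  by (cases x; cases y) simp

instantiation quat :: ring_1
begin

definition "0 = Quat 0 0 0 0"
definition "1 = Quat 1 0 0 0"
definition "x + y = Quat (qre x + qre y) (qi x + qi y) (qj x + qj y) (qk x + qk y)"
definition "- x = Quat (- qre x) (- qi x) (- qj x) (- qk x)"
definition "x - y = Quat (qre x - qre y) (qi x - qi y) (qj x - qj y) (qk x - qk y)"
definition "x * y = Quat
  (qre x * qre y - qi x * qi y - qj x * qj y - qk x * qk y)
  (qre x * qi y + qi x * qre y + qj x * qk y - qk x * qj y)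
  (qre x * qj y - qi x * qk y + qj x * qre y + qk x * qi y)
  (qre x * qk y + qi x * qj y - qj x * qi y + qk x * qre y)"

instance
  by standard
    (simp_all add: zero_quat_def one_quat_def plus_quat_def uminus_quat_def minus_quat_def
      times_quat_def algebra_simps)

end

lemma quat_zero_sel [simp]: "qre 0 = 0" "qi 0 = 0" "qj 0 = 0" "qk 0 = 0"
  by (simp_all add: zero_quat_def)

lemma quat_one_sel [simp]: "qre 1 = 1" "qi 1 = 0" "qj 1 = 0" "qk 1 = 0"
  by (simp_all add: one_quat_def)

lemma quat_plus_sel [simp]:
  "qre (x + y) = qre x + qre y" "qi (x + y) = qi x + qi y"
  "qj (x + y) = qj x + qj y" "qk (x + y) = qk x + qk y"
  by (simp_all add: plus_quat_def)

lemma quat_uminus_sel [simp]: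
  "qre (- x) = - qre x" "qi (- x) = - qi x" "qj (- x) = - qj x" "qk (- x) = - qk x"
  by (simp_all add: uminus_quat_def)

lemma quat_minus_sel [simp]:
  "qre (x - y) = qre x - qre y" "qi (x - y) = qi x - qi y"
  "qj (x - y) = qj x - qj y" "qk (x - y) = qk x - qk y"
  by (simp_all add: minus_quat_def)

lemma quat_times_sel [simp]:
  "qre (x * y) = qre x * qre y - qi x * qi y - qj x * qj y - qk x * qk y"
  "qi (x * y) = qre x * qi y + qi x * qre y + qj x * qk y - qk x * qj y"
  "qj (x * y) = qre x * qj y - qi x * qk y + qj x * qre y + qk x * qi y"
  "qk (x * y) = qre x * qk y + qi x * qj y - qj x * qi y + qk x * qre y"
  by (simp_all add: times_quat_def)

instantiation quat :: real_algebra_1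
begin

definition "r *\<^sub>R x = Quat (r * qre x) (r * qi x) (r * qj x) (r * qk x)"

instance
  by standard (simp_all add: scaleR_quat_def quat_eq_iff algebra_simps)

end

lemma quat_scaleR_sel [simp]:
  "qre (r *\<^sub>R x) = r * qre x" "qi (r *\<^sub>R x) = r * qi x"
  "qj (r *\<^sub>R x) = r * qj x" "qk (r *\<^sub>R x) = r * qk x"
  by (simp_all add: scaleR_quat_def)

instantiation quat :: real_inner
begin

definition "inner x y = qre x * qre y + qi x * qi y + qj x * qj y + qk x * qk y"
definition norm_quat_def: "norm (x :: quat) = sqrt (inner x x)"
definition sgn_quat_def: "sgn (x :: quat) = x /\<^sub>R norm x"
definition dist_quat_def: "dist (x :: quat) y = norm (x - y)"
definition uniformity_quat_def [code del]:
  "(uniformity :: (quat \<times> quat) filter) = (INF e\<in>{0<..}. principal {(x, y). dist x y < e})"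
definition open_quat_def [code del]:
  "open (U :: quat set) \<longleftrightarrow> (\<forall>x\<in>U. eventually (\<lambda>(x', y). x' = x \<longrightarrow> y \<in> U) uniformity)"

instance
proof
  fix r :: real and x y z :: quat
  show "inner x x = 0 \<longleftrightarrow> x = 0"
    by (simp add: inner_quat_def quat_eq_iff add_nonneg_eq_0_iff)
qed (simp_all add: norm_quat_def sgn_quat_def dist_quat_def uniformity_quat_def open_quat_def
    inner_quat_def algebra_simps)

end

instantiation quat :: real_normed_div_algebra
begin

definition "inverse x =
  inverse (inner x x) *\<^sub>R Quat (qre x) (- qi x) (- qj x) (- qk x)"
definition "x div (y :: quat) = x * inverse y"

instance
proof
  fix x y :: quat
  let ?cnj = "Quat (qre x) (- qi x) (- qj x) (- qk x)"
  have cnj: "?cnj * x = inner x x *\<^sub>R 1" "x * ?cnj = inner x x *\<^sub>R 1"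
    by (simp_all add: quat_eq_iff inner_quat_def mult.commute)
  show "inverse x * x = 1" if "x \<noteq> 0"
    using that by (simp add: inverse_quat_def cnj)
  show "x * inverse x = 1" if "x \<noteq> 0"
    using that by (simp add: inverse_quat_def cnj)
  show "x div y = x * inverse y"
    by (simp add: divide_quat_def)
  show "inverse (0 :: quat) = 0"
    by (simp add: inverse_quat_def)
  have "inner (x * y) (x * y) = inner x x * inner y y"
    unfolding inner_quat_def quat_times_sel by algebra
  then show "norm (x * y) = norm x * norm y"
    by (simp add: norm_quat_def real_sqrt_mult)
qed

end

instantiation quat :: euclidean_space
begin

definition "Basis = {1, Quat 0 1 0 0, Quat 0 0 1 0, Quat 0 0 0 1}"

instance
proof
  fix u v x :: quat
  show "(Basis :: quat set) \<noteq> {}" "finite (Basis :: quat set)"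
    by (simp_all add: Basis_quat_def)
  show "inner u v = (if u = v then 1 else 0)" if "u \<in> Basis" "v \<in> Basis"
    using that unfolding Basis_quat_def one_quat_def
    by (elim insertE emptyE) (simp_all add: inner_quat_def)
  show "(\<forall>u\<in>Basis. inner x u = 0) \<longleftrightarrow> x = 0"
    unfolding quat_eq_iff [of x 0] by (simp add: Basis_quat_def inner_quat_def)
qed

end

section \<open>Smooth manifolds\<close>

text \<open>For open \<open>S\<close> and a finite-dimensional domain, being \<open>k\<close> times continuously differentiable.\<close>

primrec Ck_on :: "nat \<Rightarrow> 'a::real_normed_vector set \<Rightarrow> ('a \<Rightarrow> 'b::real_normed_vector) \<Rightarrow> bool" where
  "Ck_on 0 S f \<longleftrightarrow> continuous_on S f"
| "Ck_on (Suc k) S f \<longleftrightarrow>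
     (\<forall>x\<in>S. f differentiable (at x)) \<and>
     (\<forall>v. Ck_on k S (\<lambda>x. frechet_derivative f (at x) v))"

text \<open>Smoothness on an arbitrary subset of a Euclidean space, by local smooth extension. On open
  sets this is the usual notion, on embedded submanifolds (such as closed matrix groups) it is
  smoothness with respect to the submanifold structure.\<close>

definition smooth_on :: "'a::real_normed_vector set \<Rightarrow> ('a \<Rightarrow> 'b::real_normed_vector) \<Rightarrow> bool" where
  "smooth_on S f \<longleftrightarrow>
     (\<forall>x\<in>S. \<exists>U F. open U \<and> x \<in> U \<and> (\<forall>k. Ck_on k U F) \<and> (\<forall>y\<in>S \<inter> U. F y = f y))"

text \<open>A chart is a pair of its domain and its coordinate map; coordinates take values in the
  Euclidean space \<open>'e\<close>.\<close>

type_synonym ('m, 'e) chart = "'m set \<times> ('m \<Rightarrow> 'e)"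

record ('m, 'e) manifold =
  points :: "'m set"
  charts :: "('m, 'e) chart set"

definition chart_inv :: "('m, 'e) chart \<Rightarrow> 'e \<Rightarrow> 'm" where
  "chart_inv c = inv_into (fst c) (snd c)"

definition manifold_topology :: "('m, 'e::euclidean_space) manifold \<Rightarrow> 'm topology" where
  "manifold_topology M =
     topology (\<lambda>W. W \<subseteq> points M \<and> (\<forall>c\<in>charts M. open (snd c ` (fst c \<inter> W))))"

definition smooth_manifold :: "('m, 'e::euclidean_space) manifold \<Rightarrow> bool" where
  "smooth_manifold M \<longleftrightarrow>
     (\<Union>c\<in>charts M. fst c) = points M \<and>
     (\<forall>c\<in>charts M. inj_on (snd c) (fst c) \<and> open (snd c ` fst c)) \<and>
     (\<forall>c\<in>charts M. \<forall>d\<in>charts M.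
        open (snd c ` (fst c \<inter> fst d)) \<and>
        smooth_on (snd c ` (fst c \<inter> fst d)) (snd d \<circ> chart_inv c)) \<and>
     Hausdorff_space (manifold_topology M) \<and>
     second_countable (manifold_topology M)"

definition charts_at :: "('m, 'e) manifold \<Rightarrow> 'm \<Rightarrow> ('m, 'e) chart set" where
  "charts_at M p = {c \<in> charts M. p \<in> fst c}"

definition smooth_map ::
  "('m, 'e::euclidean_space) manifold \<Rightarrow> ('n, 'f::euclidean_space) manifold \<Rightarrow> ('m \<Rightarrow> 'n) \<Rightarrow> bool" where
  "smooth_map M N f \<longleftrightarrow>
     f ` points M \<subseteq> points N \<and>
     (\<forall>c\<in>charts M. \<forall>d\<in>charts N.
        open (snd c ` (fst c \<inter> f -` fst d)) \<and>
        smooth_on (snd c ` (fst c \<inter> f -` fst d)) (snd d \<circ> f \<circ> chart_inv c))"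

subsection \<open>Tangent vectors\<close>

text \<open>A tangent vector at \<open>p\<close> is the family of its coordinate vectors in all charts at \<open>p\<close>, related
  by the differentials of the coordinate changes. The entries at all other charts are fixed to be
  \<open>0\<close>, so that equality and the vector space operations are pointwise.\<close>

type_synonym ('m, 'e) tvec = "('m, 'e) chart \<Rightarrow> 'e"

definition tangent_space :: "('m, 'e::euclidean_space) manifold \<Rightarrow> 'm \<Rightarrow> ('m, 'e) tvec set" where
  "tangent_space M p =
     {v. (\<forall>c. c \<notin> charts_at M p \<longrightarrow> v c = 0) \<and>
         (\<forall>c\<in>charts_at M p. \<forall>d\<in>charts_at M p.
            v d = frechet_derivative (snd d \<circ> chart_inv c) (at (snd c p)) (v c))}"

text \<open>The tangent vector at \<open>p\<close> with coordinate vector \<open>u\<close> in the chart \<open>c\<close>.\<close>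

definition coord_vec ::
  "('m, 'e::euclidean_space) manifold \<Rightarrow> 'm \<Rightarrow> ('m, 'e) chart \<Rightarrow> 'e \<Rightarrow> ('m, 'e) tvec" where
  "coord_vec M p c u =
     (\<lambda>d. if d \<in> charts_at M p
          then frechet_derivative (snd d \<circ> chart_inv c) (at (snd c p)) u else 0)"

definition velocity :: "('m, 'e::euclidean_space) manifold \<Rightarrow> (real \<Rightarrow> 'm) \<Rightarrow> ('m, 'e) tvec" where
  "velocity M \<gamma> =
     (\<lambda>c. if c \<in> charts_at M (\<gamma> 0) then vector_derivative (snd c \<circ> \<gamma>) (at 0) else 0)"

text \<open>The differential of \<open>f\<close> at \<open>p\<close>; its value does not depend on the chosen chart \<open>c\<close> at \<open>p\<close>.\<close>

definition pushforward ::
  "('m, 'e::euclidean_space) manifold \<Rightarrow> ('n, 'f::euclidean_space) manifold \<Rightarrow> ('m \<Rightarrow> 'n) \<Rightarrow> 'm \<Rightarrow>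
     ('m, 'e) tvec \<Rightarrow> ('n, 'f) tvec" where
  "pushforward M N f p v =
     (let c = (SOME c. c \<in> charts_at M p) in
      (\<lambda>d. if d \<in> charts_at N (f p)
           then frechet_derivative (snd d \<circ> f \<circ> chart_inv c) (at (snd c p)) (v c) else 0))"

definition submanifold ::
  "('n, 'f::euclidean_space) manifold \<Rightarrow> ('m, 'e::euclidean_space) manifold \<Rightarrow> ('n \<Rightarrow> 'm) \<Rightarrow> bool" where
  "submanifold N M \<iota> \<longleftrightarrow>
     smooth_manifold N \<and> smooth_manifold M \<and> smooth_map N M \<iota> \<and>
     (\<forall>p\<in>points N. inj_on (pushforward N M \<iota> p) (tangent_space N p)) \<and>
     embedding_map (manifold_topology N) (manifold_topology M) \<iota>"

subsection \<open>Two-forms\<close>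

type_synonym ('m, 'e) two_form = "'m \<Rightarrow> ('m, 'e) tvec \<Rightarrow> ('m, 'e) tvec \<Rightarrow> real"

definition form_rep ::
  "('m, 'e::euclidean_space) manifold \<Rightarrow> ('m, 'e) two_form \<Rightarrow> ('m, 'e) chart \<Rightarrow> 'e \<Rightarrow> 'e \<Rightarrow> 'e \<Rightarrow> real" where
  "form_rep M \<omega> c x u v =
     (let p = chart_inv c x in \<omega> p (coord_vec M p c u) (coord_vec M p c v))"

definition smooth_two_form ::
  "('m, 'e::euclidean_space) manifold \<Rightarrow> ('m, 'e) two_form \<Rightarrow> bool" where
  "smooth_two_form M \<omega> \<longleftrightarrow>
     (\<forall>c\<in>charts M.
        (\<forall>x\<in>snd c ` fst c. bilinear (form_rep M \<omega> c x) \<and> (\<forall>u. form_rep M \<omega> c x u u = 0)) \<and>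
        (\<forall>u v. smooth_on (snd c ` fst c) (\<lambda>x. form_rep M \<omega> c x u v)))"

text \<open>The closedness condition is \<open>d\<omega>(u, v, w) = 0\<close> on constant coordinate fields.\<close>

definition closed_two_form ::
  "('m, 'e::euclidean_space) manifold \<Rightarrow> ('m, 'e) two_form \<Rightarrow> bool" where
  "closed_two_form M \<omega> \<longleftrightarrow>
     smooth_two_form M \<omega> \<and>
     (\<forall>c\<in>charts M. \<forall>x\<in>snd c ` fst c. \<forall>u v w.
        frechet_derivative (\<lambda>y. form_rep M \<omega> c y v w) (at x) u +
        frechet_derivative (\<lambda>y. form_rep M \<omega> c y w u) (at x) v +
        frechet_derivative (\<lambda>y. form_rep M \<omega> c y u v) (at x) w = 0)"

definition nondegenerate ::
  "('m, 'e::euclidean_space) manifold \<Rightarrow> ('m, 'e) two_form \<Rightarrow> bool" where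
  "nondegenerate M \<omega> \<longleftrightarrow>
     (\<forall>p\<in>points M. \<forall>v\<in>tangent_space M p.
        (\<forall>w\<in>tangent_space M p. \<omega> p v w = 0) \<longrightarrow> v = (\<lambda>_. 0))"

definition pullback_form ::
  "('n, 'f::euclidean_space) manifold \<Rightarrow> ('m, 'e::euclidean_space) manifold \<Rightarrow> ('n \<Rightarrow> 'm) \<Rightarrow>
     ('m, 'e) two_form \<Rightarrow> ('n, 'f) two_form" where
  "pullback_form N M \<iota> \<omega> =
     (\<lambda>p v w. \<omega> (\<iota> p) (pushforward N M \<iota> p v) (pushforward N M \<iota> p w))"

definition symplectic_submanifold ::
  "('n, 'f::euclidean_space) manifold \<Rightarrow> ('m, 'e::euclidean_space) manifold \<Rightarrow> ('n \<Rightarrow> 'm) \<Rightarrow>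
     ('m, 'e) two_form \<Rightarrow> bool" where
  "symplectic_submanifold N M \<iota> \<omega> \<longleftrightarrow>
     submanifold N M \<iota> \<and>
     nondegenerate N (pullback_form N M \<iota> \<omega>) \<and>
     closed_two_form N (pullback_form N M \<iota> \<omega>)"

subsection \<open>Fields of endomorphisms\<close>

type_synonym ('m, 'e) endo = "('m, 'e) tvec \<Rightarrow> ('m, 'e) tvec"

definition endo_rep ::
  "('m, 'e::euclidean_space) manifold \<Rightarrow> ('m \<Rightarrow> ('m, 'e) endo) \<Rightarrow> ('m, 'e) chart \<Rightarrow> 'e \<Rightarrow> 'e \<Rightarrow> 'e" where
  "endo_rep M J c x u = (let p = chart_inv c x in J p (coord_vec M p c u) c)"

definition almost_complex_structure ::
  "('m, 'e::euclidean_space) manifold \<Rightarrow> ('m \<Rightarrow> ('m, 'e) endo) \<Rightarrow> bool" where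
  "almost_complex_structure M J \<longleftrightarrow>
     (\<forall>p\<in>points M. \<forall>v\<in>tangent_space M p. J p v \<in> tangent_space M p \<and> J p (J p v) = (\<lambda>c. - v c)) \<and>
     (\<forall>c\<in>charts M.
        (\<forall>x\<in>snd c ` fst c. linear (endo_rep M J c x)) \<and>
        (\<forall>u. smooth_on (snd c ` fst c) (\<lambda>x. endo_rep M J c x u)))"

text \<open>Integrability: around every point there are coordinates in which \<open>J\<close> is constant, i.e. (after
  a linear change of coordinates) holomorphic coordinates. The atlas is understood to be maximal,
  as it is for the homogeneous spaces below.\<close>

definition integrable_structure ::
  "('m, 'e::euclidean_space) manifold \<Rightarrow> ('m \<Rightarrow> ('m, 'e) endo) \<Rightarrow> bool" where
  "integrable_structure M J \<longleftrightarrow>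
     (\<forall>p\<in>points M. \<exists>c\<in>charts_at M p. \<exists>J0. \<forall>x\<in>snd c ` fst c. endo_rep M J c x = J0)"

definition smooth_section_along ::
  "('n, 'f::euclidean_space) manifold \<Rightarrow> ('m, 'e::euclidean_space) manifold \<Rightarrow> ('n \<Rightarrow> 'm) \<Rightarrow>
     ('m \<Rightarrow> ('m, 'e) endo set) \<Rightarrow> ('n \<Rightarrow> ('m, 'e) endo) \<Rightarrow> bool" where
  "smooth_section_along N M \<iota> Q J \<longleftrightarrow>
     (\<forall>p\<in>points N. J p \<in> Q (\<iota> p)) \<and>
     (\<forall>c\<in>charts N. \<forall>d\<in>charts M. \<forall>u.
        smooth_on (snd c ` (fst c \<inter> \<iota> -` fst d))
          (\<lambda>x. let p = chart_inv c x in J p (coord_vec M (\<iota> p) d u) d))"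

definition pseudo_hermitian ::
  "('m, 'e::euclidean_space) manifold \<Rightarrow> ('m \<Rightarrow> ('m, 'e) endo) \<Rightarrow> ('m, 'e) two_form \<Rightarrow> bool" where
  "pseudo_hermitian M J g \<longleftrightarrow>
     nondegenerate M g \<and>
     (\<forall>p\<in>points M. \<forall>v\<in>tangent_space M p. \<forall>w\<in>tangent_space M p.
        g p v w = g p w v \<and> g p (J p v) (J p w) = g p v w)"

definition pseudo_kaehler_submanifold ::
  "('n, 'f::euclidean_space) manifold \<Rightarrow> ('m, 'e::euclidean_space) manifold \<Rightarrow> ('n \<Rightarrow> 'm) \<Rightarrow>
     ('m \<Rightarrow> ('m, 'e) endo set) \<Rightarrow> ('m, 'e) two_form \<Rightarrow> bool" where
  "pseudo_kaehler_submanifold N M \<iota> Q \<omega> \<longleftrightarrow>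
     submanifold N M \<iota> \<and>
     (\<exists>J'. almost_complex_structure N J' \<and>
        (\<exists>J. smooth_section_along N M \<iota> Q J \<and>
           (\<forall>p\<in>points N. \<forall>v\<in>tangent_space N p.
              J p (pushforward N M \<iota> p v) = pushforward N M \<iota> p (J' p v))) \<and>
        nondegenerate N (pullback_form N M \<iota> \<omega>) \<and>
        pseudo_hermitian N J' (\<lambda>p v w. pullback_form N M \<iota> \<omega> p v (J' p w)) \<and>
        integrable_structure N J' \<and>
        closed_two_form N (pullback_form N M \<iota> \<omega>))"

section \<open>Homogeneous spaces of matrix groups\<close>

definition coset ::
  "('a::{real_algebra_1,euclidean_space}^'k^'k) set \<Rightarrow> 'a^'k^'k \<Rightarrow> ('a^'k^'k) set" where
  "coset H g = (\<lambda>h. g ** h) ` H"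

text \<open>\<open>G/H\<close> with the unique smooth structure for which the projection from \<open>G\<close> is a smooth
  submersion, presented by its maximal atlas. The preimage in \<open>G\<close> of a set \<open>U\<close> of cosets is
  \<open>\<Union>U\<close>, so a chart \<open>c\<close> is required to have a domain which is open in the quotient
  topology, to be smooth on \<open>G\<close> as a function of representatives, and to have an inverse
  which locally lifts to smooth maps into \<open>G\<close>.\<close>

definition homogeneous_space ::
  "('a::{real_algebra_1,euclidean_space}^'k^'k) set \<Rightarrow> ('a^'k^'k) set \<Rightarrow>
     (('a^'k^'k) set, 'e::euclidean_space) manifold" where
  "homogeneous_space G H =
     \<lparr>points = coset H ` G,
      charts = {c. fst c \<subseteq> coset H ` G \<and> inj_on (snd c) (fst c) \<and> open (snd c ` fst c) \<and>
        openin (top_of_set G) (\<Union>(fst c)) \<and>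
        smooth_on (\<Union>(fst c)) (\<lambda>g. snd c (coset H g)) \<and>
        (\<forall>x\<in>snd c ` fst c. \<exists>V s. open V \<and> x \<in> V \<and> V \<subseteq> snd c ` fst c \<and>
           smooth_on V s \<and> s ` V \<subseteq> G \<and> (\<forall>y\<in>V. coset H (s y) = chart_inv c y))}\<rparr>"

section \<open>The spaces \<open>M\<close> and \<open>N\<^sub>K\<close>\<close>

text \<open>\<open>(n + 1) \<times> (n + 1)\<close> matrices are indexed by \<open>'n option\<close> where \<open>n = CARD('n)\<close>; the index
  \<open>None\<close> is that of the distinguished \<open>1 \<times> 1\<close> block.\<close>

definition block_diagonal :: "'a::zero^('n::finite option)^('n option) \<Rightarrow> bool" where
  "block_diagonal A \<longleftrightarrow> (\<forall>i. A $ None $ Some i = 0 \<and> A $ Some i $ None = 0)"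

definition block_off_diagonal :: "'a::zero^('n::finite option)^('n option) \<Rightarrow> bool" where
  "block_off_diagonal A \<longleftrightarrow> A $ None $ None = 0 \<and> (\<forall>i j. A $ Some i $ Some j = 0)"

text \<open>The quaternion \<open>a + b j\<close> with complex \<open>a\<close>, \<open>b\<close> acts as the complex matrix with rows
  \<open>(a, b)\<close> and \<open>(- cnj b, cnj a)\<close>; \<open>False\<close> indexes the first of these rows and columns.\<close>

definition complex_form :: "quat^'k^'k \<Rightarrow> complex^('k \<times> bool)^('k \<times> bool)" where
  "complex_form A = (\<chi> r s.
     let q = A $ fst r $ fst s; a = Complex (qre q) (qi q); b = Complex (qj q) (qk q) in
     if snd r then (if snd s then cnj a else - cnj b) else (if snd s then b else a))"

definition SL_H :: "(quat^'k^'k) set" where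
  "SL_H = {A. det (complex_form A) = 1}"

definition SL :: "('a::comm_ring_1^'k^'k) set" where
  "SL = {A. det A = 1}"

definition L_H :: "(quat^('n::finite option)^('n option)) set" where
  "L_H = {A \<in> SL_H. block_diagonal A}"

definition L_K :: "('a::comm_ring_1^('n::finite option)^('n option)) set" where
  "L_K = {A \<in> SL. block_diagonal A}"

definition M_space ::
  "((quat^('n::finite option)^('n option)) set, (quat^'n) \<times> (quat^'n)) manifold" where
  "M_space = homogeneous_space SL_H L_H"

definition N_space ::
  "(('a::{comm_ring_1,real_algebra_1,euclidean_space}^('n::finite option)^('n option)) set,
     ('a^'n) \<times> ('a^'n)) manifold" where
  "N_space = homogeneous_space SL L_K"

definition quat_of_complex :: "complex \<Rightarrow> quat" where
  "quat_of_complex z = Quat (Re z) (Im z) 0 0"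

text \<open>The map \<open>g L\<^sub>K \<mapsto> f(g) L\<close>, with \<open>f\<close> applied entrywise.\<close>

definition inclusion ::
  "('a \<Rightarrow> quat) \<Rightarrow> ('a^('n option)^('n option)) set \<Rightarrow> (quat^('n::finite option)^('n option)) set" where
  "inclusion f C = (\<Union>g\<in>C. coset L_H (\<chi> i j. f (g $ i $ j)))"

subsection \<open>Lie algebra data\<close>

definition ad :: "quat^'k^'k \<Rightarrow> quat^'k^'k \<Rightarrow> quat^'k^'k" where
  "ad A B = A ** B - B ** A"

definition sl_H :: "(quat^'k^'k) set" where
  "sl_H = {A. qre (trace A) = 0}"

definition lie_l :: "(quat^('n::finite option)^('n option)) set" where
  "lie_l = {A \<in> sl_H. block_diagonal A}"

definition lie_m :: "(quat^('n::finite option)^('n option)) set" where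
  "lie_m = {A \<in> sl_H. block_off_diagonal A}"

definition center_l :: "(quat^('n::finite option)^('n option)) set" where
  "center_l = {Z \<in> lie_l. \<forall>A\<in>lie_l. ad Z A = 0}"

definition sp1 :: "(quat^('n::finite option)^('n option)) set" where
  "sp1 = {A. qre (A $ None $ None) = 0 \<and> (\<forall>i j. (i, j) \<noteq> (None, None) \<longrightarrow> A $ i $ j = 0)}"

definition trace_on :: "'v::real_vector set \<Rightarrow> ('v \<Rightarrow> 'v) \<Rightarrow> real" where
  "trace_on S f =
     (let B = (SOME B. B \<subseteq> S \<and> independent B \<and> span B = S) in \<Sum>b\<in>B. representation B (f b) b)"

definition killing_form :: "quat^'k^'k \<Rightarrow> quat^'k^'k \<Rightarrow> real" where
  "killing_form X Y = trace_on sl_H (ad X \<circ> ad Y)"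

subsection \<open>Invariant structures on \<open>M\<close>\<close>

text \<open>The image of \<open>X\<close> under the differential at the identity of the projection onto \<open>M\<close>. On
  \<open>lie_m\<close> this is the identification with the tangent space at the base point \<open>L_H\<close>.\<close>

definition base_vec ::
  "quat^('n::finite option)^('n option) \<Rightarrow>
     ((quat^('n option)^('n option)) set, (quat^'n) \<times> (quat^'n)) tvec" where
  "base_vec X =
     (THE v. \<exists>\<gamma>. range \<gamma> \<subseteq> SL_H \<and> \<gamma> 0 = mat 1 \<and> (\<gamma> has_vector_derivative X) (at 0) \<and>
        v = velocity M_space (\<lambda>t. coset L_H (\<gamma> t)))"

text \<open>The translate of \<open>base_vec X\<close> by the action of \<open>g\<close> on \<open>M\<close>.\<close>

definition translated_vec ::
  "quat^('n::finite option)^('n option) \<Rightarrow> quat^('n option)^('n option) \<Rightarrow>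
     ((quat^('n option)^('n option)) set, (quat^'n) \<times> (quat^'n)) tvec" where
  "translated_vec g X =
     pushforward M_space M_space (\<lambda>C. (\<lambda>h. g ** h) ` C) L_H (base_vec X)"

text \<open>The invariant extension of \<open>ad sp(1)\<close>. Only the values of a fibre element on tangent vectors
  at \<open>p\<close> are determined.\<close>

definition Q_structure ::
  "(quat^('n::finite option)^('n option)) set \<Rightarrow>
     ((quat^('n option)^('n option)) set, (quat^'n) \<times> (quat^'n)) endo set" where
  "Q_structure p =
     {J. \<exists>g\<in>SL_H. p = coset L_H g \<and>
        (\<exists>A\<in>sp1. \<forall>X\<in>lie_m. J (translated_vec g X) = translated_vec g (ad A X))}"

text \<open>The invariant two-form whose value at the base point satisfies \<open>\<omega>(X, [Z0, Y]) = B(X, Y)\<close>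
  for \<open>X\<close>, \<open>Y\<close> in \<open>lie_m\<close>, with \<open>B\<close> the Killing form.\<close>

definition omega ::
  "quat^('n::finite option)^('n option) \<Rightarrow>
     ((quat^('n option)^('n option)) set, (quat^'n) \<times> (quat^'n)) two_form" where
  "omega Z0 p v w =
     (THE r. \<exists>g\<in>SL_H. \<exists>X\<in>lie_m. \<exists>Y\<in>lie_m.
        p = coset L_H g \<and> v = translated_vec g X \<and> w = translated_vec g (ad Z0 Y) \<and>
        r = killing_form X Y)"

end

theory Submission
  imports Defs
begin

text \<open>A coset \<open>g L\<close> is a pair of a line and a complementary hyperplane. Writing \<open>g\<close> as a lower
  unipotent times an upper unipotent times a block-diagonal matrix gives global coordinates \<open>(w, v)\<close>
  on an open set, and translation by the group gives such standard charts around every point. In these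
  coordinates the invariant form is constant, a multiple of
  \<open>Re (v\<^sub>1 \<cdot> w\<^sub>2) - Re (v\<^sub>2 \<cdot> w\<^sub>1)\<close>, because the Killing form on \<open>lie_m\<close> is a multiple of the
  real trace of the product, and the quadratic correction terms cancel by \<open>Re (a b) = Re (b a)\<close>. The
  inclusions of the real and complex spaces are entrywise in standard charts, so the pulled back forms are
  constant and visibly non-degenerate. The complex structure on the complex space is \<open>ad\<close> of \<open>\<i>\<close> in the
  distinguished block; it is well defined along the complex space because complex scalars commute with \<open>\<i>\<close>,
  and it is constant in the affine coordinates of the line and the hyperplane.\<close>

section \<open>Calculus of smooth functions\<close>

text \<open>Two features of the definitions shape the work. Atlases are maximal, so smoothness and
  closedness speak of all charts; each condition is reduced to a criterion asking for one
  well-chosen chart around every point. Vectors, forms and structures are introduced by choice or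
  unique description over curves and representatives, so each must be shown independent of these:
  velocities see only the off-diagonal part of a matrix, and the isotropy group acts linearly and
  preserves the form, because real parts are invariant under conjugation. Hausdorffness, second
  countability and the embedding of the smaller spaces come from sending a coset of \<open>g\<close>
  to the projector \<open>g E00 g^-1\<close> onto its line along its hyperplane. The complex
  structure is not constant in the standard charts: the shear relating a chart to the one centred at
  a nearby point mixes the two off-diagonal blocks, on which \<open>\<i>\<close> acts with opposite
  signs. Replacing the second coordinate by the affine coordinate of the hyperplane removes the
  mixing.\<close>

lemma frechet_derivative_eqI:
  "(f has_derivative D) (at x) \<Longrightarrow> frechet_derivative f (at x) = D"
  by (rule frechet_derivative_at [symmetric])

text \<open>\<open>frechet_derivative\<close> is a choice among all derivatives, so functions with
  the same derivatives give the same choice, also at points where there is none.\<close>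

lemma frechet_derivative_cong:
  assumes "open S" "x \<in> S" "\<And>y. y \<in> S \<Longrightarrow> f y = g y"
  shows "frechet_derivative f (at x) = frechet_derivative g (at x)"
proof -
  have "(f has_derivative D) (at x) \<longleftrightarrow> (g has_derivative D) (at x)" for D
    using has_derivative_transform_within_open[of f D x UNIV S g]
      has_derivative_transform_within_open[of g D x UNIV S f] assms by auto
  then show ?thesis
    unfolding frechet_derivative_def by simp
qed

text \<open>Openness matters because \<open>Ck_on\<close> differentiates in the full space, so
  values outside \<open>S\<close> would otherwise enter.\<close>

lemma Ck_on_cong:
  assumes "open S" "\<And>y. y \<in> S \<Longrightarrow> f y = g y"
  shows "Ck_on k S f \<longleftrightarrow> Ck_on k S g"
  using assms(2)
proof (induction k arbitrary: f g)
  case 0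
  then show ?case by (auto intro: continuous_on_cong)
next
  case (Suc k)
  have 1: "f differentiable (at x) \<longleftrightarrow> g differentiable (at x)" if "x \<in> S" for x
    using has_derivative_transform_within_open[of f _ x UNIV S g]
      has_derivative_transform_within_open[of g _ x UNIV S f] assms(1) Suc.prems that
    unfolding differentiable_def by metis
  have 2: "Ck_on k S (\<lambda>x. frechet_derivative f (at x) v) \<longleftrightarrow>
      Ck_on k S (\<lambda>x. frechet_derivative g (at x) v)" for v
    by (rule Suc.IH) (simp add: frechet_derivative_cong[OF assms(1) _ Suc.prems])
  show ?case
    by (simp add: 1 2)
qed

lemma Ck_on_continuous: "Ck_on k S f \<Longrightarrow> continuous_on S f"
  by (cases k)
    (auto intro!: continuous_at_imp_continuous_on differentiable_imp_continuous_within)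

lemma Ck_on_SucD: "Ck_on (Suc k) S f \<Longrightarrow> Ck_on k S f"
proof (induction k arbitrary: f)
  case 0
  then show ?case using Ck_on_continuous by (metis Ck_on.simps(1))
next
  case (Suc k)
  then show ?case
    by (metis Ck_on.simps(2))
qed

lemma Ck_on_subset: "Ck_on k S f \<Longrightarrow> T \<subseteq> S \<Longrightarrow> Ck_on k T f"
  by (induction k arbitrary: f) (auto intro: continuous_on_subset)

lemma Ck_on_local:
  assumes "\<And>x. x \<in> S \<Longrightarrow> \<exists>U. open U \<and> x \<in> U \<and> Ck_on k U f"
  shows "Ck_on k S f"
  using assms
proof (induction k arbitrary: f)
  case 0
  then show ?case
    by (metis Ck_on.simps(1) continuous_at_imp_continuous_on continuous_on_eq_continuous_at)
next
  case (Suc k)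
  then show ?case
    by (simp, meson)
qed

lemma Ck_on_const: "Ck_on k S (\<lambda>x. c)"
  by (induction k arbitrary: c) auto

lemma has_derivative_frechet:
  "Ck_on (Suc k) S f \<Longrightarrow> x \<in> S \<Longrightarrow> (f has_derivative frechet_derivative f (at x)) (at x)"
  by (simp add: frechet_derivative_works)

text \<open>Replaces the chosen derivative by an explicit candidate \<open>D\<close>; this drives
  the inductions on \<open>k\<close> for the closure properties below.\<close>

lemma Ck_on_SucI:
  assumes "open S" "\<And>x. x \<in> S \<Longrightarrow> (f has_derivative D x) (at x)"
    and "\<And>v. Ck_on k S (\<lambda>x. D x v)"
  shows "Ck_on (Suc k) S f"
proof -
  have "frechet_derivative f (at x) = D x" if "x \<in> S" for x
    using assms(2)[OF that] by (rule frechet_derivative_eqI)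
  then have "Ck_on k S (\<lambda>x. frechet_derivative f (at x) v)" for v
    using Ck_on_cong[OF assms(1), of "\<lambda>x. frechet_derivative f (at x) v" "\<lambda>x. D x v"] assms(3) by simp
  then show ?thesis
    using assms(2) by (auto simp: differentiable_def)
qed

lemma Ck_on_bounded_linear:
  assumes "bounded_linear L" "open S" "Ck_on k S f"
  shows "Ck_on k S (\<lambda>x. L (f x))"
  using assms(3)
proof (induction k arbitrary: f)
  case 0
  then show ?case
    using bounded_linear.continuous_on[OF assms(1)] by simp
next
  case (Suc k)
  show ?case
    by (rule Ck_on_SucI[OF assms(2), where D = "\<lambda>x v. L (frechet_derivative f (at x) v)"])
      (use Suc bounded_linear.has_derivative[OF assms(1) has_derivative_frechet[OF Suc.prems]] in auto)
qed

lemma Ck_on_add: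
  assumes "open S" "Ck_on k S f" "Ck_on k S g"
  shows "Ck_on k S (\<lambda>x. f x + g x)"
  using assms(2,3)
proof (induction k arbitrary: f g)
  case 0
  then show ?case by (simp add: continuous_on_add)
next
  case (Suc k)
  show ?case
    by (rule Ck_on_SucI[OF assms(1),
          where D = "\<lambda>x v. frechet_derivative f (at x) v + frechet_derivative g (at x) v"])
      (use Suc has_derivative_add[OF has_derivative_frechet[OF Suc.prems(1)]
        has_derivative_frechet[OF Suc.prems(2)]] in auto)
qed

lemma Ck_on_sum:
  assumes "open S" "\<And>i. i \<in> I \<Longrightarrow> Ck_on k S (f i)"
  shows "Ck_on k S (\<lambda>x. \<Sum>i\<in>I. f i x)"
  using assms(2) by (induction I rule: infinite_finite_induct)
    (auto intro: Ck_on_const Ck_on_add[OF assms(1)])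

lemma Ck_on_bounded_bilinear:
  assumes B: "bounded_bilinear B" and S: "open S" and "Ck_on k S f" "Ck_on k S g"
  shows "Ck_on k S (\<lambda>x. B (f x) (g x))"
  using assms(3,4)
proof (induction k arbitrary: f g)
  case 0
  then show ?case
    using bounded_bilinear.continuous_on[OF B] by simp
next
  case (Suc k)
  show ?case
  proof (rule Ck_on_SucI[OF S, where D = "\<lambda>x v. B (f x) (frechet_derivative g (at x) v)
        + B (frechet_derivative f (at x) v) (g x)"])
    show "((\<lambda>x. B (f x) (g x)) has_derivative (\<lambda>v. B (f x) (frechet_derivative g (at x) v)
        + B (frechet_derivative f (at x) v) (g x))) (at x)" if "x \<in> S" for x
      by (rule bounded_bilinear.FDERIV[OF B has_derivative_frechet[OF Suc.prems(1) that]
            has_derivative_frechet[OF Suc.prems(2) that]])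
    show "Ck_on k S (\<lambda>x. B (f x) (frechet_derivative g (at x) v)
        + B (frechet_derivative f (at x) v) (g x))" for v
      using Suc.prems Suc.prems[THEN Ck_on_SucD] by (intro Ck_on_add[OF S] Suc.IH) simp_all
  qed
qed

text \<open>\<open>Ck_on\<close> only controls derivatives in a fixed direction. Expanding a varying
  direction in the basis reduces to that case.\<close>

lemma linear_Basis_expansion:
  fixes L :: "'a::euclidean_space \<Rightarrow> 'b::real_vector"
  assumes "linear L"
  shows "L v = (\<Sum>b\<in>Basis. (v \<bullet> b) *\<^sub>R L b)"
proof -
  have "L v = L (\<Sum>b\<in>Basis. (v \<bullet> b) *\<^sub>R b)"
    by (simp add: euclidean_representation)
  then show ?thesis
    by (simp add: linear_sum[OF assms] linear_cmul[OF assms])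
qed

text \<open>Induction on \<open>k\<close> through the chain rule. The inner derivative is a
  direction depending on \<open>x\<close>, so it is expanded in the basis; the induction hypothesis
  then applies to each directional derivative of \<open>g\<close>.\<close>

lemma Ck_on_compose:
  fixes f :: "'a::real_normed_vector \<Rightarrow> 'b::euclidean_space"
  assumes S: "open S" and T: "open T" and "f ` S \<subseteq> T" and "Ck_on k S f" "Ck_on k T g"
  shows "Ck_on k S (\<lambda>x. g (f x))"
  using assms(4,5)
proof (induction k arbitrary: g)
  case 0
  then show ?case
    using continuous_on_compose2[of T g S f] assms(3) by simp
next
  case (Suc k)
  have f: "(f has_derivative frechet_derivative f (at x)) (at x)" if "x \<in> S" for x
    by (rule has_derivative_frechet[OF Suc.prems(1) that])
  have g: "(g has_derivative frechet_derivative g (at y)) (at y)" if "y \<in> T" for y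
    by (rule has_derivative_frechet[OF Suc.prems(2) that])
  show ?case
  proof (rule Ck_on_SucI[OF S, where D = "\<lambda>x v. \<Sum>b\<in>Basis.
        (frechet_derivative f (at x) v \<bullet> b) *\<^sub>R frechet_derivative g (at (f x)) b"])
    fix x assume x: "x \<in> S"
    then have y: "f x \<in> T" using assms(3) by blast
    have "((\<lambda>x. g (f x)) has_derivative (\<lambda>v. frechet_derivative g (at (f x)) (frechet_derivative f (at x) v))) (at x)"
      using has_derivative_compose[OF f[OF x] g[OF y]] .
    then show "((\<lambda>x. g (f x)) has_derivative (\<lambda>v. \<Sum>b\<in>Basis.
        (frechet_derivative f (at x) v \<bullet> b) *\<^sub>R frechet_derivative g (at (f x)) b)) (at x)"
      using linear_Basis_expansion[OF has_derivative_linear[OF g[OF y]]] by (metis (no_types, lifting) ext)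
  next
    fix v
    have "Ck_on k S (\<lambda>x. frechet_derivative f (at x) v \<bullet> b)" for b
      using Suc.prems(1) by (intro Ck_on_bounded_linear[OF bounded_linear_inner_left S]) simp
    moreover have "Ck_on k S (\<lambda>x. frechet_derivative g (at (f x)) b)" for b
      using Suc.prems Suc.prems(1)[THEN Ck_on_SucD] by (intro Suc.IH) simp_all
    ultimately show "Ck_on k S (\<lambda>x. \<Sum>b\<in>Basis. (frechet_derivative f (at x) v \<bullet> b) *\<^sub>R
        frechet_derivative g (at (f x)) b)"
      by (intro Ck_on_sum[OF S] Ck_on_bounded_bilinear[OF bounded_bilinear_scaleR S])
  qed
qed

text \<open>The derivative \<open>- (inverse x * h * inverse x)\<close> is again built from
  \<open>inverse\<close>, so the induction closes. The two-sided form is what holds for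
  quaternions.\<close>

lemma Ck_on_inverse:
  "Ck_on k (- {0}) (inverse :: 'a::real_normed_div_algebra \<Rightarrow> 'a)"
proof (induction k)
  case 0
  then show ?case
    by (auto intro!: continuous_intros)
next
  case (Suc k)
  have o: "open (- {0::'a})" by (simp add: open_Compl)
  show ?case
  proof (rule Ck_on_SucI[OF o])
    show "(inverse has_derivative (\<lambda>h. - (inverse x * h * inverse x))) (at x)" if "x \<in> - {0}" for x :: 'a
      using that by (intro has_derivative_inverse') simp
    fix v :: 'a
    have "Ck_on k (- {0}) (\<lambda>x. inverse x * v * inverse x)"
      by (intro Ck_on_bounded_bilinear[OF bounded_bilinear_mult o] Ck_on_const Suc)
    then show "Ck_on k (- {0}) (\<lambda>x. - (inverse x * v * inverse x))"
      by (rule Ck_on_bounded_linear[OF bounded_linear_minus[OF bounded_linear_ident] o])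
  qed
qed

text \<open>Openness is part of the notion so that most closure rules can be chained without side
  conditions.\<close>

definition Cinf_on :: "'a::real_normed_vector set \<Rightarrow> ('a \<Rightarrow> 'b::real_normed_vector) \<Rightarrow> bool" where
  "Cinf_on S f \<longleftrightarrow> open S \<and> (\<forall>k. Ck_on k S f)"

lemma Cinf_on_imp_open: "Cinf_on S f \<Longrightarrow> open S"
  by (simp add: Cinf_on_def)

lemma Cinf_on_cong: "(\<And>y. y \<in> S \<Longrightarrow> f y = g y) \<Longrightarrow> Cinf_on S f \<longleftrightarrow> Cinf_on S g"
  unfolding Cinf_on_def using Ck_on_cong by blast

lemma Cinf_on_subset: "Cinf_on S f \<Longrightarrow> open T \<Longrightarrow> T \<subseteq> S \<Longrightarrow> Cinf_on T f"
  unfolding Cinf_on_def using Ck_on_subset by blast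

lemma Cinf_on_local:
  assumes "\<And>x. x \<in> S \<Longrightarrow> \<exists>U. x \<in> U \<and> Cinf_on U f" "open S"
  shows "Cinf_on S f"
  using assms Ck_on_local unfolding Cinf_on_def by metis

text \<open>On an open set a local extension agrees with \<open>f\<close> on a whole neighbourhood,
  so it carries no additional freedom.\<close>

lemma smooth_on_iff_Cinf_on:
  assumes "open S"
  shows "smooth_on S f \<longleftrightarrow> Cinf_on S f"
proof
  assume *: "smooth_on S f"
  show "Cinf_on S f"
  proof (rule Cinf_on_local[OF _ assms])
    fix x assume "x \<in> S"
    then obtain U F where U: "open U" "x \<in> U" "\<forall>k. Ck_on k U F" "\<forall>y\<in>S \<inter> U. F y = f y"
      using * unfolding smooth_on_def by blast
    have "Cinf_on (S \<inter> U) F"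
      using U assms unfolding Cinf_on_def by (auto intro: Ck_on_subset)
    then have "Cinf_on (S \<inter> U) f"
      using Cinf_on_cong[of "S \<inter> U" F f] U(4) by blast
    then show "\<exists>U. x \<in> U \<and> Cinf_on U f"
      using \<open>x \<in> S\<close> U by blast
  qed
next
  assume *: "Cinf_on S f"
  show "smooth_on S f"
    unfolding smooth_on_def
  proof
    fix x assume "x \<in> S"
    then show "\<exists>U F. open U \<and> x \<in> U \<and> (\<forall>k. Ck_on k U F) \<and> (\<forall>y\<in>S \<inter> U. F y = f y)"
      using * assms by (intro exI[of _ S] exI[of _ f]) (auto simp: Cinf_on_def)
  qed
qed

lemma Cinf_on_has_derivative:
  "Cinf_on S f \<Longrightarrow> x \<in> S \<Longrightarrow> (f has_derivative frechet_derivative f (at x)) (at x)"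
  unfolding Cinf_on_def using has_derivative_frechet by blast

lemma Cinf_on_continuous: "Cinf_on S f \<Longrightarrow> continuous_on S f"
  unfolding Cinf_on_def using Ck_on_continuous by blast

lemma Cinf_on_derivative: "Cinf_on S f \<Longrightarrow> Cinf_on S (\<lambda>x. frechet_derivative f (at x) v)"
  unfolding Cinf_on_def using Ck_on.simps(2) by blast

lemma Cinf_on_linear_derivative: "Cinf_on S f \<Longrightarrow> x \<in> S \<Longrightarrow> linear (frechet_derivative f (at x))"
  using Cinf_on_has_derivative has_derivative_linear by blast

lemma Cinf_on_const: "open S \<Longrightarrow> Cinf_on S (\<lambda>x. c)"
  by (simp add: Cinf_on_def Ck_on_const)

lemma Cinf_on_id: "open S \<Longrightarrow> Cinf_on S (\<lambda>x. x)"
proof -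
  assume S: "open S"
  have "Ck_on k S (\<lambda>x. x)" for k
  proof (cases k)
    case (Suc j)
    then show ?thesis
      using Ck_on_SucI[OF S has_derivative_ident Ck_on_const] by simp
  qed simp
  then show ?thesis using S by (simp add: Cinf_on_def)
qed

lemma Cinf_on_bounded_linear: "bounded_linear L \<Longrightarrow> Cinf_on S f \<Longrightarrow> Cinf_on S (\<lambda>x. L (f x))"
  unfolding Cinf_on_def using Ck_on_bounded_linear by blast

lemma Cinf_on_bounded_linear_id: "bounded_linear L \<Longrightarrow> open S \<Longrightarrow> Cinf_on S L"
  using Cinf_on_bounded_linear[OF _ Cinf_on_id] by blast

lemma Cinf_on_add: "Cinf_on S f \<Longrightarrow> Cinf_on S g \<Longrightarrow> Cinf_on S (\<lambda>x. f x + g x)"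
  unfolding Cinf_on_def using Ck_on_add by blast

lemma Cinf_on_minus: "Cinf_on S f \<Longrightarrow> Cinf_on S (\<lambda>x. - f x)"
  using Cinf_on_bounded_linear[OF bounded_linear_minus[OF bounded_linear_ident]] .

lemma Cinf_on_sum: "open S \<Longrightarrow> (\<And>i. i \<in> I \<Longrightarrow> Cinf_on S (f i)) \<Longrightarrow> Cinf_on S (\<lambda>x. \<Sum>i\<in>I. f i x)"
  unfolding Cinf_on_def by (auto intro!: Ck_on_sum)

lemma Cinf_on_bounded_bilinear:
  "bounded_bilinear B \<Longrightarrow> Cinf_on S f \<Longrightarrow> Cinf_on S g \<Longrightarrow> Cinf_on S (\<lambda>x. B (f x) (g x))"
  unfolding Cinf_on_def using Ck_on_bounded_bilinear by blast

lemmas Cinf_on_mult = Cinf_on_bounded_bilinear[OF bounded_bilinear_mult]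
lemmas Cinf_on_scaleR = Cinf_on_bounded_bilinear[OF bounded_bilinear_scaleR]

lemma Cinf_on_prod:
  fixes f :: "'i \<Rightarrow> 'a::real_normed_vector \<Rightarrow> 'b::{real_normed_algebra_1,comm_ring_1}"
  shows "open S \<Longrightarrow> (\<And>i. i \<in> I \<Longrightarrow> Cinf_on S (f i)) \<Longrightarrow> Cinf_on S (\<lambda>x. \<Prod>i\<in>I. f i x)"
  by (induction I rule: infinite_finite_induct) (auto intro: Cinf_on_const Cinf_on_mult)

lemma Cinf_on_compose:
  fixes f :: "'a::real_normed_vector \<Rightarrow> 'b::euclidean_space"
  shows "Cinf_on S f \<Longrightarrow> Cinf_on T g \<Longrightarrow> f ` S \<subseteq> T \<Longrightarrow> Cinf_on S (\<lambda>x. g (f x))"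
  unfolding Cinf_on_def using Ck_on_compose by blast

lemma Cinf_on_preimage:
  fixes f :: "'a::real_normed_vector \<Rightarrow> 'b::euclidean_space"
  assumes "Cinf_on S f" "Cinf_on T g"
  shows "Cinf_on (S \<inter> f -` T) (\<lambda>x. g (f x))"
proof -
  have "open (S \<inter> f -` T)"
    using assms Cinf_on_continuous continuous_on_open_vimage Cinf_on_imp_open by (metis Int_commute)
  then have "Cinf_on (S \<inter> f -` T) f"
    using assms(1) Cinf_on_subset by blast
  then show ?thesis
    using Cinf_on_compose[OF _ assms(2)] by blast
qed

lemma Cinf_on_inverse:
  fixes f :: "'a::real_normed_vector \<Rightarrow> 'b::{real_normed_div_algebra,euclidean_space}"
  assumes "Cinf_on S f" "\<And>x. x \<in> S \<Longrightarrow> f x \<noteq> 0"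
  shows "Cinf_on S (\<lambda>x. inverse (f x))"
  by (rule Cinf_on_compose[OF assms(1), of "- {0}"]) (use assms(2) Ck_on_inverse in \<open>auto simp: Cinf_on_def\<close>)

text \<open>Jacobians of coordinate changes get applied to vectors that vary with the point; the
  basis expansion separates the two dependencies.\<close>

lemma Cinf_on_apply_derivative:
  fixes f :: "'a::euclidean_space \<Rightarrow> 'b::real_normed_vector" and y z :: "'c::real_normed_vector \<Rightarrow> 'a"
  assumes "Cinf_on T f" "Cinf_on S y" "y ` S \<subseteq> T" "Cinf_on S z"
  shows "Cinf_on S (\<lambda>x. frechet_derivative f (at (y x)) (z x))"
proof -
  have S: "open S" using assms(2) by (rule Cinf_on_imp_open)
  have "Cinf_on S (\<lambda>x. \<Sum>b\<in>Basis. (z x \<bullet> b) *\<^sub>R frechet_derivative f (at (y x)) b)"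
    by (intro Cinf_on_sum[OF S] Cinf_on_scaleR Cinf_on_compose[OF assms(2) Cinf_on_derivative[OF assms(1)] assms(3)]
        Cinf_on_bounded_linear[OF bounded_linear_inner_left assms(4)])
  moreover have "frechet_derivative f (at (y x)) (z x) = (\<Sum>b\<in>Basis. (z x \<bullet> b) *\<^sub>R frechet_derivative f (at (y x)) b)"
    if "x \<in> S" for x
    using linear_Basis_expansion[OF Cinf_on_linear_derivative[OF assms(1)]] assms(3) that by blast
  ultimately show ?thesis
    using Cinf_on_cong by (metis (mono_tags, lifting))
qed

lemma bounded_linear_axis: "bounded_linear (axis i :: 'a::real_normed_vector \<Rightarrow> 'a^'n)"
proof
  show "axis i (x + y) = axis i x + axis i y" "axis i (r *\<^sub>R x) = r *\<^sub>R axis i x" for x y :: 'a and r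
    by (auto simp: axis_def vec_eq_iff)
  show "\<exists>K. \<forall>x::'a. norm (axis i x) \<le> norm x * K"
    by (rule exI[of _ 1])
      (simp add: norm_vec_def L2_set_def axis_def if_distrib[of norm] if_distrib[of "\<lambda>r. r\<^sup>2"] cong: if_cong)
qed

text \<open>Turns a componentwise construction into a finite sum of bounded linear images, for which
  smoothness and derivatives are available.\<close>

lemma vec_lambda_axis: "(\<chi> i. f i) = (\<Sum>i\<in>UNIV. axis i (f i :: 'a::comm_monoid_add))"
  by (simp add: vec_eq_iff axis_def if_distrib cong: if_cong)

lemma Cinf_on_vec_lambda:
  fixes f :: "'n::finite \<Rightarrow> 'a::real_normed_vector \<Rightarrow> 'b::real_normed_vector"
  assumes "open S" "\<And>i. Cinf_on S (f i)"
  shows "Cinf_on S (\<lambda>x. \<chi> i. f i x)"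
  unfolding vec_lambda_axis
  by (intro Cinf_on_sum[OF assms(1)] Cinf_on_bounded_linear[OF bounded_linear_axis] assms(2))

lemma has_derivative_vec_lambda:
  fixes f :: "'n::finite \<Rightarrow> 'a::real_normed_vector \<Rightarrow> 'b::real_normed_vector"
  assumes "\<And>i. (f i has_derivative D i) F"
  shows "((\<lambda>x. \<chi> i. f i x) has_derivative (\<lambda>v. \<chi> i. D i v)) F"
  unfolding vec_lambda_axis
  by (intro has_derivative_sum bounded_linear.has_derivative[OF bounded_linear_axis] assms)

lemma Cinf_on_nth: "Cinf_on S f \<Longrightarrow> Cinf_on S (\<lambda>x. f x $ i)"
  using Cinf_on_bounded_linear[OF bounded_linear_vec_nth] .

lemma Cinf_on_Pair:
  fixes f :: "'a::real_normed_vector \<Rightarrow> 'b::real_normed_vector"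
    and g :: "'a \<Rightarrow> 'c::real_normed_vector"
  assumes "Cinf_on S f" "Cinf_on S g"
  shows "Cinf_on S (\<lambda>x. (f x, g x))"
proof -
  have "bounded_linear (\<lambda>x::'b. (x, 0::'c))"
    using bounded_linear_Pair[OF bounded_linear_ident bounded_linear_zero] .
  from Cinf_on_bounded_linear[OF this assms(1)] have 1: "Cinf_on S (\<lambda>x. (f x, 0::'c))" .
  have "bounded_linear (\<lambda>y::'c. (0::'b, y))"
    using bounded_linear_Pair[OF bounded_linear_zero bounded_linear_ident] .
  from Cinf_on_bounded_linear[OF this assms(2)] have 2: "Cinf_on S (\<lambda>x. (0::'b, g x))" .
  have "Cinf_on S (\<lambda>x. (f x, 0::'c) + (0::'b, g x))"
    by (rule Cinf_on_add[OF 1 2])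
  then show ?thesis by simp
qed

lemma Cinf_on_fst: "Cinf_on S f \<Longrightarrow> Cinf_on S (\<lambda>x. fst (f x))"
  using Cinf_on_bounded_linear[OF bounded_linear_fst] .

lemma Cinf_on_snd: "Cinf_on S f \<Longrightarrow> Cinf_on S (\<lambda>x. snd (f x))"
  using Cinf_on_bounded_linear[OF bounded_linear_snd] .

lemma bounded_bilinear_matrix_mult:
  "bounded_bilinear ((**) :: 'a::{real_normed_algebra_1,euclidean_space}^'m^'n \<Rightarrow> 'a^'p^'m \<Rightarrow> 'a^'p^'n)"
proof -
  have "bilinear ((**) :: 'a^'m^'n \<Rightarrow> 'a^'p^'m \<Rightarrow> 'a^'p^'n)"
    unfolding bilinear_def
    by (auto intro!: linearI simp: matrix_matrix_mult_def vec_eq_iff sum.distrib distrib_left distrib_right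
        scaleR_sum_right)
  then show ?thesis
    by (simp add: bilinear_conv_bounded_bilinear)
qed

lemmas Cinf_on_matrix_mult = Cinf_on_bounded_bilinear[OF bounded_bilinear_matrix_mult]

lemma Cinf_on_det:
  fixes A :: "'a::real_normed_vector \<Rightarrow> 'b::{real_normed_field}^'n^'n"
  assumes "Cinf_on S A"
  shows "Cinf_on S (\<lambda>x. det (A x))"
  unfolding det_def using Cinf_on_imp_open[OF assms]
  by (intro Cinf_on_sum Cinf_on_mult Cinf_on_const Cinf_on_prod Cinf_on_nth assms)

lemmas Cinf_intros = Cinf_on_const Cinf_on_id Cinf_on_add Cinf_on_minus Cinf_on_sum Cinf_on_mult
  Cinf_on_scaleR Cinf_on_vec_lambda Cinf_on_nth Cinf_on_Pair Cinf_on_fst Cinf_on_snd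
  Cinf_on_matrix_mult Cinf_on_det Cinf_on_inverse

subsection \<open>Symmetry of second derivatives\<close>

lemma derivative_along_line:
  fixes f :: "'a::real_normed_vector \<Rightarrow> real"
  assumes "f differentiable (at (x + s *\<^sub>R u))"
  shows "((\<lambda>s. f (x + s *\<^sub>R u)) has_real_derivative frechet_derivative f (at (x + s *\<^sub>R u)) u) (at s)"
proof -
  have 1: "((\<lambda>s. x + s *\<^sub>R u) has_derivative (\<lambda>h. h *\<^sub>R u)) (at s)"
    by (auto intro!: derivative_eq_intros)
  have 2: "(f has_derivative frechet_derivative f (at (x + s *\<^sub>R u))) (at (x + s *\<^sub>R u))"
    using assms frechet_derivative_works by blast
  have "((\<lambda>s. f (x + s *\<^sub>R u)) has_derivative (\<lambda>h. frechet_derivative f (at (x + s *\<^sub>R u)) (h *\<^sub>R u))) (at s)"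
    by (rule has_derivative_compose[OF 1 2])
  then show ?thesis
    unfolding has_field_derivative_def
    using linear_cmul[OF has_derivative_linear[OF 2]] by (simp add: mult.commute[of _ "frechet_derivative _ _ _"])
qed

text \<open>The mean value theorem is applied twice, first in direction \<open>u\<close> to the
  difference of two translates, then in direction \<open>v\<close> to the derivative in direction
  \<open>u\<close>. The point is that the left side is symmetric in \<open>u\<close> and
  \<open>v\<close>.\<close>

lemma second_difference_mean_value:
  fixes f :: "'a::real_normed_vector \<Rightarrow> real"
  assumes "open S" and f: "Ck_on 2 S f" and t: "t > 0"
    and S: "\<And>a b. 0 \<le> a \<Longrightarrow> a \<le> t \<Longrightarrow> 0 \<le> b \<Longrightarrow> b \<le> t \<Longrightarrow> x + a *\<^sub>R u + b *\<^sub>R v \<in> S"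
  shows "\<exists>a b. 0 \<le> a \<and> a \<le> t \<and> 0 \<le> b \<and> b \<le> t \<and>
    f (x + t *\<^sub>R u + t *\<^sub>R v) - f (x + t *\<^sub>R u) - f (x + t *\<^sub>R v) + f x =
    t * (t * frechet_derivative (\<lambda>y. frechet_derivative f (at y) u) (at (x + a *\<^sub>R u + b *\<^sub>R v)) v)"
proof -
  have d1: "f differentiable (at y)" if "y \<in> S" for y
    using f that by (simp add: numeral_2_eq_2)
  have d2: "(\<lambda>y. frechet_derivative f (at y) u) differentiable (at y)" if "y \<in> S" for y
    using f that by (simp add: numeral_2_eq_2)
  define h where "h a = f (x + t *\<^sub>R v + a *\<^sub>R u) - f (x + a *\<^sub>R u)" for a
  have "\<exists>z. 0 < z \<and> z < t \<and> h t - h 0 = (t - 0) *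
      (frechet_derivative f (at (x + t *\<^sub>R v + z *\<^sub>R u)) u - frechet_derivative f (at (x + z *\<^sub>R u)) u)"
  proof (rule MVT2)
    fix a :: real assume a: "0 \<le> a" "a \<le> t"
    show "DERIV h a :> frechet_derivative f (at (x + t *\<^sub>R v + a *\<^sub>R u)) u - frechet_derivative f (at (x + a *\<^sub>R u)) u"
      unfolding h_def using S[OF a, of 0] S[OF a, of t] t
      by (intro DERIV_diff derivative_along_line d1) (auto simp: algebra_simps)
  qed (use t in auto)
  then obtain a where a: "0 < a" "a < t" and h: "h t - h 0 = t *
      (frechet_derivative f (at (x + t *\<^sub>R v + a *\<^sub>R u)) u - frechet_derivative f (at (x + a *\<^sub>R u)) u)"
    by auto
  let ?k = "\<lambda>b. frechet_derivative f (at (x + a *\<^sub>R u + b *\<^sub>R v)) u"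
  have "\<exists>z. 0 < z \<and> z < t \<and> ?k t - ?k 0 = (t - 0) *
      frechet_derivative (\<lambda>y. frechet_derivative f (at y) u) (at (x + a *\<^sub>R u + z *\<^sub>R v)) v"
  proof (rule MVT2)
    fix b :: real assume b: "0 \<le> b" "b \<le> t"
    show "DERIV ?k b :> frechet_derivative (\<lambda>y. frechet_derivative f (at y) u) (at (x + a *\<^sub>R u + b *\<^sub>R v)) v"
      by (rule derivative_along_line, rule d2, rule S) (use a b in auto)
  qed (use t in auto)
  then obtain b where b: "0 < b" "b < t" and k: "?k t - ?k 0 = t *
      frechet_derivative (\<lambda>y. frechet_derivative f (at y) u) (at (x + a *\<^sub>R u + b *\<^sub>R v)) v"
    by auto
  have "f (x + t *\<^sub>R u + t *\<^sub>R v) - f (x + t *\<^sub>R u) - f (x + t *\<^sub>R v) + f x = h t - h 0"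
    by (simp add: h_def algebra_simps)
  also have "\<dots> = t * (?k t - ?k 0)"
    using h by (simp add: add.commute add.left_commute)
  finally show ?thesis
    using a b k by (intro exI[of _ a] exI[of _ b]) auto
qed

text \<open>The symmetric second difference equals each mixed derivative at some point arbitrarily
  close to \<open>x\<close>; continuity of both mixed derivatives forces equality at
  \<open>x\<close>.\<close>

lemma second_derivative_symmetric_real:
  fixes f :: "'a::real_normed_vector \<Rightarrow> real"
  assumes S: "open S" "x \<in> S" and f: "Ck_on 2 S f"
  shows "frechet_derivative (\<lambda>y. frechet_derivative f (at y) u) (at x) v =
    frechet_derivative (\<lambda>y. frechet_derivative f (at y) v) (at x) u"
proof -
  let ?D = "\<lambda>u v y. frechet_derivative (\<lambda>y. frechet_derivative f (at y) u) (at y) v"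
  have cont: "isCont (?D u v) x" for u v
    using f S by (simp add: numeral_2_eq_2 continuous_on_eq_continuous_at)
  obtain r where r: "r > 0" "ball x r \<subseteq> S"
    using S openE by blast
  have close: "\<exists>y z. dist y x \<le> e \<and> dist z x \<le> e \<and> ?D u v y = ?D v u z" if e: "0 < e" "e < r" for e
  proof -
    \<comment> \<open>Side length for which the parallelogram spanned by \<open>t u\<close> and
      \<open>t v\<close> stays within distance \<open>e\<close> of \<open>x\<close>; the summand 1
      keeps the denominator positive when both vectors vanish.\<close>
    define t where "t = e / (norm u + norm v + 1)"
    have pos: "norm u + norm v + 1 > 0"
      by (smt (verit) norm_ge_zero)
    have t: "t > 0" using e pos by (simp add: t_def)
    have bd: "dist (x + a *\<^sub>R u + b *\<^sub>R v) x \<le> e" if "0 \<le> a" "a \<le> t" "0 \<le> b" "b \<le> t" for a b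
    proof -
      have "dist (x + a *\<^sub>R u + b *\<^sub>R v) x \<le> a * norm u + b * norm v"
        using norm_triangle_ineq[of "a *\<^sub>R u" "b *\<^sub>R v"] that by (simp add: dist_norm)
      also have "\<dots> \<le> t * norm u + t * norm v"
        using that by (intro add_mono mult_right_mono) auto
      also have "\<dots> \<le> t * (norm u + norm v + 1)"
        using t by (simp add: algebra_simps)
      also have "\<dots> = e" using pos by (simp add: t_def)
      finally show ?thesis .
    qed
    have in_S: "x + a *\<^sub>R u + b *\<^sub>R v \<in> S" if "0 \<le> a" "a \<le> t" "0 \<le> b" "b \<le> t" for a b
      using bd[OF that] r e by (auto simp: dist_commute)
    have in_S': "x + a *\<^sub>R v + b *\<^sub>R u \<in> S" if "0 \<le> a" "a \<le> t" "0 \<le> b" "b \<le> t" for a b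
      using in_S[of b a] that by (simp add: add.commute add.left_commute)
    obtain a b where ab: "0 \<le> a" "a \<le> t" "0 \<le> b" "b \<le> t"
      "f (x + t *\<^sub>R u + t *\<^sub>R v) - f (x + t *\<^sub>R u) - f (x + t *\<^sub>R v) + f x = t * (t * ?D u v (x + a *\<^sub>R u + b *\<^sub>R v))"
      using second_difference_mean_value[OF S(1) f t, of x u v] in_S by metis
    obtain c d where cd: "0 \<le> c" "c \<le> t" "0 \<le> d" "d \<le> t"
      "f (x + t *\<^sub>R v + t *\<^sub>R u) - f (x + t *\<^sub>R v) - f (x + t *\<^sub>R u) + f x = t * (t * ?D v u (x + c *\<^sub>R v + d *\<^sub>R u))"
      using second_difference_mean_value[OF S(1) f t, of x v u] in_S' by metis
    have "t * (t * ?D u v (x + a *\<^sub>R u + b *\<^sub>R v)) = t * (t * ?D v u (x + c *\<^sub>R v + d *\<^sub>R u))"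
      using ab(5) cd(5) by (simp add: algebra_simps)
    then have "?D u v (x + a *\<^sub>R u + b *\<^sub>R v) = ?D v u (x + c *\<^sub>R v + d *\<^sub>R u)"
      using t by simp
    moreover have "dist (x + c *\<^sub>R v + d *\<^sub>R u) x \<le> e"
      using bd[of d c] cd by (simp add: add.commute add.left_commute)
    ultimately show ?thesis
      using bd[OF ab(1-4)] by blast
  qed
  show ?thesis
  proof (rule ccontr)
    assume ne: "?D u v x \<noteq> ?D v u x"
    define \<epsilon> where "\<epsilon> = \<bar>?D u v x - ?D v u x\<bar> / 2"
    have "\<epsilon> > 0" using ne by (simp add: \<epsilon>_def)
    then obtain d1 d2 where d: "d1 > 0" "\<And>y. dist y x < d1 \<Longrightarrow> dist (?D u v y) (?D u v x) < \<epsilon>"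
      "d2 > 0" "\<And>y. dist y x < d2 \<Longrightarrow> dist (?D v u y) (?D v u x) < \<epsilon>"
      using cont[of u v] cont[of v u] unfolding continuous_at_eps_delta by metis
    define e where "e = min r (min d1 d2) / 2"
    have e: "0 < e" "e < r" "e < d1" "e < d2"
      using d r by (auto simp: e_def min_def)
    obtain y z where "dist y x \<le> e" "dist z x \<le> e" "?D u v y = ?D v u z"
      using close[OF e(1,2)] by blast
    then show False
      using d(2)[of y] d(4)[of z] e unfolding \<epsilon>_def dist_real_def by (smt (verit) field_sum_of_halves)
  qed
qed

lemma frechet_derivative_inner:
  assumes "f differentiable (at x)"
  shows "frechet_derivative (\<lambda>y. f y \<bullet> b) (at x) v = frechet_derivative f (at x) v \<bullet> b"
  using frechet_derivative_eqI[OF bounded_linear.has_derivative[OF bounded_linear_inner_left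
        assms[unfolded frechet_derivative_works]], of b] by simp

lemma second_derivative_symmetric:
  fixes f :: "'a::real_normed_vector \<Rightarrow> 'b::euclidean_space"
  assumes f: "Cinf_on S f" and x: "x \<in> S"
  shows "frechet_derivative (\<lambda>y. frechet_derivative f (at y) u) (at x) v =
    frechet_derivative (\<lambda>y. frechet_derivative f (at y) v) (at x) u"
proof (rule euclidean_eqI)
  fix b :: 'b assume "b \<in> Basis"
  have S: "open S" using f by (rule Cinf_on_imp_open)
  have diff: "g differentiable (at y)" if "Cinf_on S g" "y \<in> S" for g :: "'a \<Rightarrow> 'b" and y
    using Cinf_on_has_derivative[OF that] differentiable_def by blast
  have eq: "frechet_derivative (\<lambda>y. frechet_derivative f (at y) u) (at x) v \<bullet> b =
     frechet_derivative (\<lambda>y. frechet_derivative (\<lambda>y. f y \<bullet> b) (at y) u) (at x) v" for u v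
  proof -
    have "frechet_derivative (\<lambda>y. frechet_derivative f (at y) u) (at x) v \<bullet> b =
      frechet_derivative (\<lambda>y. frechet_derivative f (at y) u \<bullet> b) (at x) v"
      using frechet_derivative_inner[OF diff[OF Cinf_on_derivative[OF f] x]] by simp
    also have "frechet_derivative (\<lambda>y. frechet_derivative f (at y) u \<bullet> b) (at x) =
      frechet_derivative (\<lambda>y. frechet_derivative (\<lambda>y. f y \<bullet> b) (at y) u) (at x)"
      by (rule frechet_derivative_cong[OF S x]) (simp add: frechet_derivative_inner[OF diff[OF f]])
    finally show ?thesis .
  qed
  have "Ck_on 2 S (\<lambda>y. f y \<bullet> b)"
    using Cinf_on_bounded_linear[OF bounded_linear_inner_left f] by (simp add: Cinf_on_def)
  then show "frechet_derivative (\<lambda>y. frechet_derivative f (at y) u) (at x) v \<bullet> b =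
    frechet_derivative (\<lambda>y. frechet_derivative f (at y) v) (at x) u \<bullet> b"
    unfolding eq by (rule second_derivative_symmetric_real[OF S x])
qed

section \<open>Coordinate calculus on manifolds\<close>

text \<open>For \<open>f = id\<close> this is the Jacobian of a coordinate change, so chart changes
  and push-forwards share one chain rule.\<close>

definition chart_deriv ::
  "('m \<Rightarrow> 'n) \<Rightarrow> 'm \<Rightarrow> ('m, 'e::euclidean_space) chart \<Rightarrow> ('n, 'f::euclidean_space) chart \<Rightarrow> 'e \<Rightarrow> 'f" where
  "chart_deriv f p c d = frechet_derivative (snd d \<circ> f \<circ> chart_inv c) (at (snd c p))"

lemma chart_inv_right:
  assumes "x \<in> snd c ` fst c"
  shows "chart_inv c x \<in> fst c" "snd c (chart_inv c x) = x"
  using assms unfolding chart_inv_def by (auto intro: inv_into_into f_inv_into_f)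

lemma manifold_inj: "smooth_manifold M \<Longrightarrow> c \<in> charts M \<Longrightarrow> inj_on (snd c) (fst c)"
  by (simp add: smooth_manifold_def)

lemma chart_inv_left:
  "smooth_manifold M \<Longrightarrow> c \<in> charts M \<Longrightarrow> p \<in> fst c \<Longrightarrow> chart_inv c (snd c p) = p"
  unfolding chart_inv_def using inv_into_f_f[OF manifold_inj] by metis

lemma chart_subset_points: "smooth_manifold M \<Longrightarrow> c \<in> charts M \<Longrightarrow> fst c \<subseteq> points M"
  unfolding smooth_manifold_def by blast

lemma charts_atD: "c \<in> charts_at M p \<Longrightarrow> c \<in> charts M" "c \<in> charts_at M p \<Longrightarrow> p \<in> fst c"
  by (auto simp: charts_at_def)

lemma smooth_map_rep:
  assumes "smooth_map M N f" "c \<in> charts M" "d \<in> charts N"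
  shows "Cinf_on (snd c ` (fst c \<inter> f -` fst d)) (snd d \<circ> f \<circ> chart_inv c)"
  using assms smooth_on_iff_Cinf_on unfolding smooth_map_def by blast

lemma smooth_map_id: "smooth_manifold M \<Longrightarrow> smooth_map M M id"
  by (simp add: smooth_map_def smooth_manifold_def)

lemma transition_smooth:
  assumes "smooth_manifold M" "c \<in> charts M" "d \<in> charts M"
  shows "Cinf_on (snd c ` (fst c \<inter> fst d)) (snd d \<circ> chart_inv c)"
  using smooth_map_rep[OF smooth_map_id[OF assms(1)] assms(2,3)] by simp

lemma smooth_map_has_derivative:
  assumes "smooth_map M N f" "c \<in> charts_at M p" "d \<in> charts_at N (f p)"
  shows "(snd d \<circ> f \<circ> chart_inv c has_derivative chart_deriv f p c d) (at (snd c p))"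
  unfolding chart_deriv_def
  by (rule Cinf_on_has_derivative[OF smooth_map_rep[OF assms(1)]]) (use assms(2,3) in \<open>auto simp: charts_at_def\<close>)

lemma linear_chart_deriv:
  "smooth_map M N f \<Longrightarrow> c \<in> charts_at M p \<Longrightarrow> d \<in> charts_at N (f p) \<Longrightarrow> linear (chart_deriv f p c d)"
  by (rule has_derivative_linear[OF smooth_map_has_derivative])

lemma chart_deriv_eqI:
  assumes "(snd d \<circ> f \<circ> chart_inv c has_derivative D) (at (snd c p))"
  shows "chart_deriv f p c d = D"
  unfolding chart_deriv_def by (rule frechet_derivative_eqI[OF assms])

text \<open>Inserting the chart \<open>d\<close> and its inverse changes nothing where
  \<open>f\<close> lands in the domain of \<open>d\<close>; this set is open in the coordinates of
  \<open>c\<close>, so the derivative is unaffected.\<close>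

lemma chart_deriv_compose:
  assumes M: "smooth_manifold M" and N: "smooth_manifold N"
    and f: "smooth_map M N f" and h: "smooth_map N K h"
    and c: "c \<in> charts_at M p" and d: "d \<in> charts_at N (f p)" and e: "e \<in> charts_at K (h (f p))"
  shows "chart_deriv (h \<circ> f) p c e = chart_deriv h (f p) d e \<circ> chart_deriv f p c d"
proof (rule chart_deriv_eqI)
  let ?W = "snd c ` (fst c \<inter> f -` fst d)"
  have W: "open ?W"
    by (rule Cinf_on_imp_open[OF smooth_map_rep[OF f charts_atD(1)[OF c] charts_atD(1)[OF d]]])
  have p: "snd c p \<in> ?W"
    using c d by (auto simp: charts_at_def)
  have inv: "chart_inv c (snd c p) = p"
    using chart_inv_left[OF M] c by (simp add: charts_at_def)
  have 1: "((snd e \<circ> h \<circ> chart_inv d) \<circ> (snd d \<circ> f \<circ> chart_inv c) has_derivative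
      chart_deriv h (f p) d e \<circ> chart_deriv f p c d) (at (snd c p))"
    by (rule diff_chain_at[OF smooth_map_has_derivative[OF f c d]])
      (use smooth_map_has_derivative[OF h d e] inv in simp)
  show "(snd e \<circ> (h \<circ> f) \<circ> chart_inv c has_derivative
      chart_deriv h (f p) d e \<circ> chart_deriv f p c d) (at (snd c p))"
  proof (rule has_derivative_transform_within_open[OF 1 W p])
    fix x assume "x \<in> ?W"
    then obtain q where "q \<in> fst c" "f q \<in> fst d" "x = snd c q" by auto
    then show "((snd e \<circ> h \<circ> chart_inv d) \<circ> (snd d \<circ> f \<circ> chart_inv c)) x = (snd e \<circ> (h \<circ> f) \<circ> chart_inv c) x"
      using chart_inv_left[OF M] chart_inv_left[OF N] c d by (simp add: charts_at_def)
  qed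
qed

lemma chart_deriv_id_same:
  assumes M: "smooth_manifold M" and c: "c \<in> charts_at M p"
  shows "chart_deriv id p c c = id"
proof (rule chart_deriv_eqI)
  have o: "open (snd c ` fst c)"
    using M c by (simp add: smooth_manifold_def charts_at_def)
  have p: "snd c p \<in> snd c ` fst c"
    using c by (simp add: charts_at_def)
  have 1: "((\<lambda>x. x) has_derivative id) (at (snd c p))"
    unfolding id_def by (rule has_derivative_ident)
  show "(snd c \<circ> id \<circ> chart_inv c has_derivative id) (at (snd c p))"
    by (rule has_derivative_transform_within_open[OF 1 o p]) (simp add: chart_inv_right)
qed

lemma chart_deriv_change:
  assumes "smooth_manifold M" "c \<in> charts_at M p" "d \<in> charts_at M p" "e \<in> charts_at M p"
  shows "chart_deriv id p d e (chart_deriv id p c d u) = chart_deriv id p c e u"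
  using chart_deriv_compose[OF assms(1,1) smooth_map_id smooth_map_id, of c p d e] assms
  by (simp add: fun_eq_iff)

section \<open>Tangent vectors, push-forwards and velocities in coordinates\<close>

lemma coord_vec_alt:
  "coord_vec M p c u = (\<lambda>d. if d \<in> charts_at M p then chart_deriv id p c d u else 0)"
  by (auto simp: coord_vec_def chart_deriv_def fun_eq_iff)

lemma coord_vec_same:
  "smooth_manifold M \<Longrightarrow> c \<in> charts_at M p \<Longrightarrow> coord_vec M p c u c = u"
  by (simp add: coord_vec_alt chart_deriv_id_same)

lemma coord_vec_change:
  assumes "smooth_manifold M" "c \<in> charts_at M p" "d \<in> charts_at M p"
  shows "coord_vec M p c u = coord_vec M p d (chart_deriv id p c d u)"
  using assms by (auto simp: coord_vec_alt chart_deriv_change)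

lemma tangent_space_alt:
  "tangent_space M p =
     {v. (\<forall>c. c \<notin> charts_at M p \<longrightarrow> v c = 0) \<and>
         (\<forall>c\<in>charts_at M p. \<forall>d\<in>charts_at M p. v d = chart_deriv id p c d (v c))}"
  by (simp add: tangent_space_def chart_deriv_def)

lemma coord_vec_in_tangent_space:
  "smooth_manifold M \<Longrightarrow> c \<in> charts_at M p \<Longrightarrow> coord_vec M p c u \<in> tangent_space M p"
  by (auto simp: tangent_space_alt coord_vec_alt chart_deriv_change)

lemma tangent_space_eq_coord_vec:
  assumes "v \<in> tangent_space M p" "c \<in> charts_at M p"
  shows "coord_vec M p c (v c) = v"
proof
  fix d
  show "coord_vec M p c (v c) d = v d"
  proof (cases "d \<in> charts_at M p")
    case True
    then have "v d = chart_deriv id p c d (v c)"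
      using assms unfolding tangent_space_alt by blast
    then show ?thesis using True by (simp add: coord_vec_alt)
  next
    case False
    then have "v d = 0" using assms(1) unfolding tangent_space_alt by blast
    then show ?thesis using False by (simp add: coord_vec_alt)
  qed
qed

lemma coord_vec_scaleR:
  assumes "smooth_manifold M" "c \<in> charts_at M p"
  shows "coord_vec M p c (r *\<^sub>R u) = (\<lambda>d. r *\<^sub>R coord_vec M p c u d)"
  using linear_chart_deriv[OF smooth_map_id[OF assms(1)] assms(2)]
  by (auto simp: coord_vec_alt linear_cmul)

lemma coord_vec_eq_zero_iff:
  assumes "smooth_manifold M" "c \<in> charts_at M p"
  shows "coord_vec M p c u = (\<lambda>_. 0) \<longleftrightarrow> u = 0"
  using coord_vec_scaleR[OF assms, of 0 u] coord_vec_same[OF assms, of u] by auto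

text \<open>\<open>pushforward\<close> reads the vector in an arbitrarily chosen chart at
  \<open>p\<close>; the chain rule makes the result independent of that choice and of the target
  chart \<open>d\<close>.\<close>

lemma pushforward_coord_vec:
  assumes M: "smooth_manifold M" and N: "smooth_manifold N" and f: "smooth_map M N f"
    and c: "c \<in> charts_at M p" and d: "d \<in> charts_at N (f p)"
  shows "pushforward M N f p (coord_vec M p c u) = coord_vec N (f p) d (chart_deriv f p c d u)"
proof -
  define b where "b = (SOME c. c \<in> charts_at M p)"
  have b: "b \<in> charts_at M p"
    unfolding b_def using c by (rule someI)
  have 1: "chart_deriv f p b e (chart_deriv id p c b u) = chart_deriv f p c e u"
    if "e \<in> charts_at N (f p)" for e
    using chart_deriv_compose[OF M M smooth_map_id[OF M] f c, of b e] b that by (simp add: fun_eq_iff)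
  have 2: "chart_deriv id (f p) d e (chart_deriv f p c d u) = chart_deriv f p c e u"
    if "e \<in> charts_at N (f p)" for e
    using chart_deriv_compose[OF M N f smooth_map_id[OF N] c d, of e] that by (simp add: fun_eq_iff)
  have "pushforward M N f p (coord_vec M p c u) =
      (\<lambda>e. if e \<in> charts_at N (f p) then chart_deriv f p b e (coord_vec M p c u b) else 0)"
    unfolding pushforward_def chart_deriv_def Let_def b_def ..
  then show ?thesis
    using b 1 2 by (auto simp: coord_vec_alt)
qed

lemma pushforward_apply:
  assumes M: "smooth_manifold M" and N: "smooth_manifold N" and f: "smooth_map M N f"
    and c: "c \<in> charts_at M p" and d: "d \<in> charts_at N (f p)" and v: "v \<in> tangent_space M p"
  shows "pushforward M N f p v = coord_vec N (f p) d (chart_deriv f p c d (v c))"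
  using pushforward_coord_vec[OF M N f c d, of "v c"] tangent_space_eq_coord_vec[OF v c] by simp

lemma velocity_eq_coord_vec:
  assumes M: "smooth_manifold M" and c: "c \<in> charts_at M (\<alpha> 0)"
    and ev: "eventually (\<lambda>t. \<alpha> t \<in> fst c) (nhds 0)"
    and deriv: "(snd c \<circ> \<alpha> has_vector_derivative u) (at 0)"
  shows "velocity M \<alpha> = coord_vec M (\<alpha> 0) c u"
proof -
  have "vector_derivative (snd d \<circ> \<alpha>) (at 0) = chart_deriv id (\<alpha> 0) c d u" if d: "d \<in> charts_at M (\<alpha> 0)" for d
  proof (rule vector_derivative_at)
    have "(snd d \<circ> id \<circ> chart_inv c has_derivative chart_deriv id (\<alpha> 0) c d) (at ((snd c \<circ> \<alpha>) 0))"
      using smooth_map_has_derivative[OF smooth_map_id[OF M] c, of d] d by simp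
    from diff_chain_at[OF deriv[unfolded has_vector_derivative_def] this]
    have 1: "(snd d \<circ> id \<circ> chart_inv c \<circ> (snd c \<circ> \<alpha>) has_derivative
        chart_deriv id (\<alpha> 0) c d \<circ> (\<lambda>h. h *\<^sub>R u)) (at 0)" .
    have ev': "eventually (\<lambda>t. (snd d \<circ> id \<circ> chart_inv c \<circ> (snd c \<circ> \<alpha>)) t = (snd d \<circ> \<alpha>) t) (nhds 0)"
      using ev by (rule eventually_mono) (use chart_inv_left[OF M] c in \<open>simp add: charts_at_def\<close>)
    have "(snd d \<circ> \<alpha> has_derivative chart_deriv id (\<alpha> 0) c d \<circ> (\<lambda>h. h *\<^sub>R u)) (at 0)"
      by (rule has_derivative_transform_eventually[OF 1])
        (use ev' eventually_nhds_x_imp_x[OF ev'] in \<open>auto simp: eventually_at_filter elim: eventually_mono\<close>)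
    moreover have "chart_deriv id (\<alpha> 0) c d \<circ> (\<lambda>h. h *\<^sub>R u) = (\<lambda>h. h *\<^sub>R chart_deriv id (\<alpha> 0) c d u)"
      using linear_chart_deriv[OF smooth_map_id[OF M] c, of d] d by (auto simp: linear_cmul)
    ultimately show "(snd d \<circ> \<alpha> has_vector_derivative chart_deriv id (\<alpha> 0) c d u) (at 0)"
      by (simp add: has_vector_derivative_def)
  qed
  then show ?thesis
    by (auto simp: velocity_def coord_vec_alt)
qed

section \<open>Two-forms under coordinate changes and a criterion for closedness\<close>

lemma form_rep_eq:
  assumes "smooth_manifold M" "c \<in> charts_at M p"
  shows "form_rep M \<omega> c (snd c p) u v = \<omega> p (coord_vec M p c u) (coord_vec M p c v)"
  using chart_inv_left[OF assms(1)] assms(2) by (simp add: form_rep_def charts_at_def)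

lemma form_rep_change:
  assumes "smooth_manifold M" "c \<in> charts_at M p" "d \<in> charts_at M p"
  shows "form_rep M \<omega> c (snd c p) u v =
    form_rep M \<omega> d (snd d p) (chart_deriv id p c d u) (chart_deriv id p c d v)"
  using assms by (simp add: form_rep_eq coord_vec_change[of M c p d])

lemma form_rep_pullback:
  assumes M: "smooth_manifold M" and N: "smooth_manifold N" and f: "smooth_map N M f"
    and c: "c \<in> charts_at N p" and d: "d \<in> charts_at M (f p)"
  shows "form_rep N (pullback_form N M f \<omega>) c (snd c p) u v =
    form_rep M \<omega> d (snd d (f p)) (chart_deriv f p c d u) (chart_deriv f p c d v)"
  unfolding form_rep_eq[OF N c] form_rep_eq[OF M d] pullback_form_def pushforward_coord_vec[OF N M f c d] ..

lemma bilinear_alternating_swap: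
  assumes "bilinear B" "\<And>u. B u u = (0::real)"
  shows "B u v = - B v u"
proof -
  have "B (u + v) (u + v) = B u u + B u v + (B v u + B v v)"
    by (simp add: bilinear_ladd[OF assms(1)] bilinear_radd[OF assms(1)])
  then show ?thesis using assms(2) by simp
qed

text \<open>In a chart where the form is constant, the exterior derivative vanishes; in any other chart
  only second derivatives of the coordinate change enter, and these cancel by symmetry.\<close>

theorem closed_two_formI:
  assumes M: "smooth_manifold M"
    and const: "\<And>p. p \<in> points M \<Longrightarrow> \<exists>d\<in>charts_at M p. \<exists>B. bilinear B \<and> (\<forall>u. B u u = 0) \<and>
      (\<forall>y\<in>snd d ` fst d. form_rep M \<omega> d y = B)"
  shows "closed_two_form M \<omega>"
proof -
  have key: "\<exists>W. x \<in> W \<and> W \<subseteq> snd c ` fst c \<and> open W \<and> bilinear (form_rep M \<omega> c x) \<and> (\<forall>u. form_rep M \<omega> c x u u = 0) \<and>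
      (\<forall>u v. Cinf_on W (\<lambda>x. form_rep M \<omega> c x u v)) \<and>
      (\<forall>u v w. frechet_derivative (\<lambda>y. form_rep M \<omega> c y v w) (at x) u +
        frechet_derivative (\<lambda>y. form_rep M \<omega> c y w u) (at x) v +
        frechet_derivative (\<lambda>y. form_rep M \<omega> c y u v) (at x) w = 0)"
    if c: "c \<in> charts M" and x: "x \<in> snd c ` fst c" for c x
  proof -
    obtain p where p: "p \<in> fst c" "x = snd c p" using x by auto
    then have "p \<in> points M"
      using chart_subset_points[OF M c] by blast
    then obtain d B where d: "d \<in> charts_at M p" and B: "bilinear B" "\<And>u. B u u = 0"
      and dB: "\<And>y. y \<in> snd d ` fst d \<Longrightarrow> form_rep M \<omega> d y = B"
      using const by meson
    define W where "W = snd c ` (fst c \<inter> fst d)"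
    define \<tau> where "\<tau> = snd d \<circ> chart_inv c"
    let ?D = "\<lambda>y. frechet_derivative \<tau> (at y)"
    have \<tau>: "Cinf_on W \<tau>"
      unfolding W_def \<tau>_def using transition_smooth[OF M c] d by (simp add: charts_at_def)
    then have W: "open W" by (rule Cinf_on_imp_open)
    have xW: "x \<in> W"
      using p d by (auto simp: W_def charts_at_def)
    have rep: "form_rep M \<omega> c y u v = B (?D y u) (?D y v)" if y: "y \<in> W" for y u v
    proof -
      obtain q where q: "q \<in> fst c" "q \<in> fst d" "y = snd c q"
        using y by (auto simp: W_def)
      then have "c \<in> charts_at M q" "d \<in> charts_at M q"
        using c d by (auto simp: charts_at_def)
      from form_rep_change[OF M this] show ?thesis
        using dB[of "snd d q"] q by (simp add: chart_deriv_def \<tau>_def)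
    qed
    have bB: "bounded_bilinear B"
      using B(1) by (simp add: bilinear_conv_bounded_bilinear)
    have sm: "Cinf_on W (\<lambda>y. B (?D y u) (?D y v))" for u v
      by (intro Cinf_on_bounded_bilinear[OF bB] Cinf_on_derivative \<tau>)
    have lin: "linear (?D x)"
      by (rule Cinf_on_linear_derivative[OF \<tau> xW])
    \<comment> \<open>The second derivative of the coordinate change. In the cyclic sum, its
      symmetry and the skewness of \<open>B\<close> make the six terms cancel in pairs.\<close>
    define H where "H u v = frechet_derivative (\<lambda>y. ?D y u) (at x) v" for u v
    have H: "H u v = H v u" for u v
      unfolding H_def by (rule second_derivative_symmetric[OF \<tau> xW])
    have deriv: "frechet_derivative (\<lambda>y. form_rep M \<omega> c y v w) (at x) u = B (?D x v) (H w u) + B (H v u) (?D x w)" for u v w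
    proof -
      have "frechet_derivative (\<lambda>y. form_rep M \<omega> c y v w) (at x) =
          frechet_derivative (\<lambda>y. B (?D y v) (?D y w)) (at x)"
        by (rule frechet_derivative_cong[OF W xW rep])
      moreover have "((\<lambda>y. B (?D y v) (?D y w)) has_derivative (\<lambda>u. B (?D x v) (H w u) + B (H v u) (?D x w))) (at x)"
        unfolding H_def
        by (rule bounded_bilinear.FDERIV[OF bB
              Cinf_on_has_derivative[OF Cinf_on_derivative[OF \<tau>, of v] xW]
              Cinf_on_has_derivative[OF Cinf_on_derivative[OF \<tau>, of w] xW]])
      ultimately show ?thesis
        by (simp only: frechet_derivative_eqI)
    qed
    have "frechet_derivative (\<lambda>y. form_rep M \<omega> c y v w) (at x) u +
        frechet_derivative (\<lambda>y. form_rep M \<omega> c y w u) (at x) v +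
        frechet_derivative (\<lambda>y. form_rep M \<omega> c y u v) (at x) w = 0" for u v w
      unfolding deriv H[of w u] H[of v u] H[of w v]
      using bilinear_alternating_swap[OF B, of "H u w" "?D x v"] bilinear_alternating_swap[OF B, of "H u v" "?D x w"]
        bilinear_alternating_swap[OF B, of "H v w" "?D x u"] by simp
    moreover have "bilinear (form_rep M \<omega> c x)"
      using B(1) lin unfolding bilinear_def rep[OF xW] by (auto intro: linear_compose[unfolded comp_def])
    moreover have "form_rep M \<omega> c x u u = 0" for u
      by (simp add: rep[OF xW] B(2))
    moreover have "Cinf_on W (\<lambda>x. form_rep M \<omega> c x u v)" for u v
      by (rule iffD2[OF Cinf_on_cong sm]) (rule rep)
    moreover have "W \<subseteq> snd c ` fst c" by (auto simp: W_def)
    ultimately show ?thesis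
      using xW W by (intro exI[of _ W]) auto
  qed
  have "smooth_on (snd c ` fst c) (\<lambda>x. form_rep M \<omega> c x u v)" if c: "c \<in> charts M" for c u v
  proof -
    have o: "open (snd c ` fst c)" using M c by (simp add: smooth_manifold_def)
    have "Cinf_on (snd c ` fst c) (\<lambda>x. form_rep M \<omega> c x u v)"
      by (rule Cinf_on_local[OF _ o]) (use key[OF c] in meson)
    then show ?thesis using smooth_on_iff_Cinf_on[OF o] by blast
  qed
  then show ?thesis
    unfolding closed_two_form_def smooth_two_form_def using key by blast
qed

section \<open>Endomorphism fields under coordinate changes\<close>

lemma endo_rep_eq:
  assumes "smooth_manifold M" "c \<in> charts_at M p"
  shows "endo_rep M J c (snd c p) u = J p (coord_vec M p c u) c"
  using chart_inv_left[OF assms(1)] assms(2) by (simp add: endo_rep_def charts_at_def)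

text \<open>A tangent vector carries its coordinates in all charts, linked by the Jacobians; hence
  preservation of tangent vectors already yields the conjugation law.\<close>

lemma endo_change:
  assumes M: "smooth_manifold M" and c: "c \<in> charts_at M p" and d: "d \<in> charts_at M p"
    and J: "\<And>v. v \<in> tangent_space M p \<Longrightarrow> J v \<in> tangent_space M p"
  shows "J (coord_vec M p c u) c =
    chart_deriv id p d c (J (coord_vec M p d (chart_deriv id p c d u)) d)"
proof -
  have "J (coord_vec M p c u) \<in> tangent_space M p"
    by (intro J coord_vec_in_tangent_space[OF M c])
  then have "J (coord_vec M p c u) c = chart_deriv id p d c (J (coord_vec M p c u) d)"
    using c d unfolding tangent_space_alt by blast
  then show ?thesis
    using coord_vec_change[OF M c d] by simp
qed

text \<open>The chart in which \<open>J\<close> is constant witnesses integrability. In any other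
  chart \<open>J\<close> is that constant conjugated by Jacobians of the coordinate changes, which
  depend smoothly on the point.\<close>

theorem integrable_almost_complex_structureI:
  assumes M: "smooth_manifold M"
    and J: "\<And>p v. p \<in> points M \<Longrightarrow> v \<in> tangent_space M p \<Longrightarrow> J p v \<in> tangent_space M p \<and> J p (J p v) = (\<lambda>c. - v c)"
    and const: "\<And>p. p \<in> points M \<Longrightarrow> \<exists>d\<in>charts_at M p. \<exists>J0. linear J0 \<and>
      (\<forall>y\<in>snd d ` fst d. endo_rep M J d y = J0)"
  shows "almost_complex_structure M J" "integrable_structure M J"
proof -
  have key: "\<exists>W. x \<in> W \<and> linear (endo_rep M J c x) \<and> (\<forall>u. Cinf_on W (\<lambda>x. endo_rep M J c x u))"
    if c: "c \<in> charts M" and x: "x \<in> snd c ` fst c" for c x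
  proof -
    obtain p where p: "p \<in> fst c" "x = snd c p" using x by auto
    then have "p \<in> points M"
      using chart_subset_points[OF M c] by blast
    then obtain d J0 where d: "d \<in> charts_at M p" and J0: "linear J0"
      and dJ: "\<And>y. y \<in> snd d ` fst d \<Longrightarrow> endo_rep M J d y = J0"
      using const by meson
    define W where "W = snd c ` (fst c \<inter> fst d)"
    define \<tau> where "\<tau> = snd d \<circ> chart_inv c"
    define \<sigma> where "\<sigma> = snd c \<circ> chart_inv d"
    let ?D = "\<lambda>y. frechet_derivative \<tau> (at y)" and ?E = "\<lambda>y. frechet_derivative \<sigma> (at y)"
    have \<tau>: "Cinf_on W \<tau>"
      unfolding W_def \<tau>_def using transition_smooth[OF M c] d by (simp add: charts_at_def)
    have \<sigma>: "Cinf_on (snd d ` (fst d \<inter> fst c)) \<sigma>"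
      unfolding \<sigma>_def using transition_smooth[OF M _ c] d by (simp add: charts_at_def)
    have xW: "x \<in> W"
      using p d by (auto simp: W_def charts_at_def)
    have \<tau>W: "\<tau> ` W \<subseteq> snd d ` (fst d \<inter> fst c)"
      unfolding W_def \<tau>_def using chart_inv_left[OF M c] by auto
    have rep: "endo_rep M J c y u = ?E (\<tau> y) (J0 (?D y u))" if y: "y \<in> W" for y u
    proof -
      obtain q where q: "q \<in> fst c" "q \<in> fst d" "y = snd c q"
        using y by (auto simp: W_def)
      then have cd: "c \<in> charts_at M q" "d \<in> charts_at M q"
        using c d by (auto simp: charts_at_def)
      have qM: "q \<in> points M" using chart_subset_points[OF M c] q by blast
      have "endo_rep M J c y u = chart_deriv id q d c (endo_rep M J d (snd d q) (chart_deriv id q c d u))"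
        unfolding q(3) endo_rep_eq[OF M cd(1)] endo_rep_eq[OF M cd(2)]
        by (rule endo_change[OF M cd]) (use J[OF qM] in blast)
      then show ?thesis
        using dJ[of "snd d q"] q chart_inv_left[OF M c] by (simp add: chart_deriv_def \<tau>_def \<sigma>_def)
    qed
    have J0': "bounded_linear J0"
      using J0 by (simp add: linear_conv_bounded_linear)
    have "Cinf_on W (\<lambda>y. ?E (\<tau> y) (J0 (?D y u)))" for u
      by (rule Cinf_on_apply_derivative[OF \<sigma> \<tau> \<tau>W Cinf_on_bounded_linear[OF J0' Cinf_on_derivative[OF \<tau>]]])
    then have "Cinf_on W (\<lambda>x. endo_rep M J c x u)" for u
      by (rule iffD2[OF Cinf_on_cong, rotated]) (rule rep)
    moreover have "linear (endo_rep M J c x)"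
    proof -
      have "endo_rep M J c x = ?E (\<tau> x) \<circ> (J0 \<circ> ?D x)"
        using rep[OF xW] by auto
      moreover have "linear (?E (\<tau> x))" "linear (?D x)"
        using Cinf_on_linear_derivative[OF \<sigma>] Cinf_on_linear_derivative[OF \<tau>] xW \<tau>W by auto
      ultimately show ?thesis
        using J0 by (auto intro: linear_compose)
    qed
    ultimately show ?thesis
      using xW by blast
  qed
  have "smooth_on (snd c ` fst c) (\<lambda>x. endo_rep M J c x u)" if c: "c \<in> charts M" for c u
  proof -
    have o: "open (snd c ` fst c)" using M c by (simp add: smooth_manifold_def)
    have "Cinf_on (snd c ` fst c) (\<lambda>x. endo_rep M J c x u)"
      by (rule Cinf_on_local[OF _ o]) (use key[OF c] in meson)
    then show ?thesis using smooth_on_iff_Cinf_on[OF o] by blast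
  qed
  then show "almost_complex_structure M J"
    unfolding almost_complex_structure_def using key J by blast
  show "integrable_structure M J"
    unfolding integrable_structure_def using const by meson
qed

text \<open>One adapted pair of charts around each point suffices: in any other pair the matrix of
  \<open>J\<close> is conjugated by Jacobians of coordinate changes of \<open>M\<close>, evaluated
  along \<open>f\<close>.\<close>

theorem smooth_section_alongI:
  fixes N :: "('n, 'f::euclidean_space) manifold" and M :: "('m, 'e::euclidean_space) manifold"
  assumes N: "smooth_manifold N" and M: "smooth_manifold M" and f: "smooth_map N M f"
    and Q: "\<And>p. p \<in> points N \<Longrightarrow> J p \<in> Q (f p)"
    and J: "\<And>p v. p \<in> points N \<Longrightarrow> v \<in> tangent_space M (f p) \<Longrightarrow> J p v \<in> tangent_space M (f p)"
    and rep: "\<And>p. p \<in> points N \<Longrightarrow> \<exists>c\<in>charts_at N p. \<exists>d\<in>charts M. \<exists>R.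
      (\<forall>u. Cinf_on (snd c ` fst c) (\<lambda>x. R x u)) \<and>
      (\<forall>q\<in>fst c. f q \<in> fst d \<and> linear (R (snd c q)) \<and> (\<forall>u. J q (coord_vec M (f q) d u) d = R (snd c q) u))"
  shows "smooth_section_along N M f Q J"
proof -
  have "smooth_on (snd c ` (fst c \<inter> f -` fst d))
          (\<lambda>x. let p = chart_inv c x in J p (coord_vec M (f p) d u) d)"
    if c: "c \<in> charts N" and d: "d \<in> charts M" for c d u
  proof -
    let ?S = "snd c ` (fst c \<inter> f -` fst d)"
    let ?F = "\<lambda>x. let p = chart_inv c x in J p (coord_vec M (f p) d u) d"
    have o: "open ?S"
      using smooth_map_rep[OF f c d] by (rule Cinf_on_imp_open)
    have "Cinf_on ?S ?F"
    proof (rule Cinf_on_local[OF _ o])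
      fix x assume "x \<in> ?S"
      then obtain p where p: "p \<in> fst c" "f p \<in> fst d" "x = snd c p" by auto
      then have "p \<in> points N"
        using chart_subset_points[OF N c] by blast
      then obtain c' d' R where c': "c' \<in> charts_at N p" and d': "d' \<in> charts M"
        and R: "\<And>u. Cinf_on (snd c' ` fst c') (\<lambda>x. R x u)"
        and R': "\<And>q. q \<in> fst c' \<Longrightarrow> f q \<in> fst d' \<and> linear (R (snd c' q)) \<and>
            (\<forall>u. J q (coord_vec M (f q) d' u) d' = R (snd c' q) u)"
        using rep by meson
      define W where "W = snd c ` (fst c \<inter> fst c') \<inter> ?S"
      have W: "open W"
        unfolding W_def using o transition_smooth[OF N c, of c'] c' Cinf_on_imp_open
        by (auto simp: charts_at_def)
      have xW: "x \<in> W"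
        using p c' by (auto simp: W_def charts_at_def)
      have Wq: "\<exists>q. q \<in> fst c \<and> q \<in> fst c' \<and> f q \<in> fst d \<and> f q \<in> fst d' \<and> y = snd c q \<and> chart_inv c y = q \<and>
          c \<in> charts_at N q \<and> c' \<in> charts_at N q \<and> d \<in> charts_at M (f q) \<and> d' \<in> charts_at M (f q)" if y: "y \<in> W" for y
      proof -
        obtain q where q: "q \<in> fst c" "f q \<in> fst d" "y = snd c q"
          using y unfolding W_def by auto
        have "q \<in> fst c'"
          using y q manifold_inj[OF N c] by (auto simp: W_def inj_on_def)
        then show ?thesis
          using q chart_inv_left[OF N c] c c' d d' R'[of q] by (intro exI[of _ q]) (auto simp: charts_at_def)
      qed
      define \<tau> where "\<tau> = snd c' \<circ> chart_inv c"
      define \<phi> where "\<phi> = snd d \<circ> f \<circ> chart_inv c"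
      define \<phi>' where "\<phi>' = snd d' \<circ> f \<circ> chart_inv c"
      define \<sigma> where "\<sigma> = snd d' \<circ> chart_inv d"
      define \<rho> where "\<rho> = snd d \<circ> chart_inv d'"
      have \<tau>: "Cinf_on W \<tau>"
        unfolding \<tau>_def by (rule Cinf_on_subset[OF transition_smooth[OF N c] W])
          (use c' in \<open>auto simp: W_def charts_at_def\<close>)
      have \<phi>: "Cinf_on W \<phi>"
        unfolding \<phi>_def by (rule Cinf_on_subset[OF smooth_map_rep[OF f c d] W]) (auto simp: W_def)
      have \<phi>': "Cinf_on W \<phi>'"
        unfolding \<phi>'_def by (rule Cinf_on_subset[OF smooth_map_rep[OF f c d'] W]) (use Wq in fastforce)
      have \<sigma>: "Cinf_on (snd d ` (fst d \<inter> fst d')) \<sigma>"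
        unfolding \<sigma>_def by (rule transition_smooth[OF M d d'])
      have \<rho>: "Cinf_on (snd d' ` (fst d' \<inter> fst d)) \<rho>"
        unfolding \<rho>_def by (rule transition_smooth[OF M d' d])
      let ?z = "\<lambda>y. frechet_derivative \<sigma> (at (\<phi> y)) u"
      have eq: "?F y = frechet_derivative \<rho> (at (\<phi>' y)) (\<Sum>b\<in>Basis. (?z y \<bullet> b) *\<^sub>R R (\<tau> y) b)"
        if y: "y \<in> W" for y
      proof -
        obtain q where q: "q \<in> fst c" "q \<in> fst c'" "f q \<in> fst d" "f q \<in> fst d'" "y = snd c q" "chart_inv c y = q"
          "c \<in> charts_at N q" "c' \<in> charts_at N q" "d \<in> charts_at M (f q)" "d' \<in> charts_at M (f q)"
          using Wq[OF y] by blast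
        have qN: "q \<in> points N" using chart_subset_points[OF N c] q by blast
        have "?F y = J q (coord_vec M (f q) d u) d"
          using q(6) by (simp add: Let_def)
        also have "\<dots> = chart_deriv id (f q) d' d (J q (coord_vec M (f q) d' (chart_deriv id (f q) d d' u)) d')"
          by (rule endo_change[OF M q(9,10)]) (rule J[OF qN])
        also have "\<dots> = chart_deriv id (f q) d' d (R (snd c' q) (chart_deriv id (f q) d d' u))"
          using R'[OF q(2)] by simp
        also have "\<dots> = frechet_derivative \<rho> (at (\<phi>' y)) (R (\<tau> y) (?z y))"
          using q(6) by (simp add: chart_deriv_def \<rho>_def \<phi>'_def \<tau>_def \<phi>_def \<sigma>_def)
        \<comment> \<open>\<open>R\<close> is smooth in the point only for a fixed vector, so the
          varying vector \<open>?z y\<close> is resolved in the basis.\<close>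
        also have "R (\<tau> y) (?z y) = (\<Sum>b\<in>Basis. (?z y \<bullet> b) *\<^sub>R R (\<tau> y) b)"
          by (rule linear_Basis_expansion) (use R'[OF q(2)] q(6) in \<open>simp add: \<tau>_def\<close>)
        finally show ?thesis .
      qed
      have z: "Cinf_on W ?z"
        by (rule Cinf_on_apply_derivative[OF \<sigma> \<phi> _ Cinf_on_const[OF W]])
          (use Wq in \<open>fastforce simp: \<phi>_def\<close>)
      have "Cinf_on W (\<lambda>y. R (\<tau> y) b)" for b
        by (rule Cinf_on_compose[OF \<tau> R]) (use Wq in \<open>fastforce simp: \<tau>_def\<close>)
      then have "Cinf_on W (\<lambda>y. \<Sum>b\<in>Basis. (?z y \<bullet> b) *\<^sub>R R (\<tau> y) b)"
        by (intro Cinf_on_sum[OF W] Cinf_on_scaleR) (rule Cinf_on_bounded_linear[OF bounded_linear_inner_left z])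
      then have "Cinf_on W (\<lambda>y. frechet_derivative \<rho> (at (\<phi>' y)) (\<Sum>b\<in>Basis. (?z y \<bullet> b) *\<^sub>R R (\<tau> y) b))"
        by (rule Cinf_on_apply_derivative[OF \<rho> \<phi>', rotated]) (use Wq in \<open>fastforce simp: \<phi>'_def\<close>)
      then have "Cinf_on W ?F"
        by (rule iffD2[OF Cinf_on_cong, rotated]) (rule eq)
      then show "\<exists>U. x \<in> U \<and> Cinf_on U ?F"
        using xW by blast
    qed
    then show ?thesis
      using smooth_on_iff_Cinf_on[OF o] by blast
  qed
  then show ?thesis
    unfolding smooth_section_along_def using Q by blast
qed

text \<open>Injectivity of the charts makes images commute with intersections, so the defining
  family really is a topology and \<open>topology\<close> can be unfolded.\<close>

lemma openin_manifold_topology: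
  assumes inj: "\<And>c. c \<in> charts M \<Longrightarrow> inj_on (snd c) (fst c)"
  shows "openin (manifold_topology M) W \<longleftrightarrow> W \<subseteq> points M \<and> (\<forall>c\<in>charts M. open (snd c ` (fst c \<inter> W)))"
proof -
  have "istopology (\<lambda>W. W \<subseteq> points M \<and> (\<forall>c\<in>charts M. open (snd c ` (fst c \<inter> W))))"
    unfolding istopology_def
  proof (intro conjI allI impI ballI)
    fix S T c
    assume S: "S \<subseteq> points M \<and> (\<forall>c\<in>charts M. open (snd c ` (fst c \<inter> S)))"
      and T: "T \<subseteq> points M \<and> (\<forall>c\<in>charts M. open (snd c ` (fst c \<inter> T)))"
    then show "S \<inter> T \<subseteq> points M" by blast
    assume c: "c \<in> charts M"
    have "snd c ` (fst c \<inter> (S \<inter> T)) = snd c ` (fst c \<inter> S) \<inter> snd c ` (fst c \<inter> T)"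
      using inj_on_image_Int[OF inj[OF c], of "fst c \<inter> S" "fst c \<inter> T"] by (simp add: Int_ac)
    then show "open (snd c ` (fst c \<inter> (S \<inter> T)))"
      using S T c by auto
  next
    fix K c
    assume K: "\<forall>W\<in>K. W \<subseteq> points M \<and> (\<forall>c\<in>charts M. open (snd c ` (fst c \<inter> W)))"
    then show "\<Union>K \<subseteq> points M" by blast
    assume c: "c \<in> charts M"
    have "snd c ` (fst c \<inter> \<Union>K) = (\<Union>W\<in>K. snd c ` (fst c \<inter> W))" by blast
    then show "open (snd c ` (fst c \<inter> \<Union>K))"
      using K c by auto
  qed
  then show ?thesis
    unfolding manifold_topology_def by (simp add: topology_inverse')
qed

section \<open>Block matrices\<close>

lemma sum_option: "(\<Sum>k\<in>(UNIV :: 'n::finite option set). f k) = f None + (\<Sum>k\<in>UNIV. f (Some k))"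
  by (simp add: UNIV_option_conv sum.reindex)

lemma matrix_mult_option_nth:
  fixes A :: "'a::semiring_1^('n::finite option)^'m"
  shows "(A ** B) $ i $ j = A $ i $ None * B $ None $ j + (\<Sum>k\<in>UNIV. A $ i $ Some k * B $ Some k $ j)"
  by (simp add: matrix_matrix_mult_def sum_option)

lemma block_vec_eq_iff:
  fixes A B :: "'a^('n::finite option)^('n option)"
  shows "A = B \<longleftrightarrow> A $ None $ None = B $ None $ None \<and> (\<forall>b. A $ None $ Some b = B $ None $ Some b) \<and>
    (\<forall>a. A $ Some a $ None = B $ Some a $ None) \<and> (\<forall>a b. A $ Some a $ Some b = B $ Some a $ Some b)"
  by (simp add: vec_eq_iff) (metis option.exhaust)

definition E00 :: "'a::semiring_1^('n::finite option)^('n option)" where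
  "E00 = (\<chi> i j. if i = None \<and> j = None then 1 else 0)"

text \<open>Describing the isotropy condition as the centralizer of an idempotent makes closure
  under inversion immediate and lets cosets be encoded as conjugates of \<open>E00\<close>.\<close>

lemma block_diagonal_iff_commute: "block_diagonal A \<longleftrightarrow> A ** E00 = E00 ** A"
  by (auto simp: block_vec_eq_iff matrix_mult_option_nth E00_def block_diagonal_def)

text \<open>The product of the lower and the upper unipotent block matrices with off-diagonal blocks
  \<open>w\<close> and \<open>v\<close>.\<close>

definition sect :: "('a::ring_1^'n) \<times> ('a^'n) \<Rightarrow> 'a^('n::finite option)^('n option)" where
  "sect x = (\<chi> i j. case i of
      None \<Rightarrow> (case j of None \<Rightarrow> 1 | Some b \<Rightarrow> snd x $ b)
    | Some a \<Rightarrow> (case j of None \<Rightarrow> fst x $ a | Some b \<Rightarrow> (if a = b then 1 else 0) + fst x $ a * snd x $ b))"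

text \<open>The two unipotent factors of \<open>sect x\<close>, inverted and multiplied in the
  opposite order.\<close>

definition sect_inv :: "('a::ring_1^'n) \<times> ('a^'n) \<Rightarrow> 'a^('n::finite option)^('n option)" where
  "sect_inv x = (\<chi> i j. case i of
      None \<Rightarrow> (case j of None \<Rightarrow> 1 + (\<Sum>k\<in>UNIV. snd x $ k * fst x $ k) | Some b \<Rightarrow> - (snd x $ b))
    | Some a \<Rightarrow> (case j of None \<Rightarrow> - (fst x $ a) | Some b \<Rightarrow> (if a = b then 1 else 0)))"

lemma sect_nth [simp]:
  "sect x $ None $ None = 1" "sect x $ None $ Some b = snd x $ b" "sect x $ Some a $ None = fst x $ a"
  "sect x $ Some a $ Some b = (if a = b then 1 else 0) + fst x $ a * snd x $ b"
  by (simp_all add: sect_def)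

lemma sect_inv_nth [simp]:
  "sect_inv x $ None $ None = 1 + (\<Sum>k\<in>UNIV. snd x $ k * fst x $ k)"
  "sect_inv x $ None $ Some b = - (snd x $ b)" "sect_inv x $ Some a $ None = - (fst x $ a)"
  "sect_inv x $ Some a $ Some b = (if a = b then 1 else 0)"
  by (simp_all add: sect_inv_def)

lemma mat_1_block_nth [simp]:
  "mat 1 $ None $ None = 1" "mat 1 $ None $ Some b = 0" "mat 1 $ Some a $ None = 0"
  "mat 1 $ Some a $ Some b = (if a = b then 1 else 0)"
  by (simp_all add: mat_def)

lemma sect_zero: "sect 0 = mat 1"
  by (simp add: block_vec_eq_iff)

lemma sum_delta_mult:
  fixes f :: "'n::finite \<Rightarrow> 'a::semiring_1"
  shows "(\<Sum>k\<in>UNIV. (if a = k then 1 else 0) * f k) = f a" "(\<Sum>k\<in>UNIV. f k * (if k = a then 1 else 0)) = f a"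
  by (simp_all add: if_distrib[of "\<lambda>x. x * _"] if_distrib[of "\<lambda>x. _ * x"] cong: if_cong)

lemma sect_inv_right: "sect x ** sect_inv x = mat 1"
proof -
  have 1: "(\<Sum>k\<in>UNIV. ((if a = k then 1 else 0) + fst x $ a * snd x $ k) * - (fst x $ k)) =
      - (fst x $ a) - fst x $ a * (\<Sum>k\<in>UNIV. snd x $ k * fst x $ k)" for a
    by (simp add: distrib_right sum_subtractf sum_delta_mult sum_distrib_left sum_negf mult.assoc)
  show ?thesis
    using 1 by (auto simp: block_vec_eq_iff matrix_mult_option_nth sum_delta_mult sum_negf distrib_left)
qed

text \<open>A group element with non-zero corner entry factors uniquely as \<open>sect x ** h\<close> with \<open>h\<close> block
  diagonal, and \<open>coords\<close> recovers \<open>x\<close>.\<close>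

definition coords ::
  "('a^('n option)^('n option) \<Rightarrow> 'a^('n option)^('n option)) \<Rightarrow>
    'a::real_normed_div_algebra^('n::finite option)^('n option) \<Rightarrow> ('a^'n) \<times> ('a^'n)" where
  "coords ginv A =
    (\<chi> a. A $ Some a $ None * inverse (A $ None $ None), \<chi> b. - (A $ None $ None * ginv A $ None $ Some b))"

definition diag_subgroup :: "('a::zero^('n::finite option)^('n option)) set \<Rightarrow> ('a^('n option)^('n option)) set" where
  "diag_subgroup G = {A \<in> G. block_diagonal A}"

text \<open>The big cell translated by \<open>g\<close>, so that the chart is centred at the coset
  of \<open>g\<close>. Coordinates are read from an arbitrary representative, which is harmless by
  invariance of \<open>coords\<close> under right multiplication by the isotropy group.\<close>

definition std_chart ::
  "('a::{real_normed_div_algebra,euclidean_space}^('n::finite option)^('n option)) set \<Rightarrow>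
    ('a^('n option)^('n option) \<Rightarrow> 'a^('n option)^('n option)) \<Rightarrow> 'a^('n option)^('n option) \<Rightarrow>
    (('a^('n option)^('n option)) set, ('a^'n) \<times> ('a^'n)) chart" where
  "std_chart G ginv g =
    (coset (diag_subgroup G) ` {x \<in> G. (ginv g ** x) $ None $ None \<noteq> 0},
     \<lambda>C. coords ginv (ginv g ** (SOME x. x \<in> C)))"

lemma Cinf_on_sect: "Cinf_on UNIV (sect :: ('a::{real_normed_div_algebra,euclidean_space}^'n) \<times> ('a^'n) \<Rightarrow> _)"
proof -
  have 1: "Cinf_on UNIV (\<lambda>x :: ('a^'n) \<times> ('a^'n). case i of
      None \<Rightarrow> (case j of None \<Rightarrow> 1 | Some b \<Rightarrow> snd x $ b)
    | Some a \<Rightarrow> (case j of None \<Rightarrow> fst x $ a | Some b \<Rightarrow> (if a = b then 1 else 0) + fst x $ a * snd x $ b))" for i j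
    by (cases i; cases j) (simp_all add: Cinf_intros)
  show ?thesis
    unfolding sect_def by (intro Cinf_on_vec_lambda open_UNIV 1)
qed

section \<open>Homogeneous spaces with block-diagonal isotropy group\<close>

text \<open>Treats the real, complex and quaternionic special linear groups at once.
  \<open>ginv\<close> inverts on \<open>G\<close> but is asked to be smooth on all matrices, because
  smoothness on \<open>G\<close> is defined through extensions to open sets.\<close>

locale block_group =
  fixes G :: "('a::{real_normed_div_algebra,euclidean_space}^('n::finite option)^('n option)) set"
    and ginv :: "'a^('n option)^('n option) \<Rightarrow> 'a^('n option)^('n option)"
  assumes one_mem: "mat 1 \<in> G"
    and mult_mem: "A \<in> G \<Longrightarrow> B \<in> G \<Longrightarrow> A ** B \<in> G"
    and inv_mem: "A \<in> G \<Longrightarrow> ginv A \<in> G"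
    and inv_left: "A \<in> G \<Longrightarrow> ginv A ** A = mat 1"
    and inv_right: "A \<in> G \<Longrightarrow> A ** ginv A = mat 1"
    and smooth_inv: "Cinf_on UNIV ginv"
    and sect_mem: "sect x \<in> G"
begin

abbreviation "H \<equiv> diag_subgroup G"
abbreviation "chart g \<equiv> std_chart G ginv g"

abbreviation qspace :: "(('a^('n option)^('n option)) set, ('a^'n) \<times> ('a^'n)) manifold" where
  "qspace \<equiv> homogeneous_space G H"

abbreviation "frame g x \<equiv> coord_vec qspace (coset H g) (chart g) x"

lemma inv_unique: "A \<in> G \<Longrightarrow> A ** B = mat 1 \<Longrightarrow> ginv A = B"
  by (metis inv_left matrix_mul_assoc matrix_mul_lid matrix_mul_rid)

lemma inv_inv: "A \<in> G \<Longrightarrow> ginv (ginv A) = A"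
  by (simp add: inv_unique inv_mem inv_left)

lemma inv_mult: "A \<in> G \<Longrightarrow> B \<in> G \<Longrightarrow> ginv (A ** B) = ginv B ** ginv A"
  by (rule inv_unique) (simp_all add: mult_mem, metis inv_right matrix_mul_assoc matrix_mul_rid)

lemma inv_sect: "ginv (sect x) = sect_inv x"
  by (rule inv_unique[OF sect_mem sect_inv_right])

lemma inv_cancel: "A \<in> G \<Longrightarrow> ginv A ** (A ** B) = B" "A \<in> G \<Longrightarrow> A ** (ginv A ** B) = B"
  by (simp_all add: matrix_mul_assoc inv_left inv_right)

lemma H_subset: "h \<in> H \<Longrightarrow> h \<in> G"
  by (simp add: diag_subgroup_def)

lemma H_block_diagonal: "h \<in> H \<Longrightarrow> h $ None $ Some b = 0" "h \<in> H \<Longrightarrow> h $ Some b $ None = 0"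
  by (simp_all add: diag_subgroup_def block_diagonal_def)

lemma H_one: "mat 1 \<in> H"
  by (simp add: diag_subgroup_def one_mem block_diagonal_def)

lemma H_mult: "h \<in> H \<Longrightarrow> k \<in> H \<Longrightarrow> h ** k \<in> H"
  by (simp add: diag_subgroup_def mult_mem) (simp add: block_diagonal_def matrix_mult_option_nth)

text \<open>If \<open>h\<close> commutes with \<open>E00\<close>, so does its inverse; multiplying
  the relation by the inverse on both sides replaces a block computation.\<close>

lemma H_inv: "h \<in> H \<Longrightarrow> ginv h \<in> H"
proof -
  assume h: "h \<in> H"
  then have hG: "h \<in> G" and c: "h ** E00 = E00 ** h"
    by (auto simp: diag_subgroup_def block_diagonal_iff_commute)
  have "ginv h ** E00 = ginv h ** (E00 ** h) ** ginv h"
    by (metis hG inv_right matrix_mul_assoc matrix_mul_rid)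
  also have "\<dots> = E00 ** ginv h"
    unfolding c[symmetric] using hG by (metis inv_left matrix_mul_assoc matrix_mul_lid)
  finally show ?thesis
    by (simp add: diag_subgroup_def inv_mem hG block_diagonal_iff_commute)
qed

lemma H_corner:
  assumes "h \<in> H"
  shows "h $ None $ None * ginv h $ None $ None = 1" "h $ None $ None \<noteq> 0"
proof -
  have "(h ** ginv h) $ None $ None = 1"
    using assms by (simp add: inv_right H_subset)
  then show 1: "h $ None $ None * ginv h $ None $ None = 1"
    using H_block_diagonal[OF assms] by (simp add: matrix_mult_option_nth)
  show "h $ None $ None \<noteq> 0"
    using 1 by auto
qed

lemma mem_coset: "g \<in> coset H g"
  unfolding coset_def using H_one by (metis image_eqI matrix_mul_rid)

lemma coset_mult_H:
  assumes "h \<in> H"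
  shows "coset H (g ** h) = coset H g"
proof -
  have "\<exists>k'\<in>H. g ** k = g ** h ** k'" if "k \<in> H" for k
    using that assms H_inv H_mult inv_cancel(2) H_subset by (metis matrix_mul_assoc)
  moreover have "\<exists>k'\<in>H. g ** h ** k = g ** k'" if "k \<in> H" for k
    using that assms H_mult by (metis matrix_mul_assoc)
  ultimately show ?thesis
    unfolding coset_def by blast
qed

lemma coset_eqD:
  assumes "coset H g = coset H x"
  shows "\<exists>h\<in>H. x = g ** h"
proof -
  have "x \<in> coset H g"
    unfolding assms by (rule mem_coset)
  then show ?thesis
    unfolding coset_def by blast
qed

lemma coset_mem_eq:
  assumes "x \<in> coset H g"
  shows "coset H x = coset H g"
proof -
  obtain h where "h \<in> H" "x = g ** h"
    using assms unfolding coset_def by blast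
  then show ?thesis
    using coset_mult_H by simp
qed

lemma coset_mem_G: "x \<in> coset H g \<Longrightarrow> g \<in> G \<Longrightarrow> x \<in> G"
  unfolding coset_def using mult_mem H_subset by auto

lemma coset_eqI:
  assumes "g \<in> G" "ginv g ** x \<in> H"
  shows "coset H x = coset H g"
  using coset_mult_H[OF assms(2), of g] by (simp add: inv_cancel(2)[OF assms(1)])

lemma some_mem_coset:
  assumes "g \<in> G"
  obtains h where "h \<in> H" "(SOME x. x \<in> coset H g) = g ** h"
proof -
  have "(SOME x. x \<in> coset H g) \<in> coset H g"
    using mem_coset someI by metis
  then show ?thesis
    using that unfolding coset_def by blast
qed

lemma coset_mult_left: "(\<lambda>x. k ** x) ` coset H g = coset H (k ** g)"
  unfolding coset_def image_image by (simp add: matrix_mul_assoc)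

lemma Union_cosets:
  assumes "W \<subseteq> coset H ` G"
  shows "\<Union>W = {g \<in> G. coset H g \<in> W}"
proof (intro equalityI subsetI)
  fix x assume "x \<in> \<Union>W"
  then obtain g where g: "g \<in> G" "coset H g \<in> W" "x \<in> coset H g"
    using assms by blast
  then show "x \<in> {g \<in> G. coset H g \<in> W}"
    using coset_mem_eq[OF g(3)] coset_mem_G[OF g(3) g(1)] by simp
next
  fix x assume "x \<in> {g \<in> G. coset H g \<in> W}"
  then show "x \<in> \<Union>W" using mem_coset by blast
qed

text \<open>Reading the second coordinate from the first row of \<open>ginv A\<close> instead of
  \<open>A\<close> keeps the large block of \<open>h\<close> out of the formulas: only the corner of
  \<open>h\<close> and the corner of its inverse occur, and they cancel even without
  commutativity.\<close>

lemma coords_mult_H: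
  assumes "A \<in> G" "h \<in> H"
  shows "coords ginv (A ** h) = coords ginv A"
proof -
  have "A $ Some a $ None * h $ None $ None * inverse (A $ None $ None * h $ None $ None) =
      A $ Some a $ None * inverse (A $ None $ None)" for a
  proof (cases "A $ None $ None = 0")
    case False
    then show ?thesis using H_corner(2)[OF assms(2)]
      by (simp add: nonzero_inverse_mult_distrib mult.assoc) (simp flip: mult.assoc)
  qed simp
  moreover have "A $ None $ None * h $ None $ None * (ginv h $ None $ None * ginv A $ None $ Some b) =
      A $ None $ None * ginv A $ None $ Some b" for b
  proof -
    have "A $ None $ None * h $ None $ None * (ginv h $ None $ None * ginv A $ None $ Some b) =
        A $ None $ None * (h $ None $ None * ginv h $ None $ None) * ginv A $ None $ Some b"
      by (simp only: mult.assoc)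
    then show ?thesis
      using H_corner(1)[OF assms(2)] by simp
  qed
  ultimately show ?thesis
    using assms H_inv[OF assms(2)]
    by (simp add: coords_def inv_mult H_subset matrix_mult_option_nth H_block_diagonal)
qed

lemma coords_sect: "coords ginv (sect x) = x"
  by (simp add: coords_def inv_sect prod_eq_iff vec_eq_iff)

text \<open>It is enough that \<open>sect_inv\<close> of the coordinates times \<open>A\<close> is
  block diagonal. The lower left block vanishes by the choice of the first coordinate, the upper
  right one by the first row of \<open>ginv A ** A = mat 1\<close>.\<close>

lemma sect_coords:
  assumes A: "A \<in> G" and nz: "A $ None $ None \<noteq> 0"
  shows "coset H (sect (coords ginv A)) = coset H A"
proof -
  let ?x = "coords ginv A" and ?B = "ginv A"
  have BA: "?B $ None $ None * A $ None $ j + (\<Sum>k\<in>UNIV. ?B $ None $ Some k * A $ Some k $ j) = mat 1 $ None $ j" for j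
    using inv_left[OF A] matrix_mult_option_nth[of ?B A None j] by simp
  have s: "(\<Sum>k\<in>UNIV. ?B $ None $ Some k * A $ Some k $ None) = 1 - ?B $ None $ None * A $ None $ None"
    "(\<Sum>k\<in>UNIV. ?B $ None $ Some k * A $ Some k $ Some b) = - (?B $ None $ None * A $ None $ Some b)" for b
    using BA[of None] BA[of "Some b"] by (simp_all add: algebra_simps eq_neg_iff_add_eq_0)
  have "(\<Sum>k\<in>UNIV. snd ?x $ k * fst ?x $ k) =
      - (A $ None $ None * (\<Sum>k\<in>UNIV. ?B $ None $ Some k * A $ Some k $ None) * inverse (A $ None $ None))"
    by (simp add: coords_def sum_distrib_left sum_distrib_right sum_negf mult.assoc)
  also have "\<dots> = A $ None $ None * ?B $ None $ None - 1"
    unfolding s(1) using nz by (simp add: right_diff_distrib left_diff_distrib mult.assoc)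
  finally have c: "1 + (\<Sum>k\<in>UNIV. snd ?x $ k * fst ?x $ k) = A $ None $ None * ?B $ None $ None"
    by simp
  have "(\<Sum>k\<in>UNIV. snd ?x $ k * A $ Some k $ Some b) =
      - (A $ None $ None * (\<Sum>k\<in>UNIV. ?B $ None $ Some k * A $ Some k $ Some b))" for b
    by (simp add: coords_def sum_distrib_left sum_negf mult.assoc)
  then have d: "(\<Sum>k\<in>UNIV. snd ?x $ k * A $ Some k $ Some b) = A $ None $ None * ?B $ None $ None * A $ None $ Some b" for b
    unfolding s(2) by (simp add: mult.assoc)
  have "block_diagonal (sect_inv ?x ** A)"
    unfolding block_diagonal_def
  proof (intro allI conjI)
    fix i
    show "(sect_inv ?x ** A) $ None $ Some i = 0"
      by (simp add: matrix_mult_option_nth c sum_negf d)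
    have "fst ?x $ i * A $ None $ None = A $ Some i $ None"
      using nz by (simp add: coords_def mult.assoc)
    then show "(sect_inv ?x ** A) $ Some i $ None = 0"
      by (simp add: matrix_mult_option_nth sum_delta_mult)
  qed
  then have "ginv (sect ?x) ** A \<in> H"
    using A sect_mem inv_mem mult_mem by (simp add: diag_subgroup_def) (metis inv_sect)
  then show ?thesis
    using coset_eqI[OF sect_mem] by metis
qed

lemma Cinf_on_coords:
  "Cinf_on {A. A $ None $ None \<noteq> 0} (coords ginv)"
proof -
  have o: "open {A :: 'a^('n option)^('n option). A $ None $ None \<noteq> 0}"
    by (intro open_Collect_neq continuous_intros)
  have i: "Cinf_on {A. A $ None $ None \<noteq> 0} ginv"
    using Cinf_on_subset[OF smooth_inv o] by simp
  show ?thesis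
    unfolding coords_def[abs_def]
    by (intro Cinf_intros o i) auto
qed

lemma chart_apply:
  assumes "g \<in> G" "x \<in> G"
  shows "snd (chart g) (coset H x) = coords ginv (ginv g ** x)"
proof -
  obtain h where h: "h \<in> H" "(SOME y. y \<in> coset H x) = x ** h"
    using some_mem_coset[OF assms(2)] .
  then show ?thesis
    using coords_mult_H[OF mult_mem[OF inv_mem[OF assms(1)] assms(2)] h(1)]
    by (simp add: std_chart_def matrix_mul_assoc)
qed

lemma coset_mem_chart_iff:
  assumes "g \<in> G" "x \<in> G"
  shows "coset H x \<in> fst (chart g) \<longleftrightarrow> (ginv g ** x) $ None $ None \<noteq> 0"
proof
  assume "coset H x \<in> fst (chart g)"
  then obtain y where y: "y \<in> G" "(ginv g ** y) $ None $ None \<noteq> 0" "coset H y = coset H x"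
    unfolding std_chart_def by auto
  then obtain h where h: "h \<in> H" "x = y ** h"
    using coset_eqD by blast
  then have "(ginv g ** x) $ None $ None = (ginv g ** y) $ None $ None * h $ None $ None"
    by (simp add: matrix_mul_assoc matrix_mult_option_nth[of _ h] H_block_diagonal)
  then show "(ginv g ** x) $ None $ None \<noteq> 0"
    using y H_corner(2)[OF h(1)] by simp
qed (use assms in \<open>auto simp: std_chart_def\<close>)

lemma chart_domain: "fst (chart g) \<subseteq> coset H ` G"
  by (auto simp: std_chart_def)

lemma chart_sect:
  assumes "g \<in> G"
  shows "coset H (g ** sect y) \<in> fst (chart g)" "snd (chart g) (coset H (g ** sect y)) = y"
  using assms by (simp_all add: coset_mem_chart_iff chart_apply mult_mem sect_mem inv_cancel coords_sect)

lemma coset_sect_chart: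
  assumes "g \<in> G" "p \<in> fst (chart g)"
  shows "coset H (g ** sect (snd (chart g) p)) = p"
proof -
  obtain x where x: "x \<in> G" "p = coset H x"
    using chart_domain assms(2) by blast
  then have nz: "(ginv g ** x) $ None $ None \<noteq> 0"
    using coset_mem_chart_iff assms by simp
  have m: "ginv g ** x \<in> G" using assms x mult_mem inv_mem by simp
  have "coset H (sect (coords ginv (ginv g ** x))) = coset H (ginv g ** x)"
    by (rule sect_coords[OF m nz])
  then have "coset H (g ** sect (coords ginv (ginv g ** x))) = coset H (g ** (ginv g ** x))"
    using coset_mult_left by metis
  then show ?thesis
    using x assms by (simp add: chart_apply inv_cancel)
qed

lemma chart_inj: "g \<in> G \<Longrightarrow> inj_on (snd (chart g)) (fst (chart g))"
  by (rule inj_onI) (metis coset_sect_chart)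

lemma chart_image: "g \<in> G \<Longrightarrow> snd (chart g) ` fst (chart g) = UNIV"
  using chart_sect by (metis UNIV_eq_I image_eqI)

lemma chart_inv_std: "g \<in> G \<Longrightarrow> chart_inv (chart g) y = coset H (g ** sect y)"
  unfolding chart_inv_def using chart_sect chart_inj by (metis inv_into_f_eq)

lemma charts_homogeneous_iff:
  "c \<in> charts (homogeneous_space G H) \<longleftrightarrow> fst c \<subseteq> coset H ` G \<and> inj_on (snd c) (fst c) \<and> open (snd c ` fst c) \<and>
        openin (top_of_set G) (\<Union>(fst c)) \<and>
        smooth_on (\<Union>(fst c)) (\<lambda>g. snd c (coset H g)) \<and>
        (\<forall>x\<in>snd c ` fst c. \<exists>V s. open V \<and> x \<in> V \<and> V \<subseteq> snd c ` fst c \<and>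
           smooth_on V s \<and> s ` V \<subseteq> G \<and> (\<forall>y\<in>V. coset H (s y) = chart_inv c y))"
  by (simp add: homogeneous_space_def)

lemma points_homogeneous [simp]: "points (homogeneous_space G H) = coset H ` G"
  by (simp add: homogeneous_space_def)

lemma open_corner: "open {x :: 'a^('n option)^('n option). (A ** x) $ None $ None \<noteq> 0}"
proof -
  have "continuous_on UNIV (\<lambda>x :: 'a^('n option)^('n option). A ** x)"
    by (rule Cinf_on_continuous) (intro Cinf_intros open_UNIV)
  then show ?thesis
    by (intro open_Collect_neq continuous_intros)
qed

text \<open>Used with the identity for the standard charts and with \<open>affine_coords\<close> for
  the affine ones. Membership in the maximal atlas is witnessed by \<open>\<psi>\<close> after
  \<open>coords\<close>, which is defined on an open set of matrices, and by the global lift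
  \<open>g ** sect (\<phi> y)\<close>.\<close>

lemma reparametrized_chart:
  fixes \<psi> \<phi> :: "('a^'n) \<times> ('a^'n) \<Rightarrow> ('a^'n) \<times> ('a^'n)"
  assumes g: "g \<in> G" and \<psi>: "Cinf_on D \<psi>" "\<psi> ` D \<subseteq> D'" "\<And>x. x \<in> D \<Longrightarrow> \<phi> (\<psi> x) = x"
    and \<phi>: "Cinf_on D' \<phi>" "\<phi> ` D' \<subseteq> D" "\<And>x. x \<in> D' \<Longrightarrow> \<psi> (\<phi> x) = x"
  defines "c \<equiv> ({p \<in> fst (chart g). snd (chart g) p \<in> D}, \<lambda>p. \<psi> (snd (chart g) p))"
  shows "c \<in> charts qspace" "snd c ` fst c = D'" "\<And>y. y \<in> D' \<Longrightarrow> chart_inv c y = coset H (g ** sect (\<phi> y))"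
proof -
  have inD: "coset H (g ** sect x) \<in> fst c" "snd c (coset H (g ** sect x)) = \<psi> x" if "x \<in> D" for x
    using that chart_sect[OF g] by (simp_all add: c_def)
  have inj: "inj_on (snd c) (fst c)"
  proof (rule inj_onI)
    fix p q assume "p \<in> fst c" "q \<in> fst c" "snd c p = snd c q"
    then have "snd (chart g) p \<in> D" "snd (chart g) q \<in> D" "\<psi> (snd (chart g) p) = \<psi> (snd (chart g) q)"
      by (simp_all add: c_def)
    then have "snd (chart g) p = snd (chart g) q"
      using \<psi>(3) by metis
    then show "p = q"
      using \<open>p \<in> fst c\<close> \<open>q \<in> fst c\<close> chart_inj[OF g] by (auto simp: c_def inj_on_def)
  qed
  show im: "snd c ` fst c = D'"
  proof (intro equalityI subsetI)
    fix y assume "y \<in> D'"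
    then show "y \<in> snd c ` fst c"
      using inD[of "\<phi> y"] \<phi> by (intro image_eqI[of _ _ "coset H (g ** sect (\<phi> y))"]) auto
  qed (use \<psi>(2) in \<open>auto simp: c_def\<close>)
  show ci: "chart_inv c y = coset H (g ** sect (\<phi> y))" if "y \<in> D'" for y
  proof -
    have "\<phi> y \<in> D" using that \<phi>(2) by blast
    then show ?thesis
      unfolding chart_inv_def using inv_into_f_eq[OF inj inD(1)] inD(2) \<phi>(3)[OF that] by metis
  qed
  let ?U = "{x :: 'a^('n option)^('n option). (ginv g ** x) $ None $ None \<noteq> 0}"
  let ?F = "\<lambda>x. coords ginv (ginv g ** x)"
  have F: "Cinf_on ?U ?F"
    by (rule Cinf_on_compose[OF _ Cinf_on_coords]) (auto intro!: Cinf_intros open_corner)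
  have S: "Cinf_on (?U \<inter> ?F -` D) (\<lambda>x. \<psi> (?F x))"
    by (rule Cinf_on_preimage[OF F \<psi>(1)])
  have dom: "fst c \<subseteq> coset H ` G"
    using chart_domain by (auto simp: c_def)
  have U: "\<Union>(fst c) = G \<inter> (?U \<inter> ?F -` D)"
    unfolding Union_cosets[OF dom] using coset_mem_chart_iff[OF g] chart_apply[OF g] by (auto simp: c_def)
  show "c \<in> charts qspace"
    unfolding charts_homogeneous_iff
  proof (intro conjI ballI dom inj)
    show "open (snd c ` fst c)"
      unfolding im by (rule Cinf_on_imp_open[OF \<phi>(1)])
    show "openin (top_of_set G) (\<Union>(fst c))"
      unfolding U by (rule openin_open_Int[OF Cinf_on_imp_open[OF S]])
    show "smooth_on (\<Union>(fst c)) (\<lambda>x. snd c (coset H x))"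
      unfolding smooth_on_def U
      using S chart_apply[OF g]
      by (intro ballI exI[of _ "?U \<inter> ?F -` D"] exI[of _ "\<lambda>x. \<psi> (?F x)"]) (auto simp: Cinf_on_def c_def)
    fix x assume "x \<in> snd c ` fst c"
    then have x: "x \<in> D'" unfolding im .
    have "Cinf_on D' (\<lambda>y. g ** sect (\<phi> y) :: 'a^('n option)^('n option))"
      by (intro Cinf_on_matrix_mult Cinf_on_const Cinf_on_imp_open[OF \<phi>(1)] Cinf_on_compose[OF \<phi>(1) Cinf_on_sect]) auto
    then have "smooth_on D' (\<lambda>y. g ** sect (\<phi> y) :: 'a^('n option)^('n option))"
      using smooth_on_iff_Cinf_on[OF Cinf_on_imp_open[OF \<phi>(1)]] by blast
    moreover have "(\<lambda>y. g ** sect (\<phi> y)) ` D' \<subseteq> G"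
      by (intro image_subsetI mult_mem g sect_mem)
    moreover have "\<forall>y\<in>D'. coset H (g ** sect (\<phi> y)) = chart_inv c y"
      using ci by simp
    ultimately show "\<exists>V s. open V \<and> x \<in> V \<and> V \<subseteq> snd c ` fst c \<and>
           smooth_on V s \<and> s ` V \<subseteq> G \<and> (\<forall>y\<in>V. coset H (s y) = chart_inv c y)"
      unfolding im using x Cinf_on_imp_open[OF \<phi>(1)] by blast
  qed
qed

lemma std_chart_in_charts:
  assumes g: "g \<in> G"
  shows "chart g \<in> charts (homogeneous_space G H)"
  using reparametrized_chart(1)[OF g, of UNIV "\<lambda>x. x" UNIV "\<lambda>x. x"] by (simp add: Cinf_on_id)

text \<open>Shrinking the domain of a local extension by an open set that cuts out the preimage of
  the chart domain controls membership and value together.\<close>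

lemma chart_extension:
  assumes c: "c \<in> charts (homogeneous_space G H)" and g: "g \<in> G" "coset H g \<in> fst c"
  shows "\<exists>U F. g \<in> U \<and> Cinf_on U F \<and> (\<forall>y\<in>G \<inter> U. coset H y \<in> fst c \<and> F y = snd c (coset H y))"
proof -
  note c' = c[unfolded charts_homogeneous_iff]
  have U: "\<Union>(fst c) = {g \<in> G. coset H g \<in> fst c}"
    using c' Union_cosets by blast
  obtain T where T: "open T" "\<Union>(fst c) = G \<inter> T"
    using c' by (auto simp: openin_open)
  have "g \<in> \<Union>(fst c)" using g U by blast
  then obtain V F where V: "open V" "g \<in> V" "\<forall>k. Ck_on k V F" "\<forall>y\<in>\<Union>(fst c) \<inter> V. F y = snd c (coset H y)"
    using conjunct1[OF conjunct2[OF conjunct2[OF conjunct2[OF conjunct2[OF c']]]],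
        unfolded smooth_on_def, rule_format, of g] by blast
  have "Cinf_on (V \<inter> T) F"
    using V T unfolding Cinf_on_def by (auto intro: Ck_on_subset)
  moreover have "g \<in> V \<inter> T"
    using V T \<open>g \<in> \<Union>(fst c)\<close> by blast
  moreover have "coset H y \<in> fst c \<and> F y = snd c (coset H y)" if "y \<in> G \<inter> (V \<inter> T)" for y
  proof -
    have "y \<in> \<Union>(fst c)" using that T by blast
    then show ?thesis using U V that by blast
  qed
  ultimately show ?thesis by blast
qed

text \<open>Right multiplication of a lift by a fixed element of \<open>H\<close> is again a lift,
  and a suitable element makes it pass through the prescribed representative
  \<open>g\<close>.\<close>

lemma chart_section:
  assumes c: "c \<in> charts (homogeneous_space G H)" and g: "g \<in> G" "coset H g \<in> fst c"
  shows "\<exists>V s. snd c (coset H g) \<in> V \<and> V \<subseteq> snd c ` fst c \<and> Cinf_on V s \<and> s ` V \<subseteq> G \<and>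
    s (snd c (coset H g)) = g \<and> (\<forall>y\<in>V. coset H (s y) = chart_inv c y)"
proof -
  note c' = c[unfolded charts_homogeneous_iff]
  obtain V s where V: "open V" "snd c (coset H g) \<in> V" "V \<subseteq> snd c ` fst c"
    "smooth_on V s" "s ` V \<subseteq> G" "\<forall>y\<in>V. coset H (s y) = chart_inv c y"
    using c' g by (metis (no_types, lifting) image_eqI)
  have s: "Cinf_on V s"
    using V smooth_on_iff_Cinf_on by blast
  have "chart_inv c (snd c (coset H g)) = coset H g"
    using c' g unfolding chart_inv_def by simp
  then have "coset H (s (snd c (coset H g))) = coset H g"
    using V by simp
  then obtain h where h: "h \<in> H" "g = s (snd c (coset H g)) ** h"
    using coset_eqD by blast
  have "Cinf_on V (\<lambda>y. s y ** h)"
    using V(1) s by (intro Cinf_intros)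
  then show ?thesis
    using V h by (intro exI[of _ V] exI[of _ "\<lambda>y. s y ** h"])
      (auto simp: coset_mult_H intro: mult_mem H_subset)
qed

lemma openin_quotient_iff:
  "openin (manifold_topology (homogeneous_space G H :: (_, 'e::euclidean_space) manifold)) W \<longleftrightarrow>
    W \<subseteq> coset H ` G \<and> (\<forall>c\<in>charts (homogeneous_space G H :: (_, 'e) manifold). open (snd c ` (fst c \<inter> W)))"
  by (subst openin_manifold_topology) (auto simp: charts_homogeneous_iff)

end

text \<open>Locally the coordinate expression is a lift to \<open>G\<close>, followed by the linear
  map \<open>\<Phi>\<close>, followed by an extended coordinate function on \<open>G'\<close>. With
  \<open>\<Phi>\<close> the identity this gives the transition maps of the atlas.\<close>

lemma homogeneous_map_rep:
  fixes \<phi> :: "('a::{real_normed_div_algebra,euclidean_space}^('n::finite option)^('n option)) set \<Rightarrow>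
      ('b::{real_normed_div_algebra,euclidean_space}^('m::finite option)^('m option)) set"
  assumes "block_group G ginv" "block_group G' ginv'" and \<Phi>: "bounded_linear \<Phi>" "\<Phi> ` G \<subseteq> G'"
    and \<phi>: "\<And>g. g \<in> G \<Longrightarrow> \<phi> (coset (diag_subgroup G) g) = coset (diag_subgroup G') (\<Phi> g)"
    and c: "c \<in> charts (homogeneous_space G (diag_subgroup G))"
    and d: "d \<in> charts (homogeneous_space G' (diag_subgroup G'))"
  shows "Cinf_on (snd c ` (fst c \<inter> \<phi> -` fst d)) (snd d \<circ> \<phi> \<circ> chart_inv c)"
proof -
  interpret G: block_group G ginv by fact
  interpret G': block_group G' ginv' by fact
  let ?S = "snd c ` (fst c \<inter> \<phi> -` fst d)" and ?f = "snd d \<circ> \<phi> \<circ> chart_inv c"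
  have loc: "\<exists>W. x \<in> W \<and> W \<subseteq> ?S \<and> Cinf_on W ?f" if x: "x \<in> ?S" for x
  proof -
    obtain p where p: "p \<in> fst c" "\<phi> p \<in> fst d" "x = snd c p"
      using x by blast
    obtain g where g: "g \<in> G" "p = coset G.H g"
      using p c[unfolded G.charts_homogeneous_iff] by blast
    obtain V s where V: "x \<in> V" "V \<subseteq> snd c ` fst c" "Cinf_on V s" "s ` V \<subseteq> G" "s x = g"
        "\<And>y. y \<in> V \<Longrightarrow> coset G.H (s y) = chart_inv c y"
      using G.chart_section[OF c g(1)] p g by blast
    have \<Phi>g: "\<Phi> g \<in> G'" "coset G'.H (\<Phi> g) \<in> fst d"
      using \<Phi>(2) g p \<phi>[OF g(1)] by auto
    obtain U F where U: "\<Phi> g \<in> U" "Cinf_on U F" "\<And>y. y \<in> G' \<inter> U \<Longrightarrow> coset G'.H y \<in> fst d \<and> F y = snd d (coset G'.H y)"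
      using G'.chart_extension[OF d \<Phi>g] by blast
    define W where "W = V \<inter> (\<lambda>y. \<Phi> (s y)) -` U"
    have W: "Cinf_on W (\<lambda>y. F (\<Phi> (s y)))"
      unfolding W_def by (rule Cinf_on_preimage[OF Cinf_on_bounded_linear[OF \<Phi>(1) V(3)] U(2)])
    have eq: "\<phi> (chart_inv c y) = coset G'.H (\<Phi> (s y)) \<and> \<phi> (chart_inv c y) \<in> fst d \<and> ?f y = F (\<Phi> (s y))"
      if "y \<in> W" for y
    proof -
      have y: "y \<in> V" "\<Phi> (s y) \<in> U" using that by (auto simp: W_def)
      have sG: "s y \<in> G" using V(4) y by blast
      then have 1: "\<phi> (chart_inv c y) = coset G'.H (\<Phi> (s y))"
        using \<phi>[OF sG] V(6)[OF y(1)] by simp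
      have "\<Phi> (s y) \<in> G' \<inter> U" using sG \<Phi>(2) y by blast
      from U(3)[OF this] show ?thesis using 1 by simp
    qed
    have "W \<subseteq> ?S"
    proof
      fix y assume y: "y \<in> W"
      then have "y \<in> snd c ` fst c" using V(2) by (auto simp: W_def)
      then show "y \<in> ?S"
        using chart_inv_right[of y c] eq[OF y] by (intro image_eqI[of _ _ "chart_inv c y"]) auto
    qed
    moreover have "x \<in> W"
      using V U by (simp add: W_def)
    moreover have "Cinf_on W ?f"
      by (rule iffD2[OF Cinf_on_cong W]) (use eq in blast)
    ultimately show ?thesis by blast
  qed
  have "open ?S"
    by (subst open_subopen) (use loc Cinf_on_imp_open in meson)
  then show ?thesis
    by (intro Cinf_on_local) (use loc in meson)
qed

lemma smooth_map_homogeneous: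
  fixes \<phi> :: "('a::{real_normed_div_algebra,euclidean_space}^('n::finite option)^('n option)) set \<Rightarrow>
      ('b::{real_normed_div_algebra,euclidean_space}^('m::finite option)^('m option)) set"
  assumes "block_group G ginv" "block_group G' ginv'" "bounded_linear \<Phi>" "\<Phi> ` G \<subseteq> G'"
    and "\<And>g. g \<in> G \<Longrightarrow> \<phi> (coset (diag_subgroup G) g) = coset (diag_subgroup G') (\<Phi> g)"
  shows "smooth_map (homogeneous_space G (diag_subgroup G)) (homogeneous_space G' (diag_subgroup G')) \<phi>"
proof -
  interpret G: block_group G ginv by fact
  interpret G': block_group G' ginv' by fact
  have "smooth_on (snd c ` (fst c \<inter> \<phi> -` fst d)) (snd d \<circ> \<phi> \<circ> chart_inv c) \<and> open (snd c ` (fst c \<inter> \<phi> -` fst d))"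
    if "c \<in> charts (homogeneous_space G G.H)" "d \<in> charts (homogeneous_space G' G'.H)" for c d
    using homogeneous_map_rep[OF assms that] Cinf_on_imp_open smooth_on_iff_Cinf_on by blast
  then show ?thesis
    unfolding smooth_map_def using assms(4,5) by auto
qed

section \<open>The quotient topology, its embedding into matrices, and the manifold axioms\<close>

context block_group
begin

text \<open>The manifold topology is the quotient topology. One direction uses that a standard chart
  extends continuously to a neighbourhood of a representative, the other that every chart has
  continuous local lifts to \<open>G\<close>.\<close>

lemma openin_quotient:
  "openin (manifold_topology qspace) W \<longleftrightarrow>
    W \<subseteq> coset H ` G \<and> openin (top_of_set G) (\<Union>W)" (is "?L \<longleftrightarrow> ?R")
proof
  assume L: ?L
  then have W: "W \<subseteq> coset H ` G" and o: "\<And>c. c \<in> charts qspace \<Longrightarrow> open (snd c ` (fst c \<inter> W))"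
    unfolding openin_quotient_iff by blast+
  have "\<exists>T. openin (top_of_set G) T \<and> g \<in> T \<and> T \<subseteq> \<Union>W" if g: "g \<in> \<Union>W" for g
  proof -
    have gG: "g \<in> G" "coset H g \<in> W" using g unfolding Union_cosets[OF W] by auto
    have c: "chart g \<in> charts (homogeneous_space G H)" by (rule std_chart_in_charts[OF gG(1)])
    have gc: "coset H g \<in> fst (chart g)"
      using gG by (simp add: coset_mem_chart_iff inv_left)
    obtain U F where U: "g \<in> U" "Cinf_on U F" "\<And>y. y \<in> G \<inter> U \<Longrightarrow> coset H y \<in> fst (chart g) \<and> F y = snd (chart g) (coset H y)"
      using chart_extension[OF c gG(1) gc] by blast
    let ?T = "G \<inter> (F -` (snd (chart g) ` (fst (chart g) \<inter> W)) \<inter> U)"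
    have "open (F -` (snd (chart g) ` (fst (chart g) \<inter> W)) \<inter> U)"
      using o[OF c] U(2) Cinf_on_continuous continuous_on_open_vimage Cinf_on_imp_open by blast
    then have "openin (top_of_set G) ?T"
      by (simp add: openin_open_Int)
    moreover have "g \<in> ?T"
      using U(1) U(3)[of g] gG gc by auto
    moreover have "y \<in> \<Union>W" if y: "y \<in> ?T" for y
    proof -
      have "coset H y \<in> fst (chart g)" "snd (chart g) (coset H y) \<in> snd (chart g) ` (fst (chart g) \<inter> W)"
        using y U(3)[of y] by auto
      then have "coset H y \<in> W"
        using inj_on_image_mem_iff[OF chart_inj[OF gG(1)], of "coset H y" "fst (chart g) \<inter> W"] by blast
      then show ?thesis using mem_coset by blast
    qed
    ultimately show ?thesis by blast
  qed
  then have "openin (top_of_set G) (\<Union>W)"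
    by (subst openin_subopen) blast
  then show ?R using W by blast
next
  assume R: ?R
  then obtain T where T: "open T" "\<Union>W = G \<inter> T"
    by (auto simp: openin_open)
  have "open (snd c ` (fst c \<inter> W))" if c: "c \<in> charts qspace" for c
  proof (subst open_subopen, intro ballI)
    fix x assume "x \<in> snd c ` (fst c \<inter> W)"
    then obtain p where p: "p \<in> fst c" "p \<in> W" "x = snd c p" by blast
    then obtain g where g: "g \<in> G" "p = coset H g" using R by blast
    obtain V s where V: "x \<in> V" "V \<subseteq> snd c ` fst c" "Cinf_on V s" "s ` V \<subseteq> G" "s x = g"
        "\<And>y. y \<in> V \<Longrightarrow> coset H (s y) = chart_inv c y"
      using chart_section[OF c g(1)] p g by blast
    have 1: "open (s -` T \<inter> V)"
      using T(1) V(3) Cinf_on_continuous continuous_on_open_vimage Cinf_on_imp_open by blast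
    have "g \<in> \<Union>W" using p g mem_coset by blast
    then have 2: "x \<in> s -` T \<inter> V" using V T by auto
    have "y \<in> snd c ` (fst c \<inter> W)" if y: "y \<in> s -` T \<inter> V" for y
    proof -
      have "s y \<in> \<Union>W" using y V(4) T(2) by blast
      then have "coset H (s y) \<in> W" using R Union_cosets[of W] by blast
      then have "chart_inv c y \<in> W" using V(6) y by auto
      moreover have "y \<in> snd c ` fst c" using V(2) y by blast
      ultimately show ?thesis
        using chart_inv_right[of y c] by (intro image_eqI[of _ _ "chart_inv c y"]) auto
    qed
    then show "\<exists>T. open T \<and> x \<in> T \<and> T \<subseteq> snd c ` (fst c \<inter> W)"
      using 1 2 by blast
  qed
  then show ?L
    unfolding openin_quotient_iff using R by blast
qed

text \<open>Conjugation of \<open>E00\<close> embeds the space of cosets into the matrices, which yields its topological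
  properties.\<close>

definition rank_one_proj :: "('a^('n option)^('n option)) set \<Rightarrow> 'a^('n option)^('n option)" where
  "rank_one_proj C = (SOME x. x \<in> C) ** E00 ** ginv (SOME x. x \<in> C)"

lemma proj_coset:
  assumes "g \<in> G"
  shows "rank_one_proj (coset H g) = g ** E00 ** ginv g"
proof -
  obtain h where h: "h \<in> H" "(SOME y. y \<in> coset H g) = g ** h"
    using some_mem_coset[OF assms] .
  have "h ** E00 = E00 ** h"
    using h by (simp add: diag_subgroup_def block_diagonal_iff_commute)
  then have "g ** h ** E00 ** (ginv h ** ginv g) = g ** (E00 ** h) ** (ginv h ** ginv g)"
    by (metis matrix_mul_assoc)
  also have "\<dots> = g ** E00 ** ginv g"
    by (simp add: matrix_mul_assoc[symmetric] inv_cancel(2)[OF H_subset[OF h(1)]])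
  finally show ?thesis
    using h assms by (simp add: rank_one_proj_def inv_mult H_subset)
qed

text \<open>Equal conjugates of \<open>E00\<close> under \<open>g\<close> and \<open>x\<close> say
  that \<open>ginv g ** x\<close> centralizes \<open>E00\<close>, hence lies in
  \<open>H\<close>.\<close>

lemma proj_inj: "inj_on rank_one_proj (coset H ` G)"
proof (rule inj_onI)
  fix p q assume "p \<in> coset H ` G" "q \<in> coset H ` G" and eq: "rank_one_proj p = rank_one_proj q"
  then obtain g x where g: "g \<in> G" "p = coset H g" and x: "x \<in> G" "q = coset H x" by blast
  have "g ** E00 ** ginv g = x ** E00 ** ginv x"
    using eq g x proj_coset by metis
  then have "ginv g ** (g ** E00 ** ginv g) ** x = ginv g ** (x ** E00 ** ginv x) ** x" by simp
  then have "E00 ** (ginv g ** x) = ginv g ** x ** E00"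
    by (simp add: matrix_mul_assoc[symmetric] inv_cancel(1)[OF g(1)] inv_left[OF x(1)])
  then have "ginv g ** x \<in> H"
    using g x by (simp add: diag_subgroup_def block_diagonal_iff_commute mult_mem inv_mem)
  then show "p = q"
    using coset_eqI g x by metis
qed

lemma proj_nth:
  "(g ** E00 ** ginv g) $ i $ j = g $ i $ None * ginv g $ None $ j"
proof -
  have "(g ** E00) $ i $ k = (if k = None then g $ i $ None else 0)" for k
    by (cases k) (simp_all add: matrix_mult_option_nth E00_def)
  then show ?thesis
    by (simp add: matrix_mult_option_nth)
qed

text \<open>The coordinates can be read off from the projection near any point, so \<open>rank_one_proj\<close> is open onto
  its image.\<close>

lemma coords_of_proj:
  assumes A: "A \<in> G" and nz: "(A ** E00 ** ginv A) $ None $ None \<noteq> 0"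
  shows "coords ginv A = (\<chi> a. (A ** E00 ** ginv A) $ Some a $ None * inverse ((A ** E00 ** ginv A) $ None $ None),
    \<chi> b. - (A ** E00 ** ginv A) $ None $ Some b)" "A $ None $ None \<noteq> 0"
proof -
  have nz': "A $ None $ None \<noteq> 0" "ginv A $ None $ None \<noteq> 0"
    using nz unfolding proj_nth by auto
  have "A $ Some a $ None * ginv A $ None $ None * inverse (A $ None $ None * ginv A $ None $ None) =
      A $ Some a $ None * inverse (A $ None $ None)" for a
    using nz' by (simp add: nonzero_inverse_mult_distrib mult.assoc) (simp flip: mult.assoc)
  then show "coords ginv A = (\<chi> a. (A ** E00 ** ginv A) $ Some a $ None * inverse ((A ** E00 ** ginv A) $ None $ None),
    \<chi> b. - (A ** E00 ** ginv A) $ None $ Some b)"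
    by (simp add: coords_def proj_nth)
  show "A $ None $ None \<noteq> 0" by (rule nz')
qed

lemma topspace_quotient:
  "topspace (manifold_topology qspace) = coset H ` G"
proof -
  have "openin (manifold_topology qspace) (coset H ` G)"
  proof -
    have "\<Union>(coset H ` G) = G"
      using Union_cosets[of "coset H ` G"] by auto
    then show ?thesis by (simp add: openin_quotient)
  qed
  moreover have "openin (manifold_topology qspace)
      (topspace (manifold_topology qspace))"
    by (rule openin_topspace)
  ultimately show ?thesis
    using openin_quotient openin_subset by blast
qed

lemma proj_continuous:
  "continuous_map (manifold_topology qspace) euclidean rank_one_proj"
  unfolding continuous_map openin_quotient topspace_quotient
proof (intro conjI allI impI)
  fix U :: "('a^('n option)^('n option)) set" assume "openin euclidean U"
  then have U: "open U" by simp
  show "{x \<in> coset H ` G. rank_one_proj x \<in> U} \<subseteq> coset H ` G" by blast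
  have "continuous_on UNIV (\<lambda>g. g ** E00 ** ginv g)"
    by (rule Cinf_on_continuous) (intro Cinf_intros open_UNIV smooth_inv)
  then have "open ((\<lambda>g. g ** E00 ** ginv g) -` U)"
    using U open_vimage by blast
  moreover have "\<Union>{x \<in> coset H ` G. rank_one_proj x \<in> U} = G \<inter> (\<lambda>g. g ** E00 ** ginv g) -` U"
    by (subst Union_cosets) (auto simp: proj_coset)
  ultimately show "openin (top_of_set G) (\<Union>{x \<in> coset H ` G. rank_one_proj x \<in> U})"
    by (simp add: openin_open_Int)
qed simp

text \<open>Besides continuity and injectivity this needs openness onto the image. After conjugating
  \<open>g\<close> to the base point, a representative of a nearby coset is recovered from its
  projector by a continuous formula.\<close>

lemma proj_embedding:
  "embedding_map (manifold_topology qspace) euclidean rank_one_proj"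
proof -
  let ?X = "manifold_topology qspace"
  let ?R = "rank_one_proj ` (coset H ` G)"
  have "open_map ?X (top_of_set ?R) rank_one_proj"
    unfolding open_map_def
  proof (intro allI impI)
    fix W assume "openin ?X W"
    then have W: "W \<subseteq> coset H ` G" "openin (top_of_set G) (\<Union>W)"
      by (auto simp: openin_quotient)
    obtain T where T: "open T" "\<Union>W = G \<inter> T"
      using W(2) by (auto simp: openin_open)
    have "\<exists>O'. open O' \<and> x \<in> O' \<and> ?R \<inter> O' \<subseteq> rank_one_proj ` W" if x: "x \<in> rank_one_proj ` W" for x
    proof -
      obtain g where g: "g \<in> G" "coset H g \<in> W" "x = rank_one_proj (coset H g)"
        using x W(1) by blast
      define \<kappa> :: "'a^('n option)^('n option) \<Rightarrow> ('a^'n) \<times> ('a^'n)"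
        where "\<kappa> P = (\<chi> a. P $ Some a $ None * inverse (P $ None $ None), \<chi> b. - P $ None $ Some b)" for P
      have conj: "Cinf_on UNIV (\<lambda>P. ginv g ** P ** g)"
        by (intro Cinf_intros open_UNIV)
      have o: "open {P :: 'a^('n option)^('n option). P $ None $ None \<noteq> 0}"
        by (intro open_Collect_neq continuous_intros)
      have "Cinf_on {P. P $ None $ None \<noteq> 0} (\<lambda>P. g ** sect (\<kappa> P))"
        unfolding \<kappa>_def by (intro Cinf_intros o Cinf_on_compose[OF _ Cinf_on_sect]) auto
      then have m: "Cinf_on (UNIV \<inter> (\<lambda>P. ginv g ** P ** g) -` {P. P $ None $ None \<noteq> 0}) (\<lambda>P. g ** sect (\<kappa> (ginv g ** P ** g)))"
        using Cinf_on_preimage[OF conj] by fast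
      \<comment> \<open>Matrices whose reconstructed representative lies in \<open>T\<close>, with
        the corner condition under which the reconstruction makes sense.\<close>
      define O' where "O' = (\<lambda>P. g ** sect (\<kappa> (ginv g ** P ** g))) -` T \<inter>
          (UNIV \<inter> (\<lambda>P. ginv g ** P ** g) -` {P. P $ None $ None \<noteq> 0})"
      have "open O'"
        unfolding O'_def
        using T(1) Cinf_on_continuous[OF m] continuous_on_open_vimage[OF Cinf_on_imp_open[OF m]] by blast
      have cj: "ginv g ** (y ** E00 ** ginv y) ** g = (ginv g ** y) ** E00 ** ginv (ginv g ** y)" if "y \<in> G" for y
        using g that by (simp add: inv_mult inv_mem inv_inv matrix_mul_assoc)
      have sub: "y ** E00 ** ginv y \<in> O' \<Longrightarrow> coset H y \<in> W" if y: "y \<in> G" for y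
      proof -
        assume *: "y ** E00 ** ginv y \<in> O'"
        let ?z = "ginv g ** y"
        have z: "?z \<in> G" using g y mult_mem inv_mem by blast
        have nz: "(?z ** E00 ** ginv ?z) $ None $ None \<noteq> 0" and gT: "g ** sect (\<kappa> (?z ** E00 ** ginv ?z)) \<in> T"
          using * unfolding O'_def cj[OF y, symmetric] by auto
        have "\<kappa> (?z ** E00 ** ginv ?z) = coords ginv ?z"
          unfolding \<kappa>_def using coords_of_proj(1)[OF z nz] by simp
        then have "g ** sect (coords ginv ?z) \<in> T" using gT by simp
        then have "g ** sect (coords ginv ?z) \<in> \<Union>W"
          using T g mult_mem sect_mem by blast
        then have 1: "coset H (g ** sect (coords ginv ?z)) \<in> W"
          using Union_cosets[OF W(1)] by blast
        have "coset H (g ** sect (coords ginv ?z)) = coset H (g ** ?z)"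
          using coset_mult_left sect_coords[OF z coords_of_proj(2)[OF z nz]] by metis
        then show ?thesis
          using 1 g by (simp add: inv_cancel)
      qed
      have one: "mat 1 ** E00 ** ginv (mat 1) = (E00 :: 'a^('n option)^('n option))"
        by (simp add: inv_unique[OF one_mem, of "mat 1"])
      have "\<kappa> (ginv g ** (g ** E00 ** ginv g) ** g) = 0"
        unfolding cj[OF g(1)] \<kappa>_def inv_left[OF g(1)] one
        by (simp add: E00_def prod_eq_iff vec_eq_iff)
      then have 0: "g ** sect (\<kappa> (ginv g ** (g ** E00 ** ginv g) ** g)) = g"
        by (simp add: sect_zero)
      have "g \<in> \<Union>W" using g mem_coset by blast
      then have "g \<in> T" using T by blast
      moreover have "(ginv g ** (g ** E00 ** ginv g) ** g) $ None $ None \<noteq> 0"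
        unfolding cj[OF g(1)] inv_left[OF g(1)] one by (simp add: E00_def)
      ultimately have "x \<in> O'"
        unfolding O'_def g(3) proj_coset[OF g(1)] using 0 by auto
      moreover have "?R \<inter> O' \<subseteq> rank_one_proj ` W"
        using sub by (auto simp: proj_coset)
      ultimately show ?thesis using \<open>open O'\<close> by blast
    qed
    then have "openin (top_of_set ?R) (rank_one_proj ` W)"
      using W(1) by (subst openin_subopen) (metis (no_types, lifting) IntI Int_commute image_mono openin_open_Int subsetD)
    then show "openin (top_of_set ?R) (rank_one_proj ` W)" .
  qed
  then have "embedding_map ?X (top_of_set ?R) rank_one_proj"
    using proj_continuous proj_inj
    by (intro injective_open_imp_embedding_map) (auto simp: continuous_map_in_subtopology topspace_quotient)
  then show ?thesis
    by (simp add: embedding_map_in_subtopology)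
qed

text \<open>Hausdorffness and second countability are inherited from the space of matrices through
  \<open>rank_one_proj\<close>; compatibility of charts is the case of the identity map in
  \<open>homogeneous_map_rep\<close>.\<close>

lemma smooth_manifold_homogeneous:
  "smooth_manifold qspace" (is "smooth_manifold ?M")
  unfolding smooth_manifold_def
proof (intro conjI ballI)
  let ?X = "manifold_topology ?M"
  have hs: "?X homeomorphic_space (subtopology euclidean (rank_one_proj ` topspace ?X))"
    by (rule embedding_map_imp_homeomorphic_space[OF proj_embedding])
  have "second_countable (euclidean :: ('a^('n option)^('n option)) topology)"
    unfolding second_countable_def using univ_second_countable
    by (metis open_openin topological_basisE topological_basis_def ex_countable_basis topological_basis_open)
  then show "second_countable ?X"
    using homeomorphic_space_second_countability[OF hs] second_countable_subtopology by blast
  show "Hausdorff_space ?X"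
    using homeomorphic_Hausdorff_space[OF hs] by (simp add: Hausdorff_space_subtopology)
  show "(\<Union>c\<in>charts ?M. fst c) = points ?M"
  proof (intro equalityI subsetI)
    fix p assume "p \<in> points ?M"
    then obtain g where g: "g \<in> G" "p = coset H g" by auto
    then have "p \<in> fst (chart g)" by (simp add: coset_mem_chart_iff inv_left)
    then show "p \<in> (\<Union>c\<in>charts ?M. fst c)" using std_chart_in_charts[OF g(1)] by blast
  qed (auto simp: charts_homogeneous_iff)
next
  fix c d assume c: "c \<in> charts ?M" "d \<in> charts ?M"
  have "Cinf_on (snd c ` (fst c \<inter> id -` fst d)) (snd d \<circ> id \<circ> chart_inv c)"
    by (rule homogeneous_map_rep[OF block_group_axioms block_group_axioms bounded_linear_ident _ _ c]) auto
  then show "open (snd c ` (fst c \<inter> fst d))" "smooth_on (snd c ` (fst c \<inter> fst d)) (snd d \<circ> chart_inv c)"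
    using smooth_on_iff_Cinf_on Cinf_on_imp_open by auto
qed (auto simp: charts_homogeneous_iff)

end

subsection \<open>Coordinate changes between standard charts\<close>

text \<open>The differential at the origin of the change from the chart centred at \<open>g ** sect y\<close> to the
  one centred at \<open>g\<close> is \<open>shear (snd y)\<close>.\<close>

definition shear :: "'a::ring_1^'n \<Rightarrow> ('a^'n) \<times> ('a^'n) \<Rightarrow> ('a^'n) \<times> ('a^'n::finite)" where
  "shear v x = (fst x, \<chi> b. snd x $ b + (\<Sum>k\<in>UNIV. v $ k * fst x $ k) * v $ b)"

definition shear_inv :: "'a::ring_1^'n \<Rightarrow> ('a^'n) \<times> ('a^'n) \<Rightarrow> ('a^'n) \<times> ('a^'n::finite)" where
  "shear_inv v x = (fst x, \<chi> b. snd x $ b - (\<Sum>k\<in>UNIV. v $ k * fst x $ k) * v $ b)"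

lemma shear_inverse [simp]: "shear v (shear_inv v x) = x" "shear_inv v (shear v x) = x"
  by (simp_all add: shear_def shear_inv_def prod_eq_iff vec_eq_iff)

text \<open>The linear isotropy representation: conjugation by a block-diagonal \<open>l\<close>,
  written on the two off-diagonal blocks.\<close>

definition isotropy ::
  "('a^('n option)^('n option) \<Rightarrow> 'a^('n option)^('n option)) \<Rightarrow>
    'a::real_normed_div_algebra^('n::finite option)^('n option) \<Rightarrow>
    ('a^'n) \<times> ('a^'n) \<Rightarrow> ('a^'n) \<times> ('a^'n)" where
  "isotropy ginv l x =
    (\<chi> a. (\<Sum>k\<in>UNIV. l $ Some a $ Some k * fst x $ k) * inverse (l $ None $ None),
     \<chi> b. l $ None $ None * (\<Sum>k\<in>UNIV. snd x $ k * ginv l $ Some k $ Some b))"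

definition off_diagonal :: "'a^('n::finite option)^('n option) \<Rightarrow> ('a^'n) \<times> ('a^'n)" where
  "off_diagonal X = (\<chi> a. X $ Some a $ None, \<chi> b. X $ None $ Some b)"

definition off_matrix :: "('a::zero^'n) \<times> ('a^'n) \<Rightarrow> 'a^('n::finite option)^('n option)" where
  "off_matrix x = (\<chi> i j. case i of
      None \<Rightarrow> (case j of None \<Rightarrow> 0 | Some b \<Rightarrow> snd x $ b)
    | Some a \<Rightarrow> (case j of None \<Rightarrow> fst x $ a | Some b \<Rightarrow> 0))"

lemma off_matrix_nth [simp]:
  "off_matrix x $ None $ None = 0" "off_matrix x $ None $ Some b = snd x $ b"
  "off_matrix x $ Some a $ None = fst x $ a" "off_matrix x $ Some a $ Some b = 0"
  by (simp_all add: off_matrix_def)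

lemma off_diagonal_off_matrix [simp]: "off_diagonal (off_matrix x) = x"
  by (simp add: off_diagonal_def)

lemma has_derivative_comps:
  "((\<lambda>z :: ('a::real_normed_vector^'n) \<times> ('a^'n). fst z $ k) has_derivative (\<lambda>h. fst h $ k)) (at z)"
  "((\<lambda>z :: ('a::real_normed_vector^'n) \<times> ('a^'n). snd z $ k) has_derivative (\<lambda>h. snd h $ k)) (at z)"
  by (auto intro!: bounded_linear_imp_has_derivative bounded_linear_compose[OF bounded_linear_vec_nth bounded_linear_fst]
      bounded_linear_compose[OF bounded_linear_vec_nth bounded_linear_snd])

context block_group
begin

lemma chart_at_sect: "g \<in> G \<Longrightarrow> chart g \<in> charts_at qspace (coset H (g ** sect y))"
  by (simp add: charts_at_def std_chart_in_charts chart_sect)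

lemma chart_at_center: "g \<in> G \<Longrightarrow> chart g \<in> charts_at qspace (coset H g)"
  using chart_at_sect[of g 0] by (simp add: sect_zero)

lemma chart_center: "g \<in> G \<Longrightarrow> snd (chart g) (coset H g) = 0"
  using chart_sect(2)[of g 0] by (simp add: sect_zero)

lemma coords_sect_mult:
  "coords ginv (sect y ** sect z) =
    (\<chi> a. (fst y $ a * (1 + (\<Sum>k\<in>UNIV. snd y $ k * fst z $ k)) + fst z $ a) * inverse (1 + (\<Sum>k\<in>UNIV. snd y $ k * fst z $ k)),
     \<chi> b. (1 + (\<Sum>k\<in>UNIV. snd y $ k * fst z $ k)) * ((1 + (\<Sum>k\<in>UNIV. snd z $ k * fst z $ k)) * snd y $ b + snd z $ b))"
proof -
  have 0: "(sect y ** sect z) $ None $ None = 1 + (\<Sum>k\<in>UNIV. snd y $ k * fst z $ k)"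
    by (simp add: matrix_mult_option_nth)
  have 1: "(sect y ** sect z) $ Some a $ None = fst y $ a * (1 + (\<Sum>k\<in>UNIV. snd y $ k * fst z $ k)) + fst z $ a" for a
    by (simp add: matrix_mult_option_nth distrib_right distrib_left sum.distrib sum_delta_mult sum_distrib_left mult.assoc)
  have 2: "ginv (sect y ** sect z) $ None $ Some b = - ((1 + (\<Sum>k\<in>UNIV. snd z $ k * fst z $ k)) * snd y $ b + snd z $ b)" for b
    by (simp add: inv_mult sect_mem inv_sect matrix_mult_option_nth sum_negf sum_delta_mult)
  show ?thesis
    unfolding coords_def 0 1 2 mult_minus_right minus_minus ..
qed

lemma has_derivative_coords_sect_mult:
  "((\<lambda>z. coords ginv (sect y ** sect z)) has_derivative shear (snd y)) (at 0)"
proof -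
  let ?q = "\<lambda>z :: ('a^'n) \<times> ('a^'n). 1 + (\<Sum>k\<in>UNIV. snd y $ k * fst z $ k)"
  let ?dq = "\<lambda>h :: ('a^'n) \<times> ('a^'n). \<Sum>k\<in>UNIV. snd y $ k * fst h $ k"
  let ?r = "\<lambda>z :: ('a^'n) \<times> ('a^'n). 1 + (\<Sum>k\<in>UNIV. snd z $ k * fst z $ k)"
  have q: "(?q has_derivative ?dq) (at 0)"
    by (auto intro!: derivative_eq_intros has_derivative_comps)
  \<comment> \<open>The non-constant part is quadratic in \<open>z\<close>, so nothing of first
    order remains at the origin.\<close>
  have r: "(?r has_derivative (\<lambda>h. 0)) (at 0)"
    by (auto intro!: derivative_eq_intros has_derivative_comps)
  have i: "((\<lambda>z. inverse (?q z)) has_derivative (\<lambda>h. - ?dq h)) (at 0)"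
    using Deriv.has_derivative_inverse[OF _ q] by simp
  have 1: "((\<lambda>z. (fst y $ a * ?q z + fst z $ a) * inverse (?q z)) has_derivative (\<lambda>h. fst h $ a)) (at 0)" for a
    using has_derivative_mult[OF has_derivative_add[OF has_derivative_mult_right[OF q, of "fst y $ a"] has_derivative_comps(1)[of a 0]] i]
    by simp
  have 2: "((\<lambda>z. ?q z * (?r z * snd y $ b + snd z $ b)) has_derivative (\<lambda>h. snd h $ b + ?dq h * snd y $ b)) (at 0)" for b
    using has_derivative_mult[OF q has_derivative_add[OF has_derivative_mult_left[OF r, of "snd y $ b"] has_derivative_comps(2)[of b 0]]]
    by simp
  have s: "shear (snd y) = (\<lambda>h. (\<chi> a. fst h $ a, \<chi> b. snd h $ b + ?dq h * snd y $ b))"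
    by (simp add: shear_def fun_eq_iff prod_eq_iff vec_eq_iff)
  show ?thesis
    unfolding coords_sect_mult s
    by (intro has_derivative_Pair has_derivative_vec_lambda 1 2)
qed

end

text \<open>The coordinate expression between standard charts is an explicit formula on the whole
  coordinate space, so any derivative of that formula is the chart derivative.\<close>

lemma chart_deriv_homogeneous:
  fixes \<phi> :: "('a::{real_normed_div_algebra,euclidean_space}^('n::finite option)^('n option)) set \<Rightarrow>
      ('b::{real_normed_div_algebra,euclidean_space}^('m::finite option)^('m option)) set"
  assumes "block_group G ginv" "block_group G' ginv'"
    and \<Phi>: "\<Phi> ` G \<subseteq> G'"
    and \<phi>: "\<And>g. g \<in> G \<Longrightarrow> \<phi> (coset (diag_subgroup G) g) = coset (diag_subgroup G') (\<Phi> g)"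
    and g: "g \<in> G" "g' \<in> G'"
    and D: "((\<lambda>z. coords ginv' (ginv' g' ** \<Phi> (g ** sect z))) has_derivative D) (at y)"
  shows "chart_deriv \<phi> (coset (diag_subgroup G) (g ** sect y)) (std_chart G ginv g) (std_chart G' ginv' g') = D"
proof -
  interpret G: block_group G ginv by fact
  interpret G': block_group G' ginv' by fact
  have "(snd (G'.chart g') \<circ> \<phi> \<circ> chart_inv (G.chart g)) z = coords ginv' (ginv' g' ** \<Phi> (g ** sect z))" for z
    using g G.mult_mem G.sect_mem \<Phi> by (simp add: G.chart_inv_std \<phi> G'.chart_apply image_subset_iff)
  then have "snd (G'.chart g') \<circ> \<phi> \<circ> chart_inv (G.chart g) = (\<lambda>z. coords ginv' (ginv' g' ** \<Phi> (g ** sect z)))"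
    by auto
  then show ?thesis
    using D g by (intro chart_deriv_eqI) (simp add: G.chart_sect)
qed

context block_group
begin

lemma chart_deriv_id_std:
  assumes "g \<in> G" "g' \<in> G" "((\<lambda>z. coords ginv (ginv g' ** (g ** sect z))) has_derivative D) (at y)"
  shows "chart_deriv id (coset H (g ** sect y)) (chart g) (chart g') = D"
  by (rule chart_deriv_homogeneous[OF block_group_axioms block_group_axioms, where \<Phi> = "\<lambda>x. x"]) (use assms in auto)

lemma chart_deriv_shear:
  assumes "g \<in> G"
  shows "chart_deriv id (coset H (g ** sect y)) (chart (g ** sect y)) (chart g) = shear (snd y)"
proof -
  have "(\<lambda>z. coords ginv (ginv g ** (g ** sect y ** sect z))) = (\<lambda>z. coords ginv (sect y ** sect z))"
    using assms by (simp add: matrix_mul_assoc[symmetric] inv_cancel)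
  then show ?thesis
    using chart_deriv_id_std[of "g ** sect y" g "shear (snd y)" 0] has_derivative_coords_sect_mult assms
    by (simp add: mult_mem sect_mem sect_zero)
qed

text \<open>Block-diagonal matrices normalize both unipotent factors, so moving \<open>l\<close> to
  the right only conjugates the blocks. Hence charts centred at the same coset through different
  representatives differ by a linear map.\<close>

lemma coords_H_sect:
  assumes "l \<in> H"
  shows "coords ginv (l ** sect z) = isotropy ginv l z"
  using assms H_inv[OF assms] H_block_diagonal[OF assms] H_block_diagonal[OF H_inv[OF assms]]
  by (simp add: coords_def isotropy_def inv_mult H_subset sect_mem inv_sect matrix_mult_option_nth sum_negf)

lemma linear_isotropy: "linear (isotropy ginv l)"
  by (rule linearI) (simp_all add: isotropy_def vec_eq_iff distrib_left distrib_right sum.distrib scaleR_sum_right[symmetric])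

lemma chart_deriv_isotropy:
  assumes "g \<in> G" "l \<in> H"
  shows "chart_deriv id (coset H g) (chart (g ** l)) (chart g) = isotropy ginv l"
proof -
  have "(\<lambda>z. coords ginv (ginv g ** (g ** l ** sect z))) = isotropy ginv l"
    using assms by (simp add: matrix_mul_assoc[symmetric] inv_cancel coords_H_sect)
  then show ?thesis
    using chart_deriv_id_std[of "g ** l" g "isotropy ginv l" 0] assms linear_imp_has_derivative[OF linear_isotropy]
    by (simp add: mult_mem H_subset sect_zero coset_mult_H)
qed

lemma coord_vec_isotropy:
  assumes "g \<in> G" "l \<in> H"
  shows "coord_vec qspace (coset H g) (chart (g ** l)) x = frame g (isotropy ginv l x)"
proof -
  have "chart (g ** l) \<in> charts_at qspace (coset H g)"
    using chart_at_center[of "g ** l"] assms by (simp add: mult_mem H_subset coset_mult_H)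
  then show ?thesis
    using coord_vec_change[OF smooth_manifold_homogeneous _ chart_at_center[OF assms(1)]] chart_deriv_isotropy[OF assms] by metis
qed

lemma coord_vec_shear:
  assumes "g \<in> G"
  shows "frame (g ** sect y) x =
    coord_vec qspace (coset H (g ** sect y)) (chart g) (shear (snd y) x)"
  using coord_vec_change[OF smooth_manifold_homogeneous chart_at_center[of "g ** sect y"] chart_at_sect[OF assms]]
    chart_deriv_shear[OF assms] assms by (metis mult_mem sect_mem)

lemma coord_vec_shear_inv:
  assumes "g \<in> G"
  shows "coord_vec qspace (coset H (g ** sect y)) (chart g) x =
    frame (g ** sect y) (shear_inv (snd y) x)"
  using coord_vec_shear[OF assms, of y "shear_inv (snd y) x"] by simp

lemma smooth_map_translation:
  assumes "k \<in> G"
  shows "smooth_map qspace qspace (\<lambda>C. (\<lambda>h. k ** h) ` C)"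
  by (rule smooth_map_homogeneous[OF block_group_axioms block_group_axioms
        bounded_bilinear.bounded_linear_right[OF bounded_bilinear_matrix_mult, of k]])
    (use assms mult_mem in \<open>auto simp: coset_mult_left\<close>)

text \<open>Read in the charts attached to \<open>g\<close> and \<open>k ** g\<close>, translation
  by \<open>k\<close> is the identity of the coordinate space.\<close>

lemma pushforward_translation:
  assumes "k \<in> G" "g \<in> G"
  shows "pushforward qspace qspace (\<lambda>C. (\<lambda>h. k ** h) ` C) (coset H g) (frame g x) =
    frame (k ** g) x"
proof -
  let ?\<tau> = "\<lambda>C. (\<lambda>h. k ** h) ` C"
  have "chart_deriv ?\<tau> (coset H (g ** sect 0)) (chart g) (chart (k ** g)) = (\<lambda>z. z)"
  proof (rule chart_deriv_homogeneous[OF block_group_axioms block_group_axioms, where \<Phi> = "\<lambda>x. k ** x"])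
    have "(\<lambda>z. coords ginv (ginv (k ** g) ** (k ** (g ** sect z)))) = (\<lambda>z. z)"
      using assms by (simp add: inv_mult matrix_mul_assoc[symmetric] inv_cancel coords_sect)
    then show "((\<lambda>z. coords ginv (ginv (k ** g) ** (k ** (g ** sect z)))) has_derivative (\<lambda>z. z)) (at 0)"
      by simp
  qed (use assms mult_mem in \<open>auto simp: coset_mult_left\<close>)
  then show ?thesis
    using pushforward_coord_vec[OF smooth_manifold_homogeneous smooth_manifold_homogeneous smooth_map_translation[OF assms(1)]
        chart_at_center[OF assms(2)], of "chart (k ** g)" x]
    by (simp add: coset_mult_left sect_zero chart_at_center mult_mem assms)
qed

text \<open>Shows that the projected velocity depends on the curve only through the off-diagonal
  part of \<open>X\<close>, which is the uniqueness behind \<open>base_vec\<close>.\<close>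

lemma velocity_at_one:
  assumes \<gamma>: "range \<gamma> \<subseteq> G" "\<gamma> 0 = mat 1" "(\<gamma> has_vector_derivative X) (at 0)"
  shows "velocity qspace (\<lambda>t. coset H (\<gamma> t)) = frame (mat 1) (off_diagonal X)"
proof -
  have \<gamma>G: "\<gamma> t \<in> G" for t using \<gamma>(1) by blast
  have d\<gamma>: "(\<gamma> has_derivative (\<lambda>h. h *\<^sub>R X)) (at 0)"
    using \<gamma>(3) by (simp add: has_vector_derivative_def)
  have inv1: "ginv (mat 1) = mat 1"
    by (rule inv_unique[OF one_mem]) simp
  define D where "D = frechet_derivative ginv (at (mat 1))"
  have "(ginv has_derivative D) (at (\<gamma> 0))"
    unfolding D_def \<gamma>(2) by (rule Cinf_on_has_derivative[OF smooth_inv]) simp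
  from has_derivative_compose[OF d\<gamma> this]
  have di: "((\<lambda>t. ginv (\<gamma> t)) has_derivative (\<lambda>h. D (h *\<^sub>R X))) (at 0)" .
  \<comment> \<open>Nothing explicit is known about the differential of \<open>ginv\<close>; its
    value on \<open>X\<close> is extracted by differentiating the constant curve
    \<open>ginv (\<gamma> t) ** \<gamma> t\<close>.\<close>
  have "((\<lambda>t. ginv (\<gamma> t) ** \<gamma> t) has_derivative (\<lambda>h. ginv (\<gamma> 0) ** (h *\<^sub>R X) + D (h *\<^sub>R X) ** \<gamma> 0)) (at 0)"
    by (rule bounded_bilinear.FDERIV[OF bounded_bilinear_matrix_mult di d\<gamma>])
  moreover have "((\<lambda>t. ginv (\<gamma> t) ** \<gamma> t) has_derivative (\<lambda>h. 0)) (at 0)"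
    using inv_left[OF \<gamma>G] by simp
  ultimately have "(\<lambda>h. ginv (\<gamma> 0) ** (h *\<^sub>R X) + D (h *\<^sub>R X) ** \<gamma> 0) = (\<lambda>h. 0)"
    by (rule has_derivative_unique)
  from fun_cong[OF this, of h for h] have DX: "D (h *\<^sub>R X) = - (h *\<^sub>R X)" for h
    by (simp add: \<gamma>(2) inv1 eq_neg_iff_add_eq_0 add.commute)
  have nth: "((\<lambda>t. f t $ i $ j) has_derivative (\<lambda>h. f' h $ i $ j)) (at 0)"
    if "(f has_derivative f') (at 0)" for f f' :: "real \<Rightarrow> 'a^('n option)^('n option)" and i j
    using bounded_linear.has_derivative[OF bounded_linear_vec_nth bounded_linear.has_derivative[OF bounded_linear_vec_nth that]] .
  have n: "((\<lambda>t. \<gamma> t $ i $ j) has_derivative (\<lambda>h. h *\<^sub>R X $ i $ j)) (at 0)" for i j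
    using nth[OF d\<gamma>] by simp
  have ni: "((\<lambda>t. ginv (\<gamma> t) $ i $ j) has_derivative (\<lambda>h. - (h *\<^sub>R X $ i $ j))) (at 0)" for i j
    using nth[OF di] unfolding DX by simp
  have ninv: "((\<lambda>t. inverse (\<gamma> t $ None $ None)) has_derivative (\<lambda>h. - (h *\<^sub>R X $ None $ None))) (at 0)"
    using Deriv.has_derivative_inverse[OF _ n[of None None]] by (simp add: \<gamma>(2))
  have 1: "((\<lambda>t. \<gamma> t $ Some a $ None * inverse (\<gamma> t $ None $ None)) has_derivative (\<lambda>h. h *\<^sub>R X $ Some a $ None)) (at 0)" for a
    using has_derivative_mult[OF n[of "Some a" None] ninv] by (simp add: \<gamma>(2))
  have 2: "((\<lambda>t. - (\<gamma> t $ None $ None * ginv (\<gamma> t) $ None $ Some b)) has_derivative (\<lambda>h. h *\<^sub>R X $ None $ Some b)) (at 0)" for b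
    using has_derivative_minus[OF has_derivative_mult[OF n[of None None] ni[of None "Some b"]]] by (simp add: \<gamma>(2) inv1)
  have "((\<lambda>t. coords ginv (\<gamma> t)) has_derivative (\<lambda>h. (\<chi> a. h *\<^sub>R X $ Some a $ None, \<chi> b. h *\<^sub>R X $ None $ Some b))) (at 0)"
    unfolding coords_def by (intro has_derivative_Pair has_derivative_vec_lambda 1 2)
  moreover have "(\<lambda>h. (\<chi> a. h *\<^sub>R X $ Some a $ None, \<chi> b. h *\<^sub>R X $ None $ Some b)) = (\<lambda>h. h *\<^sub>R off_diagonal X)"
    by (simp add: off_diagonal_def fun_eq_iff vec_eq_iff)
  moreover have "snd (chart (mat 1)) \<circ> (\<lambda>t. coset H (\<gamma> t)) = (\<lambda>t. coords ginv (\<gamma> t))"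
    by (simp add: fun_eq_iff chart_apply one_mem \<gamma>G inv1)
  ultimately have v: "(snd (chart (mat 1)) \<circ> (\<lambda>t. coset H (\<gamma> t)) has_vector_derivative off_diagonal X) (at 0)"
    by (simp add: has_vector_derivative_def)
  have "isCont (\<lambda>t. \<gamma> t $ None $ None) 0"
    using has_derivative_continuous[OF n] .
  then have "((\<lambda>t. \<gamma> t $ None $ None) \<longlongrightarrow> \<gamma> 0 $ None $ None) (nhds 0)"
    using tendsto_at_iff_tendsto_nhds[of "\<lambda>t. \<gamma> t $ None $ None" 0] by (simp add: continuous_at)
  then have "eventually (\<lambda>t. \<gamma> t $ None $ None \<noteq> 0) (nhds 0)"
    by (rule tendsto_imp_eventually_ne) (simp add: \<gamma>(2))
  then have ev: "eventually (\<lambda>t. coset H (\<gamma> t) \<in> fst (chart (mat 1))) (nhds 0)"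
    by (rule eventually_mono) (simp add: coset_mem_chart_iff one_mem \<gamma>G inv1)
  show ?thesis
    using velocity_eq_coord_vec[OF smooth_manifold_homogeneous _ ev v] chart_at_center[OF one_mem] \<gamma>(2) by simp
qed

text \<open>Supplies a curve in \<open>G\<close> with prescribed off-diagonal velocity, the
  existence half of \<open>base_vec\<close>; the only entries beyond first order are the quadratic
  ones in the lower block.\<close>

lemma has_vector_derivative_sect_line:
  fixes x :: "('a^'n) \<times> ('a^'n)"
  shows "((\<lambda>t. sect (t *\<^sub>R x)) has_vector_derivative
    off_matrix x) (at 0)"
proof -
  have d: "((\<lambda>t. t *\<^sub>R c) has_derivative (\<lambda>h. h *\<^sub>R c)) (at 0)" for c :: 'a
    by (auto intro!: derivative_eq_intros)
  have dd: "((\<lambda>t. (t * t) *\<^sub>R (c * e)) has_derivative (\<lambda>h. 0)) (at 0)" for c e :: 'a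
    using has_derivative_mult[OF d[of c] d[of e]] by simp
  have dd': "((\<lambda>t. 1 + (t * t) *\<^sub>R (c * e)) has_derivative (\<lambda>h. 0)) (at 0)" for c e :: 'a
    using has_derivative_add[OF has_derivative_const dd[of c e]] by simp
  have "((\<lambda>t. sect (t *\<^sub>R x) $ i $ j) has_derivative (\<lambda>h. h *\<^sub>R (case i of None \<Rightarrow> (case j of None \<Rightarrow> 0 | Some b \<Rightarrow> snd x $ b)
      | Some a \<Rightarrow> (case j of None \<Rightarrow> fst x $ a | Some b \<Rightarrow> 0)))) (at 0)" for i j
    by (cases i; cases j) (auto simp: d dd dd')
  then have "((\<lambda>t. \<chi> i. \<chi> j. sect (t *\<^sub>R x) $ i $ j) has_derivative (\<lambda>h. \<chi> i. \<chi> j. h *\<^sub>R (case i of None \<Rightarrow> (case j of None \<Rightarrow> 0 | Some b \<Rightarrow> snd x $ b)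
      | Some a \<Rightarrow> (case j of None \<Rightarrow> fst x $ a | Some b \<Rightarrow> 0)))) (at 0)"
    by (intro has_derivative_vec_lambda)
  moreover have "(\<lambda>h. \<chi> i. \<chi> j. h *\<^sub>R (case i of None \<Rightarrow> (case j of None \<Rightarrow> 0 | Some b \<Rightarrow> snd x $ b)
      | Some a \<Rightarrow> (case j of None \<Rightarrow> fst x $ a | Some b \<Rightarrow> 0))) =
    (\<lambda>h. h *\<^sub>R (\<chi> i j. case i of None \<Rightarrow> (case j of None \<Rightarrow> 0 | Some b \<Rightarrow> snd x $ b)
      | Some a \<Rightarrow> (case j of None \<Rightarrow> fst x $ a | Some b \<Rightarrow> 0)))"
    by (simp add: fun_eq_iff vec_eq_iff)
  ultimately show ?thesis
    unfolding has_vector_derivative_def off_matrix_def by (simp add: vec_lambda_eta)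
qed

end

subsection \<open>Inclusions of block groups\<close>

definition map_pair :: "('a \<Rightarrow> 'b) \<Rightarrow> ('a^'n) \<times> ('a^'n) \<Rightarrow> ('b^'n) \<times> ('b^'n)" where
  "map_pair f x = (\<chi> a. f (fst x $ a), \<chi> b. f (snd x $ b))"

text \<open>Extension of scalars along \<open>f\<close>. Besides the inclusions of real and complex
  scalars into the quaternions, the case \<open>f = id\<close> is used to construct the complex
  structure on the complex space itself.\<close>

locale block_group_hom = N: block_group G ginv + M: block_group G' ginv'
  for G :: "('a::{real_normed_div_algebra,euclidean_space}^('n::finite option)^('n option)) set" and ginv
    and G' :: "('b::{real_normed_div_algebra,euclidean_space}^('n::finite option)^('n option)) set" and ginv' +
  fixes f :: "'a \<Rightarrow> 'b"
  assumes f_linear: "bounded_linear f" and f_mult: "f (x * y) = f x * f y" and f_one: "f 1 = 1"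
    and f_inj: "inj f" and f_group: "A \<in> G \<Longrightarrow> map_matrix f A \<in> G'"
begin

lemma f_zero: "f 0 = 0"
  using linear_0[OF bounded_linear.linear[OF f_linear]] .

lemma f_add: "f (x + y) = f x + f y"
  using linear_add[OF bounded_linear.linear[OF f_linear]] .

lemma f_sum: "f (\<Sum>i\<in>I. g i) = (\<Sum>i\<in>I. f (g i))"
  using linear_sum[OF bounded_linear.linear[OF f_linear]] .

lemma map_matrix_mult: "map_matrix f (A ** B) = map_matrix f A ** map_matrix f B"
  by (simp add: map_matrix_def matrix_matrix_mult_def vec_eq_iff f_sum f_mult)

lemma map_matrix_one: "map_matrix f (mat 1) = mat 1"
  by (simp add: map_matrix_def mat_def vec_eq_iff f_one f_zero)

lemma map_matrix_inv: "A \<in> G \<Longrightarrow> ginv' (map_matrix f A) = map_matrix f (ginv A)"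
  by (rule M.inv_unique[OF f_group]) (simp_all add: map_matrix_mult[symmetric] N.inv_right map_matrix_one)

lemma map_matrix_sect: "map_matrix f (sect x) = sect (map_pair f x)"
  by (simp add: block_vec_eq_iff map_matrix_def map_pair_def f_one f_zero f_add f_mult)

lemma map_matrix_E00: "map_matrix f E00 = E00"
  by (simp add: map_matrix_def E00_def vec_eq_iff f_one f_zero)

lemma map_matrix_H: "h \<in> N.H \<Longrightarrow> map_matrix f h \<in> M.H"
  using f_group by (simp add: diag_subgroup_def block_diagonal_def map_matrix_def f_zero)

lemma linear_map_matrix: "linear (map_matrix f :: 'a^'k^'m \<Rightarrow> 'b^'k^'m)"
  using bounded_linear.linear[OF f_linear]
  by (intro linearI) (simp_all add: map_matrix_def vec_eq_iff f_add linear_cmul)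

lemma linear_map_pair: "linear (map_pair f :: ('a^'k) \<times> ('a^'k) \<Rightarrow> _)"
  using bounded_linear.linear[OF f_linear]
  by (intro linearI) (simp_all add: map_pair_def vec_eq_iff f_add linear_cmul)

lemma inj_map_matrix: "inj (map_matrix f)"
  using f_inj by (auto simp: inj_def map_matrix_def vec_eq_iff)

lemma inj_map_pair: "inj (map_pair f)"
  using f_inj by (auto simp: inj_def map_pair_def vec_eq_iff prod_eq_iff)

definition incl :: "('a^('n option)^('n option)) set \<Rightarrow> ('b^('n option)^('n option)) set" where
  "incl C = (\<Union>g\<in>C. coset M.H (map_matrix f g))"

lemma incl_coset: "incl (coset N.H g) = coset M.H (map_matrix f g)"
proof -
  have "coset M.H (map_matrix f x) = coset M.H (map_matrix f g)" if "x \<in> coset N.H g" for x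
    using that M.coset_mult_H[OF map_matrix_H] by (auto simp: coset_def[of N.H] map_matrix_mult)
  then show ?thesis
    unfolding incl_def using N.mem_coset[of g] by blast
qed

lemma smooth_map_incl: "smooth_map N.qspace M.qspace incl"
proof (rule smooth_map_homogeneous[OF N.block_group_axioms M.block_group_axioms])
  show "bounded_linear (map_matrix f :: 'a^('n option)^('n option) \<Rightarrow> _)"
    using linear_map_matrix by (simp add: linear_conv_bounded_linear)
qed (use f_group incl_coset in auto)

text \<open>Entrywise application of \<open>f\<close> commutes with products and with
  \<open>sect\<close>, so in matching standard charts the inclusion is the linear map
  \<open>map_pair f\<close> and equals its own derivative.\<close>

lemma chart_deriv_incl:
  assumes "g \<in> G"
  shows "chart_deriv incl (coset N.H (g ** sect y)) (N.chart g) (M.chart (map_matrix f g)) = map_pair f"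
proof (rule chart_deriv_homogeneous[OF N.block_group_axioms M.block_group_axioms, where \<Phi> = "map_matrix f"])
  have "(\<lambda>z. coords ginv' (ginv' (map_matrix f g) ** map_matrix f (g ** sect z))) = map_pair f"
    using assms by (simp add: fun_eq_iff map_matrix_mult M.inv_cancel f_group map_matrix_sect M.coords_sect)
  then show "((\<lambda>z. coords ginv' (ginv' (map_matrix f g) ** map_matrix f (g ** sect z))) has_derivative map_pair f) (at y)"
    using linear_imp_has_derivative[OF linear_map_pair] by simp
qed (use assms f_group incl_coset in auto)

lemma chart_deriv_incl_center:
  "g \<in> G \<Longrightarrow> chart_deriv incl (coset N.H g) (N.chart g) (M.chart (map_matrix f g)) = map_pair f"
  using chart_deriv_incl[of g 0] by (simp add: sect_zero)

lemma incl_sect: "g \<in> G \<Longrightarrow> incl (coset N.H (g ** sect y)) = coset M.H (map_matrix f g ** sect (map_pair f y))"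
  by (simp add: incl_coset map_matrix_mult map_matrix_sect)

lemma incl_chart_at:
  "g \<in> G \<Longrightarrow> M.chart (map_matrix f g) \<in> charts_at M.qspace (incl (coset N.H g))"
  by (simp add: incl_coset M.chart_at_center f_group)

lemma pushforward_incl:
  assumes "g \<in> G" "v \<in> tangent_space N.qspace (coset N.H g)"
  shows "pushforward N.qspace M.qspace incl (coset N.H g) v =
    M.frame (map_matrix f g) (map_pair f (v (N.chart g)))"
  using pushforward_apply[OF N.smooth_manifold_homogeneous M.smooth_manifold_homogeneous smooth_map_incl
      N.chart_at_center[OF assms(1)] incl_chart_at[OF assms(1)] assms(2)]
  by (simp add: chart_deriv_incl_center assms incl_coset)

text \<open>Under the projector embeddings the inclusion becomes the linear map
  \<open>map_matrix f\<close>, which reduces its topological properties to linear algebra.\<close>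

lemma proj_incl: "p \<in> points N.qspace \<Longrightarrow> M.rank_one_proj (incl p) = map_matrix f (N.rank_one_proj p)"
  by (auto simp: incl_coset M.proj_coset N.proj_coset f_group map_matrix_mult map_matrix_inv map_matrix_E00)

lemma embedding_map_matrix: "embedding_map euclidean euclidean (map_matrix f :: 'a^('n option)^('n option) \<Rightarrow> _)"
proof -
  obtain h :: "'b^('n option)^('n option) \<Rightarrow> 'a^('n option)^('n option)" where h: "linear h" "h \<circ> map_matrix f = id"
    using linear_injective_left_inverse[OF linear_map_matrix inj_map_matrix] by blast
  have hm: "h (map_matrix f A) = A" for A
    using h(2) by (metis comp_apply id_apply)
  have "homeomorphic_maps euclidean (top_of_set (range (map_matrix f :: 'a^('n option)^('n option) \<Rightarrow> _))) (map_matrix f) h"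
    unfolding homeomorphic_maps_def
    using hm linear_continuous_on[of h] h(1) linear_continuous_on[of "map_matrix f :: 'a^('n option)^('n option) \<Rightarrow> _" UNIV] linear_map_matrix
    by (auto simp: continuous_map_in_subtopology linear_conv_bounded_linear)
  then show ?thesis
    by (auto simp: embedding_map_def homeomorphic_map_maps)
qed

text \<open>\<open>incl\<close> is the composite of three embeddings: projectors on the small space,
  entrywise \<open>f\<close>, and the inverse \<open>k\<close> of the projector map on the large
  space.\<close>

lemma embedding_incl: "embedding_map (manifold_topology N.qspace) (manifold_topology M.qspace) incl"
proof -
  let ?X = "manifold_topology N.qspace" and ?Y = "manifold_topology M.qspace"
  let ?R = "M.rank_one_proj ` topspace ?Y"
  obtain k where k: "homeomorphic_maps ?Y (top_of_set ?R) M.rank_one_proj k"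
    using M.proj_embedding unfolding embedding_map_def homeomorphic_map_maps by blast
  then have "homeomorphic_map (top_of_set ?R) ?Y k"
    using homeomorphic_maps_sym homeomorphic_map_maps by blast
  then have ek: "embedding_map (top_of_set ?R) ?Y k"
    using surjective_embedding_map by blast
  have pt: "incl p \<in> topspace ?Y" "map_matrix f (N.rank_one_proj p) = M.rank_one_proj (incl p)" if "p \<in> topspace ?X" for p
    using that proj_incl[of p] f_group incl_coset by (auto simp: N.topspace_quotient M.topspace_quotient)
  have "embedding_map ?X euclidean (map_matrix f \<circ> N.rank_one_proj)"
    by (rule embedding_map_compose[OF N.proj_embedding embedding_map_matrix])
  then have "embedding_map ?X (top_of_set ?R) (map_matrix f \<circ> N.rank_one_proj)"
    unfolding embedding_map_in_subtopology using pt by auto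
  from embedding_map_compose[OF this ek]
  show ?thesis
  proof (rule embedding_map_eq)
    fix p assume p: "p \<in> topspace ?X"
    show "(k \<circ> (map_matrix f \<circ> N.rank_one_proj)) p = incl p"
      using k pt[OF p] by (simp add: homeomorphic_maps_def)
  qed
qed

lemma submanifold_incl: "submanifold N.qspace M.qspace incl"
  unfolding submanifold_def
proof (intro conjI ballI N.smooth_manifold_homogeneous M.smooth_manifold_homogeneous smooth_map_incl embedding_incl)
  fix p assume "p \<in> points N.qspace"
  then obtain g where g: "g \<in> G" "p = coset N.H g" by auto
  show "inj_on (pushforward N.qspace M.qspace incl p) (tangent_space N.qspace p)"
  proof (rule inj_onI)
    fix v w assume v: "v \<in> tangent_space N.qspace p" and w: "w \<in> tangent_space N.qspace p"
      and eq: "pushforward N.qspace M.qspace incl p v = pushforward N.qspace M.qspace incl p w"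
    let ?d = "M.chart (map_matrix f g)"
    have "coord_vec M.qspace (coset M.H (map_matrix f g)) ?d (map_pair f (v (N.chart g))) =
        coord_vec M.qspace (coset M.H (map_matrix f g)) ?d (map_pair f (w (N.chart g)))"
      using eq v w pushforward_incl g by simp
    from fun_cong[OF this, of ?d] have "map_pair f (v (N.chart g)) = map_pair f (w (N.chart g))"
      using coord_vec_same[OF M.smooth_manifold_homogeneous M.chart_at_center[OF f_group[OF g(1)]]] by simp
    then have "v (N.chart g) = w (N.chart g)"
      by (rule injD[OF inj_map_pair])
    then show "v = w"
      using tangent_space_eq_coord_vec[OF v] tangent_space_eq_coord_vec[OF w] N.chart_at_center[OF g(1)] g by metis
  qed
qed

end

section \<open>The groups\<close>

definition block_scale :: "real \<Rightarrow> 'a::real_algebra_1^('n::finite option)^('n option)" where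
  "block_scale c = (\<chi> i j. if i = j then (if i = None then 1 else of_real c) else 0)"

lemma block_scale_nth [simp]:
  "block_scale c $ None $ None = 1" "block_scale c $ None $ Some b = 0" "block_scale c $ Some a $ None = 0"
  "block_scale c $ Some a $ Some b = (if a = b then of_real c else 0)"
  by (simp_all add: block_scale_def)

lemma sum_delta_of_real:
  fixes f :: "'n::finite \<Rightarrow> 'a::real_algebra_1"
  shows "(\<Sum>k\<in>UNIV. (if a = k then of_real c else 0) * f k) = of_real c * f a"
    "(\<Sum>k\<in>UNIV. f k * (if k = a then of_real c else 0)) = f a * of_real c"
  by (simp_all add: if_distrib[of "\<lambda>x. x * _"] if_distrib[of "\<lambda>x. _ * x"] cong: if_cong)

text \<open>Conjugation by a diagonal matrix turns a unipotent block into its square.\<close>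

lemma multiplicative_sect:
  fixes \<delta> :: "'a::real_algebra_1^('n::finite option)^('n option) \<Rightarrow> 'f::field"
  assumes mult: "\<And>A B. \<delta> (A ** B) = \<delta> A * \<delta> B" and one: "\<delta> (mat 1) = 1"
  shows "\<delta> (sect x) = 1"
proof -
  have sq: "\<delta> A = 1" if "C ** C' = mat 1" "C ** A ** C' = A ** A" "A ** B = mat 1" for A B C C'
  proof -
    have c: "\<delta> C * \<delta> C' = 1" using mult[of C C'] one that(1) by simp
    have "\<delta> A * \<delta> B = 1" using mult[of A B] one that(3) by simp
    then have nz: "\<delta> A \<noteq> 0" by auto
    have "\<delta> A * \<delta> A = \<delta> C * \<delta> A * \<delta> C'" using mult that(2) by metis
    also have "\<dots> = \<delta> A" using c by (simp add: mult.commute mult.left_commute)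
    finally show ?thesis using nz by simp
  qed
  have half: "of_real 2 * of_real (1/2) = (1::'a)" "of_real (1/2) * of_real 2 = (1::'a)"
    unfolding of_real_mult[symmetric] by simp_all
  have half': "of_real (1/2) + of_real (1/2) = (1::'a)" "2 * of_real (1/2) = (1::'a)"
    using half(1) unfolding of_real_add[symmetric] by simp_all
  have two: "of_real 2 * y = y + y" "y * of_real 2 = y + y" for y :: 'a
    by (simp_all add: distrib_right[of 1 1 y, simplified] distrib_left[of y 1 1, simplified] mult_2 mult_2_right)
  have "\<delta> (sect (fst x, 0)) = 1"
    by (rule sq[of "block_scale 2" "block_scale (1/2)" _ "sect_inv (fst x, 0)"])
      (auto simp: sect_inv_right block_vec_eq_iff matrix_mult_option_nth sum_delta_of_real sum_delta_mult half half' two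
        simp del: of_real_numeral of_real_divide)
  \<comment> \<open>The scaling reaches the upper block from the right, so 2 and 1/2 trade
    places.\<close>
  moreover have "\<delta> (sect (0, snd x)) = 1"
    by (rule sq[of "block_scale (1/2)" "block_scale 2" _ "sect_inv (0, snd x)"])
      (auto simp: sect_inv_right block_vec_eq_iff matrix_mult_option_nth sum_delta_of_real sum_delta_mult half half' two
        simp del: of_real_numeral of_real_divide)
  moreover have "sect x = sect (fst x, 0) ** sect (0, snd x)"
    by (auto simp: block_vec_eq_iff matrix_mult_option_nth sum_delta_mult)
  ultimately show ?thesis
    using mult by simp
qed

text \<open>By Cramer's rule, inversion on the special linear group is the restriction of a polynomial map
  defined on all matrices.\<close>

definition cramer_inv :: "'a::comm_ring_1^'k^'k \<Rightarrow> 'a^'k^'k" where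
  "cramer_inv A = (\<chi> k j. det (\<chi> r c. if c = k then (if r = j then 1 else 0) else A $ r $ c))"

text \<open>Column \<open>j\<close> of \<open>cramer_inv A\<close> is the solution given by Cramer's
  rule for the \<open>j\<close>-th unit vector; with determinant 1 there is no denominator.\<close>

lemma cramer_inv_right:
  fixes A :: "'a::field^'k^'k"
  assumes "det A = 1"
  shows "A ** cramer_inv A = mat 1"
proof -
  have "A *v (\<chi> k. cramer_inv A $ k $ j) = (\<chi> r. if r = j then 1 else 0)" for j
    by (rule iffD2[OF cramer]) (simp_all add: assms cramer_inv_def vec_eq_iff cong: if_cong)
  then have "(A *v (\<chi> k. cramer_inv A $ k $ j)) $ i = (if i = j then 1 else 0)" for i j
    by simp
  then show ?thesis
    by (simp add: vec_eq_iff matrix_matrix_mult_def matrix_vector_mult_def mat_def)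
qed

lemma cramer_inv_left:
  fixes A :: "'a::field^'k^'k"
  assumes "det A = 1"
  shows "cramer_inv A ** A = mat 1"
  using cramer_inv_right[OF assms] matrix_left_right_inverse by blast

lemma det_cramer_inv:
  fixes A :: "'a::field^'k^'k"
  assumes "det A = 1"
  shows "det (cramer_inv A) = 1"
  using arg_cong[OF cramer_inv_right[OF assms], of det] assms by (simp add: det_mul)

lemma Cinf_on_cramer_inv: "Cinf_on UNIV (cramer_inv :: 'a::real_normed_field^'k^'k \<Rightarrow> _)"
proof -
  have "Cinf_on UNIV (\<lambda>A :: 'a^'k^'k. if c = k then (if r = j then 1 else 0) else A $ r $ c)" for r c k j
    by (cases "c = k"; cases "r = j") (simp_all add: Cinf_intros)
  then show ?thesis
    unfolding cramer_inv_def[abs_def] by (intro Cinf_on_vec_lambda open_UNIV Cinf_on_det)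
qed

lemma block_group_SL:
  "block_group (SL :: ('a::{real_normed_field,euclidean_space}^('n::finite option)^('n option)) set) cramer_inv"
proof
  show "sect x \<in> SL" for x :: "('a^'n) \<times> ('a^'n)"
    using multiplicative_sect[of det x] by (simp add: SL_def det_mul)
qed (auto simp: SL_def det_mul det_cramer_inv cramer_inv_left cramer_inv_right Cinf_on_cramer_inv)

subsection \<open>Quaternionic matrices as complex matrices\<close>

definition quat_a :: "quat \<Rightarrow> complex" where "quat_a q = Complex (qre q) (qi q)"
definition quat_b :: "quat \<Rightarrow> complex" where "quat_b q = Complex (qj q) (qk q)"

lemma quat_ab_mult:
  "quat_a (x * y) = quat_a x * quat_a y - quat_b x * cnj (quat_b y)"
  "quat_b (x * y) = quat_a x * quat_b y + quat_b x * cnj (quat_a y)"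
  by (simp_all add: quat_a_def quat_b_def complex_eq_iff)

lemma quat_ab_simps [simp]:
  "quat_a 0 = 0" "quat_b 0 = 0" "quat_a 1 = 1" "quat_b 1 = 0"
  "quat_a (x + y) = quat_a x + quat_a y" "quat_b (x + y) = quat_b x + quat_b y"
  "quat_a (r *\<^sub>R x) = r *\<^sub>R quat_a x" "quat_b (r *\<^sub>R x) = r *\<^sub>R quat_b x"
  by (simp_all add: quat_a_def quat_b_def complex_eq_iff)

lemma quat_ab_sum: "quat_a (\<Sum>i\<in>I. f i) = (\<Sum>i\<in>I. quat_a (f i))" "quat_b (\<Sum>i\<in>I. f i) = (\<Sum>i\<in>I. quat_b (f i))"
  by (induction I rule: infinite_finite_induct) auto

lemma complex_form_nth:
  "complex_form A $ (i, False) $ (j, False) = quat_a (A $ i $ j)"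
  "complex_form A $ (i, False) $ (j, True) = quat_b (A $ i $ j)"
  "complex_form A $ (i, True) $ (j, False) = - cnj (quat_b (A $ i $ j))"
  "complex_form A $ (i, True) $ (j, True) = cnj (quat_a (A $ i $ j))"
  by (simp_all add: complex_form_def quat_a_def quat_b_def Let_def)

lemma bool_vec_eq_iff:
  fixes A B :: "'a^('k::finite \<times> bool)^('k \<times> bool)"
  shows "A = B \<longleftrightarrow> (\<forall>i j. A $ (i, False) $ (j, False) = B $ (i, False) $ (j, False) \<and>
    A $ (i, False) $ (j, True) = B $ (i, False) $ (j, True) \<and> A $ (i, True) $ (j, False) = B $ (i, True) $ (j, False) \<and>
    A $ (i, True) $ (j, True) = B $ (i, True) $ (j, True))" (is "_ \<longleftrightarrow> ?R")
proof
  assume ?R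
  then have "A $ r $ s = B $ r $ s" for r s
    by (cases r; cases s; cases "snd r"; cases "snd s") auto
  then show "A = B" by (simp add: vec_eq_iff)
qed simp

lemma sum_prod_bool: "(\<Sum>t\<in>(UNIV :: ('k::finite \<times> bool) set). g t) = (\<Sum>k\<in>UNIV. g (k, False) + g (k, True))"
proof -
  have "(\<Sum>t\<in>UNIV \<times> UNIV. g t) = (\<Sum>k\<in>UNIV. \<Sum>b\<in>UNIV. g (k :: 'k, b :: bool))"
    by (simp add: sum.cartesian_product)
  then show ?thesis
    unfolding UNIV_Times_UNIV by (simp add: UNIV_bool add.commute)
qed

lemma complex_form_mult: "complex_form (A ** B) = complex_form A ** complex_form B"
  by (simp add: bool_vec_eq_iff matrix_matrix_mult_def sum_prod_bool complex_form_nth quat_ab_sum quat_ab_mult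
      sum.distrib sum_subtractf sum_negf algebra_simps)

lemma complex_form_one: "complex_form (mat 1) = mat 1"
  by (simp add: bool_vec_eq_iff complex_form_nth) (simp add: mat_def)

definition quat_form :: "complex^('k::finite \<times> bool)^('k \<times> bool) \<Rightarrow> quat^'k^'k" where
  "quat_form C = (\<chi> i j. Quat (Re (C $ (i, False) $ (j, False))) (Im (C $ (i, False) $ (j, False)))
    (Re (C $ (i, False) $ (j, True))) (Im (C $ (i, False) $ (j, True))))"

lemma quat_form_complex_form: "quat_form (complex_form A) = A"
  by (simp add: quat_form_def complex_form_nth quat_a_def quat_b_def vec_eq_iff)

text \<open>The fixed points of this multiplicative involution are the complex forms of quaternionic
  matrices.\<close>

definition quat_conj :: "complex^('k::finite \<times> bool)^('k \<times> bool) \<Rightarrow> complex^('k \<times> bool)^('k \<times> bool)" where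
  "quat_conj C = (\<chi> r s. (if snd r = snd s then 1 else - 1) * cnj (C $ (fst r, \<not> snd r) $ (fst s, \<not> snd s)))"

lemma quat_conj_complex_form: "quat_conj (complex_form A) = complex_form A"
  by (simp add: bool_vec_eq_iff quat_conj_def complex_form_nth)

lemma complex_form_quat_form:
  assumes "quat_conj C = C"
  shows "complex_form (quat_form C) = C"
proof -
  have "quat_conj C $ r $ s = C $ r $ s" for r s using assms by simp
  from this[of "(i, True)" "(j, False)" for i j] this[of "(i, True)" "(j, True)" for i j]
  show ?thesis
    by (auto simp: bool_vec_eq_iff quat_conj_def complex_form_nth quat_form_def quat_a_def quat_b_def)
qed

lemma quat_conj_mult: "quat_conj (C ** D) = quat_conj C ** quat_conj D"
  by (simp add: bool_vec_eq_iff quat_conj_def matrix_matrix_mult_def sum_prod_bool sum_negf sum.distrib add.commute)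

lemma quat_conj_one: "quat_conj (mat 1) = mat 1"
  by (simp add: bool_vec_eq_iff quat_conj_def) (simp add: mat_def)

definition quat_inv :: "quat^'k^'k \<Rightarrow> quat^'k^'k" where
  "quat_inv A = quat_form (cramer_inv (complex_form A))"

text \<open>\<open>quat_conj\<close> is multiplicative and fixes \<open>complex_form A\<close>, so
  it sends the inverse to another inverse and therefore fixes it; fixed matrices come from
  quaternionic ones.\<close>

lemma complex_form_quat_inv:
  assumes "A \<in> SL_H"
  shows "complex_form (quat_inv A) = cramer_inv (complex_form A)"
proof -
  let ?C = "complex_form A" and ?D = "cramer_inv (complex_form A)"
  have d: "det ?C = 1" using assms by (simp add: SL_H_def)
  have "?C ** quat_conj ?D = quat_conj (?C ** ?D)"
    by (simp add: quat_conj_mult quat_conj_complex_form)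
  also have "\<dots> = mat 1" by (simp add: cramer_inv_right[OF d] quat_conj_one)
  finally have "?D ** (?C ** quat_conj ?D) = ?D" by simp
  then have "quat_conj ?D = ?D"
    by (simp add: matrix_mul_assoc cramer_inv_left[OF d])
  then show ?thesis
    unfolding quat_inv_def by (rule complex_form_quat_form)
qed

lemma complex_form_inject: "complex_form A = complex_form B \<longleftrightarrow> A = B"
  using quat_form_complex_form by metis

lemma linear_complex_form: "linear (complex_form :: quat^'k^'k \<Rightarrow> _)"
  by (rule linearI) (simp_all add: bool_vec_eq_iff complex_form_nth)

lemma linear_quat_form: "linear (quat_form :: _ \<Rightarrow> quat^'k^'k)"
  by (rule linearI) (simp_all add: vec_eq_iff quat_form_def quat_eq_iff)

lemma block_group_SL_H:
  "block_group (SL_H :: (quat^('n::finite option)^('n option)) set) quat_inv"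
proof
  show "sect x \<in> SL_H" for x :: "(quat^'n) \<times> (quat^'n)"
    using multiplicative_sect[of "\<lambda>A. det (complex_form A)" x]
    by (simp add: SL_H_def complex_form_mult complex_form_one det_mul)
  have "Cinf_on UNIV (\<lambda>A :: quat^('n option)^('n option). quat_form (cramer_inv (complex_form A)))"
    using linear_quat_form linear_complex_form
    by (intro Cinf_on_bounded_linear[of quat_form] Cinf_on_compose[OF _ Cinf_on_cramer_inv] Cinf_on_bounded_linear_id)
      (auto simp: linear_conv_bounded_linear)
  then show "Cinf_on UNIV (quat_inv :: quat^('n option)^('n option) \<Rightarrow> _)"
    unfolding quat_inv_def[abs_def] .
  fix A :: "quat^('n option)^('n option)" assume A: "A \<in> SL_H"
  then have d: "det (complex_form A) = 1" by (simp add: SL_H_def)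
  show "quat_inv A ** A = mat 1" "A ** quat_inv A = mat 1"
    using cramer_inv_left[OF d] cramer_inv_right[OF d]
    by (simp_all add: complex_form_inject[symmetric] complex_form_mult complex_form_one complex_form_quat_inv[OF A])
  show "quat_inv A \<in> SL_H"
    by (simp add: SL_H_def complex_form_quat_inv[OF A] det_cramer_inv[OF d])
qed (auto simp: SL_H_def complex_form_mult complex_form_one det_mul)

section \<open>Determinants of complex matrices viewed as quaternionic ones\<close>

definition embed_matrix :: "('k \<Rightarrow> 'm) \<Rightarrow> 'a::{zero,one}^'k^'k \<Rightarrow> 'a^'m^'m" where
  "embed_matrix f A = (\<chi> r s. if r \<in> range f \<and> s \<in> range f then A $ inv f r $ inv f s else if r = s then 1 else 0)"

text \<open>In the Leibniz expansion only permutations fixing every index outside the range of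
  \<open>f\<close> contribute, and these correspond to the permutations of the small index set with
  the same sign.\<close>

lemma det_embed_matrix:
  fixes A :: "'a::comm_ring_1^'k^'k" and f :: "'k::finite \<Rightarrow> 'm::finite"
  assumes f: "inj f"
  shows "det (embed_matrix f A) = det A"
proof -
  let ?S = "range f" and ?M = "embed_matrix f A"
  let ?t = "\<lambda>p. of_int (sign p) * (\<Prod>r\<in>UNIV. ?M $ r $ p r)"
  have 0: "?t p = 0" if p: "p permutes UNIV" "\<not> p permutes ?S" for p
  proof -
    obtain r where r: "r \<notin> ?S" "p r \<noteq> r"
      using permutes_superset[OF p(1), of ?S] p(2) by auto
    then have "?M $ r $ p r = 0" by (auto simp: embed_matrix_def)
    then have "(\<Prod>r\<in>UNIV. ?M $ r $ p r) = 0"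
      by (intro prod_zero) auto
    then show ?thesis by simp
  qed
  have "det ?M = (\<Sum>p | p permutes ?S. ?t p)"
    unfolding det_def
    by (rule sum.mono_neutral_right) (use 0 permutes_subset[of _ ?S UNIV] in \<open>auto simp: finite_permutations\<close>)
  also have "\<dots> = (\<Sum>p | p permutes (UNIV :: 'k set). of_int (sign p) * (\<Prod>i\<in>UNIV. A $ i $ p i))"
  proof (rule sum.reindex_bij_witness[where i = "map_permutation UNIV f" and j = "map_permutation ?S (inv f)"])
    have b: "bij_betw f UNIV ?S" "bij_betw (inv f) ?S UNIV"
      using f by (auto simp: bij_betw_def inj_on_inv_into)
    show "map_permutation UNIV f p \<in> {p. p permutes ?S}" if "p \<in> {p. p permutes UNIV}" for p
      using map_permutation_permutes[OF b(1)] that by simp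
    show "map_permutation ?S (inv f) p \<in> {p. p permutes UNIV}" if "p \<in> {p. p permutes ?S}" for p
      using map_permutation_permutes[OF b(2)] that by simp
    show "map_permutation ?S (inv f) (map_permutation UNIV f p) = p" if "p \<in> {p. p permutes UNIV}" for p
      by (rule map_permutation_compose_inv[OF b(1)]) (use that f in auto)
    show inv_back: "map_permutation UNIV f (map_permutation ?S (inv f) p) = p" if "p \<in> {p. p permutes ?S}" for p
      by (rule map_permutation_compose_inv[OF b(2)]) (use that f in \<open>auto simp: f_inv_into_f\<close>)
    show "of_int (sign (map_permutation ?S (inv f) p)) * (\<Prod>i\<in>UNIV. A $ i $ map_permutation ?S (inv f) p i) = ?t p"
      if p: "p \<in> {p. p permutes ?S}" for p
    proof -
      let ?q = "map_permutation ?S (inv f) p"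
      have s: "sign ?q = sign p"
        by (rule sign_map_permutation) (use p f in \<open>auto simp: inj_on_inv_into\<close>)
      have q: "p (f i) = f (?q i)" for i
        using map_permutation_apply[OF f, of i ?q] inv_back[OF p] by simp
      have "(\<Prod>r\<in>UNIV. ?M $ r $ p r) = (\<Prod>r\<in>?S. ?M $ r $ p r) * (\<Prod>r\<in>UNIV - ?S. ?M $ r $ p r)"
        using prod.subset_diff[of ?S UNIV "\<lambda>r. ?M $ r $ p r"] by (simp add: mult.commute)
      also have "(\<Prod>r\<in>UNIV - ?S. ?M $ r $ p r) = 1"
        by (rule prod.neutral) (use p in \<open>auto simp: embed_matrix_def permutes_def\<close>)
      also have "(\<Prod>r\<in>?S. ?M $ r $ p r) = (\<Prod>i\<in>UNIV. A $ i $ ?q i)"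
        unfolding prod.reindex[OF f] by (simp add: q embed_matrix_def f)
      finally show ?thesis by (simp add: s)
    qed
  qed
  finally show ?thesis
    by (simp add: det_def)
qed

lemma det_cnj: "det (map_matrix cnj A) = cnj (det A)"
  by (simp add: det_def map_matrix_def)

text \<open>Complex entries have no \<open>j\<close> part, so the complex form is block diagonal
  with blocks \<open>A\<close> and its conjugate. The factorization turns its determinant into the
  squared modulus of \<open>det A\<close>.\<close>

lemma complex_form_of_complex:
  "complex_form (map_matrix quat_of_complex A) =
    embed_matrix (\<lambda>i. (i, False)) A ** embed_matrix (\<lambda>i. (i, True)) (map_matrix cnj A)"
proof -
  have inv: "inv (\<lambda>i::'a. (i, b)) (j, b) = j" for b :: bool and j
    by (rule inv_f_f) (auto simp: inj_def)
  have r: "(j, b) \<in> range (\<lambda>i::'a. (i, c)) \<longleftrightarrow> b = c" for b c :: bool and j by auto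
  have n: "quat_a (quat_of_complex z) = z" "quat_b (quat_of_complex z) = 0" for z
    by (simp_all add: quat_a_def quat_b_def quat_of_complex_def complex_eq_iff)
  show ?thesis
    by (simp add: bool_vec_eq_iff matrix_matrix_mult_def sum_prod_bool embed_matrix_def inv r complex_form_nth
        map_matrix_def n sum.distrib if_distrib[of "\<lambda>x. x * _"] if_distrib[of "\<lambda>x. _ * x"] cong: if_cong)
qed

lemma det_complex_form_of_complex: "det (complex_form (map_matrix quat_of_complex A)) = det A * cnj (det A)"
  by (simp add: complex_form_of_complex det_mul det_embed_matrix inj_def det_cnj)

lemma quat_of_complex_simps [simp]:
  "quat_of_complex (x + y) = quat_of_complex x + quat_of_complex y"
  "quat_of_complex (x * y) = quat_of_complex x * quat_of_complex y"
  "quat_of_complex 1 = 1" "quat_of_complex 0 = 0"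
  "quat_of_complex (r *\<^sub>R x) = r *\<^sub>R quat_of_complex x"
  "quat_of_complex (- x) = - quat_of_complex x"
  by (simp_all add: quat_of_complex_def quat_eq_iff)

lemma quat_of_complex_sel [simp]:
  "qre (quat_of_complex z) = Re z" "qi (quat_of_complex z) = Im z" "qj (quat_of_complex z) = 0" "qk (quat_of_complex z) = 0"
  by (simp_all add: quat_of_complex_def)

lemma block_group_hom_complex:
  "block_group_hom (SL :: (complex^('n::finite option)^('n option)) set) cramer_inv SL_H quat_inv quat_of_complex"
proof (intro block_group_hom.intro block_group_SL block_group_SL_H block_group_hom_axioms.intro)
  show "bounded_linear quat_of_complex"
    by (simp flip: linear_conv_bounded_linear add: linearI)
  show "inj quat_of_complex"
    by (auto simp: inj_def quat_of_complex_def complex_eq_iff)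
  show "map_matrix quat_of_complex A \<in> SL_H" if "A \<in> SL" for A :: "complex^('n option)^('n option)"
    using that by (simp add: SL_H_def SL_def det_complex_form_of_complex)
qed auto

lemma quat_of_real_sel [simp]:
  "qre (of_real r) = r" "qi (of_real r) = 0" "qj (of_real r) = 0" "qk (of_real r) = 0"
  by (simp_all add: of_real_def)

lemma det_of_real: "det (map_matrix of_real A) = (of_real (det A) :: complex)"
  by (simp add: det_def map_matrix_def)

lemma block_group_hom_real:
  "block_group_hom (SL :: (real^('n::finite option)^('n option)) set) cramer_inv SL_H quat_inv of_real"
proof (intro block_group_hom.intro block_group_SL block_group_SL_H block_group_hom_axioms.intro)
  show "bounded_linear (of_real :: real \<Rightarrow> quat)"
    by (rule bounded_linear_of_real)
  show "inj (of_real :: real \<Rightarrow> quat)"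
    by (auto simp: inj_def)
  show "map_matrix of_real A \<in> SL_H" if "A \<in> SL" for A :: "real^('n option)^('n option)"
  proof -
    have "map_matrix of_real A = map_matrix quat_of_complex (map_matrix of_real A)"
      by (simp add: map_matrix_def vec_eq_iff quat_eq_iff)
    then show ?thesis
      using that by (simp add: SL_H_def SL_def det_complex_form_of_complex det_of_real)
  qed
qed auto

section \<open>The Lie algebra\<close>

lemma sum_Basis_vec:
  "(\<Sum>e\<in>(Basis :: ('a::euclidean_space^'n) set). g e) = (\<Sum>i\<in>UNIV. \<Sum>u\<in>Basis. g (axis i u))"
proof -
  have B: "(Basis :: ('a^'n) set) = (\<lambda>(i, u). axis i u) ` (UNIV \<times> Basis)"
    by (auto simp: Basis_vec_def)
  have "inj_on (\<lambda>(i, u). axis i u :: 'a^'n) (UNIV \<times> Basis)"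
    by (auto simp: inj_on_def axis_eq_axis)
  then show ?thesis
    unfolding B by (simp add: sum.reindex sum.cartesian_product case_prod_unfold)
qed

text \<open>The sum is the real trace of two-sided multiplication on the four-dimensional space of
  quaternions.\<close>

lemma quat_trace_mult: "(\<Sum>u\<in>Basis. (a * u * b) \<bullet> u) = 4 * qre a * qre b"
  by (simp add: Basis_quat_def inner_quat_def one_quat_def algebra_simps)

lemma trace_matrix_mult_left_right:
  fixes A B :: "quat^'k^'k"
  shows "(\<Sum>E\<in>Basis. (A ** E ** B) \<bullet> E) = (\<Sum>i\<in>UNIV. \<Sum>j\<in>UNIV. 4 * qre (A $ i $ i) * qre (B $ j $ j))"
proof -
  have "(A ** axis i (axis j u) ** B) $ i $ j = A $ i $ i * u * B $ j $ j" for i j u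
    by (simp add: matrix_matrix_mult_def axis_def if_distrib[of "\<lambda>x. x * _"] if_distrib[of "\<lambda>x. _ * x"]
        if_distrib[of "\<lambda>x. x $ _"] cong: if_cong)
  then show ?thesis
    by (simp add: sum_Basis_vec inner_axis quat_trace_mult)
qed

text \<open>A map with image in \<open>S\<close> has equal traces on \<open>S\<close> and on the
  whole space. This permits computing the Killing form over all matrices with the standard
  basis.\<close>

lemma trace_on_eq:
  fixes f :: "'v::euclidean_space \<Rightarrow> 'v"
  assumes S: "subspace S" and f: "linear f" "range f \<subseteq> S"
  shows "trace_on S f = (\<Sum>e\<in>Basis. f e \<bullet> e)"
proof -
  define B where "B = (SOME B. B \<subseteq> S \<and> independent B \<and> span B = S)"
  have "\<exists>B. B \<subseteq> S \<and> independent B \<and> span B = S"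
    using maximal_independent_subset[of S] span_subspace[OF _ _ S] by metis
  then have B: "B \<subseteq> S" "independent B" "span B = S"
    unfolding B_def using someI_ex by (metis (mono_tags, lifting))+
  have fin: "finite B" using B(2) independent_imp_finite by blast
  have fs: "f v \<in> span B" for v using f(2) B(3) by blast
  have lin: "linear (\<lambda>v. representation B (f v) b)" for b
    using f(1) B(2) fs by (intro linearI) (auto simp: linear_add linear_cmul representation_add representation_scale)
  have rep: "(\<Sum>b\<in>B. representation B (f v) b *\<^sub>R b) = f v" for v
    using sum_representation_eq[OF B(2) _ fin subset_refl, of "f v"] f(2) B(3) by auto
  have "trace_on S f = (\<Sum>b\<in>B. representation B (f b) b)"
    by (simp add: trace_on_def Let_def B_def)
  also have "\<dots> = (\<Sum>b\<in>B. \<Sum>e\<in>Basis. (b \<bullet> e) * representation B (f e) b)"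
  proof (rule sum.cong[OF refl])
    show "representation B (f b) b = (\<Sum>e\<in>Basis. (b \<bullet> e) * representation B (f e) b)" for b
      using linear_Basis_expansion[OF lin[of b], of b] by simp
  qed
  also have "\<dots> = (\<Sum>e\<in>Basis. (\<Sum>b\<in>B. representation B (f e) b *\<^sub>R b) \<bullet> e)"
    by (subst sum.swap) (simp add: inner_sum_left mult.commute)
  finally show ?thesis by (simp add: rep)
qed

lemma qre_sum: "qre (\<Sum>i\<in>I. f i) = (\<Sum>i\<in>I. qre (f i))"
  by (induction I rule: infinite_finite_induct) auto

lemma qre_mult_commute: "qre (x * y) = qre (y * x)"
  by simp

lemma qre_trace_commute: "qre (trace (A ** B)) = qre (trace (B ** A))"
proof -
  have "qre (trace (A ** B)) = (\<Sum>i\<in>UNIV. \<Sum>k\<in>UNIV. qre (A $ i $ k * B $ k $ i))"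
    by (simp add: trace_def matrix_matrix_mult_def qre_sum del: quat_times_sel)
  also have "\<dots> = (\<Sum>k\<in>UNIV. \<Sum>i\<in>UNIV. qre (B $ k $ i * A $ i $ k))"
    by (subst sum.swap) (simp only: qre_mult_commute[of "A $ _ $ _"])
  also have "\<dots> = qre (trace (B ** A))"
    by (simp add: trace_def matrix_matrix_mult_def qre_sum del: quat_times_sel)
  finally show ?thesis .
qed

lemma linear_ad: "linear (ad X)"
  unfolding ad_def
  using bounded_bilinear.bounded_linear_right[OF bounded_bilinear_matrix_mult, of X]
    bounded_bilinear.bounded_linear_left[OF bounded_bilinear_matrix_mult, of X]
  by (intro linear_compose_sub) (auto intro: bounded_linear.linear)

lemma subspace_sl_H: "subspace sl_H"
  by (auto simp: subspace_def sl_H_def trace_def qre_sum sum.distrib sum_distrib_left[symmetric])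

lemma ad_in_sl_H: "ad X Y \<in> sl_H"
proof -
  have "qre (trace (A - B)) = qre (trace A) - qre (trace B)" for A B :: "quat^'a^'a"
    by (simp add: trace_def qre_sum sum_subtractf)
  then show ?thesis
    using qre_trace_commute[of X Y] by (simp add: sl_H_def ad_def)
qed

lemma lie_m_nth: "X \<in> lie_m \<Longrightarrow> X $ None $ None = 0" "X \<in> lie_m \<Longrightarrow> X $ Some a $ Some b = 0"
  by (simp_all add: lie_m_def block_off_diagonal_def)

lemma off_matrix_in_lie_m: "off_matrix x \<in> lie_m"
  by (simp add: lie_m_def block_off_diagonal_def sl_H_def trace_def sum_option)

lemma off_matrix_off_diagonal: "X \<in> lie_m \<Longrightarrow> off_matrix (off_diagonal X) = X"
  by (simp add: block_vec_eq_iff off_diagonal_def lie_m_nth)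

text \<open>\<open>ad X (ad Y E)\<close> has two one-sided terms, each contributing four times the
  matrix size times the real trace of \<open>X ** Y\<close>, and two mixed terms, whose traces
  involve only the vanishing diagonals of \<open>X\<close> and \<open>Y\<close>. Hence the factor
  8.\<close>

lemma killing_form_lie_m:
  fixes X Y :: "quat^('n::finite option)^('n option)"
  assumes X: "X \<in> lie_m" and Y: "Y \<in> lie_m"
  shows "killing_form X Y = 8 * real CARD('n option) *
    (\<Sum>k\<in>UNIV. qre (snd (off_diagonal X) $ k * fst (off_diagonal Y) $ k) + qre (snd (off_diagonal Y) $ k * fst (off_diagonal X) $ k))"
proof -
  let ?N = "real CARD('n option)"
  have d: "X $ i $ i = 0" "Y $ i $ i = 0" for i
    using lie_m_nth[OF X] lie_m_nth[OF Y] by (cases i; simp)+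
  have "killing_form X Y = (\<Sum>E\<in>Basis. (ad X \<circ> ad Y) E \<bullet> E)"
    unfolding killing_form_def
    by (rule trace_on_eq[OF subspace_sl_H linear_compose[OF linear_ad linear_ad]]) (auto simp: ad_in_sl_H)
  also have "\<dots> = (\<Sum>E\<in>Basis. (X ** Y ** E ** mat 1) \<bullet> E - (X ** E ** Y) \<bullet> E - (Y ** E ** X) \<bullet> E + (mat 1 ** E ** (Y ** X)) \<bullet> E)"
  proof (rule sum.cong[OF refl])
    fix E :: "quat^('n option)^('n option)"
    have sub: "A ** (B - C) = A ** B - A ** C" "(B - C) ** A = B ** A - C ** A" for A B C :: "quat^('n option)^('n option)"
      using bounded_bilinear.diff_right[OF bounded_bilinear_matrix_mult] bounded_bilinear.diff_left[OF bounded_bilinear_matrix_mult] by auto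
    show "(ad X \<circ> ad Y) E \<bullet> E = (X ** Y ** E ** mat 1) \<bullet> E - (X ** E ** Y) \<bullet> E - (Y ** E ** X) \<bullet> E + (mat 1 ** E ** (Y ** X)) \<bullet> E"
      by (simp add: ad_def sub matrix_mul_assoc inner_diff_left)
  qed
  also have "\<dots> = 4 * ?N * qre (trace (X ** Y)) + 4 * ?N * qre (trace (Y ** X))"
  proof -
    have 1: "(\<Sum>i\<in>UNIV. \<Sum>j\<in>UNIV. 4 * qre (A $ i $ i) * qre ((mat 1 :: quat^('n option)^('n option)) $ j $ j)) = 4 * ?N * qre (trace A)" for A :: "quat^('n option)^('n option)"
      by (simp add: trace_def qre_sum sum_distrib_left mat_def algebra_simps sum.distrib)
    have 2: "(\<Sum>i\<in>UNIV. \<Sum>j\<in>UNIV. 4 * qre ((mat 1 :: quat^('n option)^('n option)) $ i $ i) * qre (A $ j $ j)) = 4 * ?N * qre (trace A)" for A :: "quat^('n option)^('n option)"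
      by (subst sum.swap) (use 1[of A] in \<open>simp add: mult.commute mult.left_commute\<close>)
    show ?thesis
      unfolding sum.distrib sum_subtractf trace_matrix_mult_left_right 1 2 by (simp add: d)
  qed
  also have "\<dots> = 8 * ?N * qre (trace (X ** Y))"
    by (simp add: qre_trace_commute[of Y X])
  also have "trace (X ** Y) = (\<Sum>k\<in>UNIV. X $ None $ Some k * Y $ Some k $ None + X $ Some k $ None * Y $ None $ Some k)"
    using lie_m_nth[OF X] lie_m_nth[OF Y] by (simp add: trace_def sum_option matrix_mult_option_nth sum.distrib)
  finally show ?thesis
    by (simp add: qre_sum off_diagonal_def qre_mult_commute[of "X $ Some _ $ None"] del: quat_times_sel)
qed

section \<open>The center of the isotropy algebra and its action on \<open>lie_m\<close>\<close>

lemma commute_imaginary_imp_real: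
  assumes "\<And>q. qre q = 0 \<Longrightarrow> z * q = q * z"
  shows "z = of_real (qre z)"
  using assms[of "Quat 0 1 0 0"] assms[of "Quat 0 0 1 0"] by (auto simp: quat_eq_iff)

text \<open>Imaginary multiples of diagonal matrix units lie in \<open>lie_l\<close>, since only the
  real trace is constrained; they kill the off-diagonal entries of \<open>Z\<close> and make its
  diagonal real. Off-diagonal units of the lower block then equate its diagonal entries.\<close>

lemma center_l_form:
  fixes Z :: "quat^('n::finite option)^('n option)"
  assumes "Z \<in> center_l"
  shows "\<exists>s r. \<forall>i j. Z $ i $ j = (if i = j then of_real (if i = None then s else r) else 0)"
proof -
  define E where "E k l q = (\<chi> i j. if i = k \<and> j = l then q else 0)" for k l :: "'n option" and q :: quat
  have comm: "Z ** A = A ** Z" if "A \<in> lie_l" for A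
    using assms that by (auto simp: center_l_def ad_def)
  have E_left: "(Z ** E k l q) $ i $ j = (if j = l then Z $ i $ k * q else 0)" for k l q i j
    by (simp add: matrix_matrix_mult_def E_def if_distrib[of "\<lambda>x. _ * x"] conj_commute if_if_eq_conj[symmetric] cong: if_cong)
  have E_right: "(E k l q ** Z) $ i $ j = (if i = k then q * Z $ l $ j else 0)" for k l q i j
    by (simp add: matrix_matrix_mult_def E_def if_distrib[of "\<lambda>x. x * _"] if_if_eq_conj[symmetric] cong: if_cong)
  have tr: "trace (E k l q) = (if k = l then q else 0)" for k l q
    by (auto simp: trace_def E_def if_if_eq_conj[symmetric] cong: if_cong)
  have diag: "E k k q \<in> lie_l" if "qre q = 0" for k q
    using that by (simp add: lie_l_def sl_H_def tr block_diagonal_def) (auto simp: E_def)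
  have offd: "E (Some a) (Some b) 1 \<in> lie_l" if "a \<noteq> b" for a b
    using that by (simp add: lie_l_def sl_H_def tr block_diagonal_def) (auto simp: E_def)
  have Zd: "Z $ i $ k = 0" if "i \<noteq> k" for i k
  proof -
    have "Z $ i $ k * Quat 0 1 0 0 = 0"
      using arg_cong[OF comm[OF diag[of "Quat 0 1 0 0" k]], of "\<lambda>A. A $ i $ k"] that by (simp add: E_left E_right)
    then show ?thesis
      by (simp add: quat_eq_iff)
  qed
  have Zr: "Z $ k $ k = of_real (qre (Z $ k $ k))" for k
  proof (rule commute_imaginary_imp_real)
    show "Z $ k $ k * q = q * Z $ k $ k" if "qre q = 0" for q
      using arg_cong[OF comm[OF diag[OF that, of k]], of "\<lambda>A. A $ k $ k"] by (simp add: E_left E_right)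
  qed
  \<comment> \<open>A reference index in the lower block; it exists because types are
    nonempty.\<close>
  obtain a0 :: 'n where True by simp
  have Ze: "Z $ Some a $ Some a = Z $ Some a0 $ Some a0" for a
  proof (cases "a = a0")
    case False
    then show ?thesis
      using arg_cong[OF comm[OF offd[OF False]], of "\<lambda>A. A $ Some a $ Some a0"] by (simp add: E_left E_right)
  qed simp
  have "Z $ i $ j = (if i = j then of_real (if i = None then qre (Z $ None $ None) else qre (Z $ Some a0 $ Some a0)) else 0)" for i j
  proof (cases "i = j")
    case True
    show ?thesis
    proof (cases i)
      case None
      then show ?thesis using True by (simp flip: Zr)
    next
      case (Some y)
      then show ?thesis using True Ze[of y] by (simp flip: Zr)
    qed
  qed (simp add: Zd)
  then show ?thesis by blast
qed

text \<open>\<open>Z\<close> is diagonal with entries \<open>s, r, ..., r\<close>, so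
  \<open>ad Z\<close> acts on the two off-diagonal blocks by \<open>s - r\<close> and its negative.
  The normalization leaves only the sign of \<open>\<epsilon> = s - r\<close> undetermined.\<close>

lemma center_l_ad:
  fixes Z :: "quat^('n::finite option)^('n option)"
  assumes Z: "Z \<in> center_l" and inv: "\<And>X. X \<in> lie_m \<Longrightarrow> ad Z (ad Z X) = X"
  obtains \<epsilon> :: real where "\<epsilon> * \<epsilon> = 1"
    "\<And>X. X \<in> lie_m \<Longrightarrow> ad Z X = off_matrix (- \<epsilon> *\<^sub>R fst (off_diagonal X), \<epsilon> *\<^sub>R snd (off_diagonal X))"
proof -
  obtain s r where Zf: "\<And>i j. Z $ i $ j = (if i = j then of_real (if i = None then s else r) else 0)"
    using center_l_form[OF Z] by blast
  have scale: "of_real c * q - q * of_real d = (c - d) *\<^sub>R q" for c d and q :: quat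
    by (simp add: quat_eq_iff algebra_simps)
  have nth: "ad Z X $ i $ j = of_real (if i = None then s else r) * X $ i $ j - X $ i $ j * of_real (if j = None then s else r)" for X i j
    by (simp add: ad_def matrix_matrix_mult_def Zf if_distrib[of "\<lambda>x. x * _"] if_distrib[of "\<lambda>x. _ * x"] cong: if_cong)
  have ad: "ad Z X = off_matrix (- (s - r) *\<^sub>R fst (off_diagonal X), (s - r) *\<^sub>R snd (off_diagonal X))" if "X \<in> lie_m" for X
    using lie_m_nth[OF that] by (simp add: block_vec_eq_iff nth scale off_diagonal_def)
  let ?X = "off_matrix (0, 1) :: quat^('n option)^('n option)"
  have "ad Z (ad Z ?X) = ?X" by (rule inv[OF off_matrix_in_lie_m])
  then have "off_diagonal (ad Z (ad Z ?X)) = (0, 1)" by simp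
  then have "(s - r) *\<^sub>R ((s - r) *\<^sub>R (1 :: quat^'n)) = 1"
    by (simp add: ad off_matrix_in_lie_m)
  then have "(s - r) * (s - r) = 1"
    by (simp add: vec_eq_iff quat_eq_iff)
  then show ?thesis
    using that ad by blast
qed

lemma sp1_ad:
  assumes A: "A \<in> sp1" and X: "X \<in> lie_m"
  shows "ad A X = off_matrix (\<chi> a. - (fst (off_diagonal X) $ a * A $ None $ None), \<chi> b. A $ None $ None * snd (off_diagonal X) $ b)"
proof -
  have "A $ Some a $ j = 0" "A $ None $ Some b = 0" for a b j
    using A by (auto simp: sp1_def)
  then show ?thesis
    using lie_m_nth[OF X] by (simp add: block_vec_eq_iff ad_def matrix_mult_option_nth off_diagonal_def)
qed

section \<open>The invariant symplectic form\<close>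

definition pairing :: "'a::semiring_0^'n \<Rightarrow> 'a^'n \<Rightarrow> 'a" where
  "pairing v w = (\<Sum>k\<in>UNIV. v $ k * w $ k)"

text \<open>The real part is what makes the value insensitive to conjugation by corner entries. The
  scalar \<open>\<kappa>\<close> absorbs the Killing constant and the sign in the normalization of
  the center.\<close>

definition symp_form :: "real \<Rightarrow> (quat^'n) \<times> (quat^'n) \<Rightarrow> (quat^'n) \<times> (quat^'n) \<Rightarrow> real" where
  "symp_form \<kappa> x y = \<kappa> * (qre (pairing (snd x) (fst y)) - qre (pairing (snd y) (fst x)))"

lemma symp_self: "symp_form \<kappa> x x = 0"
  by (simp add: symp_form_def)

lemma symp_skew: "symp_form \<kappa> x y = - symp_form \<kappa> y x"
  by (simp add: symp_form_def algebra_simps)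

lemma pairing_add: "pairing (v + v') w = pairing v w + pairing v' w" "pairing v (w + w') = pairing v w + pairing v w'"
  by (simp_all add: pairing_def distrib_left distrib_right sum.distrib)

lemma pairing_scaleR:
  fixes v w :: "'a::real_algebra^'n"
  shows "pairing (r *\<^sub>R v) w = r *\<^sub>R pairing v w" "pairing v (r *\<^sub>R w) = r *\<^sub>R pairing v w"
  by (simp_all add: pairing_def scaleR_sum_right)

lemma pairing_mult:
  fixes v w :: "'a::ring^'n"
  shows "pairing (\<chi> k. c * v $ k) w = c * pairing v w" "pairing v (\<chi> k. w $ k * c) = pairing v w * c"
    "pairing (\<chi> k. v $ k + c * z $ k) w = pairing v w + c * pairing z w"
    "pairing v (\<chi> k. - (w $ k * c)) = - (pairing v w * c)"
  by (simp_all add: pairing_def sum_distrib_left sum_distrib_right mult.assoc distrib_right sum.distrib sum_negf)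

lemma bilinear_symp: "bilinear (symp_form \<kappa>)"
  unfolding bilinear_def by (auto intro!: linearI simp: symp_form_def pairing_add pairing_scaleR algebra_simps)

lemma shear_pairing: "shear v x = (fst x, \<chi> b. snd x $ b + pairing v (fst x) * v $ b)"
  by (simp add: shear_def pairing_def)

lemma linear_shear: "linear (shear v :: ('a::real_algebra_1^'n) \<times> ('a^'n) \<Rightarrow> _)"
  by (rule linearI) (simp_all add: shear_pairing pairing_add pairing_scaleR vec_eq_iff algebra_simps)

lemma linear_shear_inv: "linear (shear_inv v :: ('a::real_algebra_1^'n) \<times> ('a^'n) \<Rightarrow> _)"
  unfolding shear_inv_def pairing_def[symmetric]
  by (rule linearI) (simp_all add: pairing_add pairing_scaleR vec_eq_iff algebra_simps)

lemma symp_shear: "symp_form \<kappa> (shear v x) (shear v y) = symp_form \<kappa> x y"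
  unfolding symp_form_def shear_pairing
  using qre_mult_commute[of "pairing v (fst x)" "pairing v (fst y)"]
  by (simp add: pairing_mult del: quat_times_sel)

text \<open>The large blocks of \<open>ginv l\<close> and \<open>l\<close> meet in the middle of the
  sum and cancel; what survives is conjugation by the corner, invisible to the real part.\<close>

lemma (in block_group) pairing_isotropy:
  assumes "l \<in> H"
  shows "pairing (snd (isotropy ginv l x)) (fst (isotropy ginv l y)) =
    l $ None $ None * pairing (snd x) (fst y) * inverse (l $ None $ None)"
proof -
  have B: "(ginv l ** l) $ Some j $ Some i = (if j = i then 1 else 0)" for i j
    using assms by (simp add: inv_left H_subset)
  have e: "(\<Sum>k\<in>UNIV. ginv l $ Some j $ Some k * l $ Some k $ Some i) = (if j = i then 1 else 0)" for i j
    using B[of j i] H_block_diagonal[OF assms] by (simp add: matrix_mult_option_nth)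
  have "(\<Sum>k\<in>UNIV. (\<Sum>j\<in>UNIV. snd x $ j * ginv l $ Some j $ Some k) * (\<Sum>i\<in>UNIV. l $ Some k $ Some i * fst y $ i)) =
      (\<Sum>k\<in>UNIV. \<Sum>j\<in>UNIV. \<Sum>i\<in>UNIV. snd x $ j * (ginv l $ Some j $ Some k * l $ Some k $ Some i) * fst y $ i)"
    by (simp add: sum_product mult.assoc)
  also have "\<dots> = (\<Sum>j\<in>UNIV. \<Sum>i\<in>UNIV. \<Sum>k\<in>UNIV. snd x $ j * (ginv l $ Some j $ Some k * l $ Some k $ Some i) * fst y $ i)"
    by (rule trans[OF sum.swap]) (intro sum.cong refl sum.swap)
  also have "\<dots> = (\<Sum>j\<in>UNIV. \<Sum>i\<in>UNIV. snd x $ j * (\<Sum>k\<in>UNIV. ginv l $ Some j $ Some k * l $ Some k $ Some i) * fst y $ i)"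
    by (simp add: sum_distrib_left sum_distrib_right)
  also have "\<dots> = pairing (snd x) (fst y)"
    unfolding e pairing_def
    by (simp add: if_distrib[of "\<lambda>x. _ * x"] if_distrib[of "\<lambda>x. x * _"] cong: if_cong)
  finally have "(\<Sum>k\<in>UNIV. (\<Sum>j\<in>UNIV. snd x $ j * ginv l $ Some j $ Some k) * (\<Sum>i\<in>UNIV. l $ Some k $ Some i * fst y $ i)) =
      pairing (snd x) (fst y)" .
  moreover have "pairing (\<chi> b. p * A b) (\<chi> a. B a * q) = p * (\<Sum>k\<in>UNIV. A k * B k) * q" for p q :: 'a and A B :: "'n \<Rightarrow> 'a"
    by (simp add: pairing_def sum_distrib_left sum_distrib_right mult.assoc)
  ultimately show ?thesis
    unfolding isotropy_def fst_conv snd_conv by (simp only:)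
qed

interpretation SLH: block_group "SL_H :: (quat^('n::finite option)^('n option)) set" quat_inv
  by (rule block_group_SL_H)

lemma symp_isotropy:
  assumes "l \<in> SLH.H"
  shows "symp_form \<kappa> (isotropy quat_inv l x) (isotropy quat_inv l y) = symp_form \<kappa> x y"
proof -
  have "qre (a * q * inverse a) = qre q" if "a \<noteq> 0" for a q
    using that qre_mult_commute[of "a * q" "inverse a"] by (simp add: mult.assoc[symmetric] del: quat_times_sel)
  then show ?thesis
    using SLH.H_corner(2)[OF assms] unfolding symp_form_def SLH.pairing_isotropy[OF assms] by simp
qed

lemma M_space_eq: "M_space = SLH.qspace"
  by (simp add: M_space_def L_H_def diag_subgroup_def)

lemma L_H_eq: "L_H = SLH.H"
  by (simp add: L_H_def diag_subgroup_def)

lemma (in block_group) coset_one: "coset H (mat 1) = H"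
  by (simp add: coset_def)

text \<open>Resolves the unique description in \<open>base_vec\<close>: the curve
  \<open>sect (t x)\<close> realizes the value, and every admissible curve has the same projected
  velocity.\<close>

lemma base_vec_lie_m:
  fixes X :: "quat^('n::finite option)^('n option)"
  assumes "X \<in> lie_m"
  shows "base_vec X = coord_vec SLH.qspace SLH.H (SLH.chart (mat 1)) (off_diagonal X)"
  unfolding base_vec_def M_space_eq L_H_eq
proof (rule the_equality)
  let ?\<gamma> = "\<lambda>t. sect (t *\<^sub>R off_diagonal X) :: quat^('n option)^('n option)"
  have \<gamma>: "range ?\<gamma> \<subseteq> SL_H" "?\<gamma> 0 = mat 1" "(?\<gamma> has_vector_derivative X) (at 0)"
    using SLH.has_vector_derivative_sect_line[of "off_diagonal X"]
    by (auto simp: sect_zero off_matrix_off_diagonal[OF assms] intro: SLH.sect_mem)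
  show "\<exists>\<gamma>. range \<gamma> \<subseteq> SL_H \<and> \<gamma> 0 = mat 1 \<and> (\<gamma> has_vector_derivative X) (at 0) \<and>
      coord_vec SLH.qspace SLH.H (SLH.chart (mat 1)) (off_diagonal X) = velocity SLH.qspace (\<lambda>t. coset SLH.H (\<gamma> t))"
    using SLH.velocity_at_one[OF \<gamma>] \<gamma> unfolding SLH.coset_one by metis
  show "v = coord_vec SLH.qspace SLH.H (SLH.chart (mat 1)) (off_diagonal X)"
    if "\<exists>\<gamma>. range \<gamma> \<subseteq> SL_H \<and> \<gamma> 0 = mat 1 \<and> (\<gamma> has_vector_derivative X) (at 0) \<and>
      v = velocity SLH.qspace (\<lambda>t. coset SLH.H (\<gamma> t))" for v
    using that SLH.velocity_at_one SLH.coset_one by metis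
qed

lemma translated_vec_lie_m:
  assumes "g \<in> SL_H" "X \<in> lie_m"
  shows "translated_vec g X = SLH.frame g (off_diagonal X)"
  using SLH.pushforward_translation[OF assms(1) SLH.one_mem, of "off_diagonal X"]
  by (simp add: translated_vec_def base_vec_lie_m[OF assms(2)] M_space_eq L_H_eq SLH.coset_one)

lemma (in block_group) coord_vec_eq_iff:
  assumes "g \<in> G"
  shows "frame g x = frame g y \<longleftrightarrow> x = y"
  using coord_vec_same[OF smooth_manifold_homogeneous chart_at_center[OF assms]] by metis

text \<open>The description of \<open>omega\<close> ranges over all representatives of the coset.
  Writing the Killing form in terms of \<open>ad Z0 Y\<close> makes it a function of the two tangent
  vectors, and invariance under \<open>isotropy\<close> makes it agree for all
  representatives.\<close>

lemma omega_coords: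
  fixes Z0 :: "quat^('n::finite option)^('n option)"
  assumes "Z0 \<in> center_l" "\<And>X. X \<in> lie_m \<Longrightarrow> ad Z0 (ad Z0 X) = X"
  obtains \<kappa> :: real where "\<kappa> \<noteq> 0" "\<And>g x y. g \<in> SL_H \<Longrightarrow>
    omega Z0 (coset SLH.H g) (SLH.frame g x)
      (SLH.frame g y) = symp_form \<kappa> x y"
proof -
  obtain \<epsilon> where \<epsilon>: "\<epsilon> * \<epsilon> = 1"
    and ad: "\<And>X. X \<in> lie_m \<Longrightarrow> ad Z0 X = off_matrix (- \<epsilon> *\<^sub>R fst (off_diagonal X), \<epsilon> *\<^sub>R snd (off_diagonal X))"
    using center_l_ad[OF assms] by blast
  \<comment> \<open>Comparing the two sides of \<open>K\<close> requires
    \<open>- \<kappa> * \<epsilon>\<close> to be the Killing constant; as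
    \<open>\<epsilon> * \<epsilon> = 1\<close>, dividing by \<open>\<epsilon>\<close> is multiplying
    by it.\<close>
  define \<kappa> where "\<kappa> = - \<epsilon> * (8 * real CARD('n option))"
  have "\<kappa> \<noteq> 0" using \<epsilon> by (auto simp: \<kappa>_def)
  have K: "killing_form X Y = symp_form \<kappa> (off_diagonal X) (off_diagonal (ad Z0 Y))"
    if X: "X \<in> lie_m" and Y: "Y \<in> lie_m" for X Y
  proof -
    have "killing_form X Y = 8 * real CARD('n option) * (qre (pairing (snd (off_diagonal X)) (fst (off_diagonal Y))) +
        qre (pairing (snd (off_diagonal Y)) (fst (off_diagonal X))))"
      unfolding killing_form_lie_m[OF X Y] pairing_def by (simp add: qre_sum sum.distrib del: quat_times_sel)
    also have "\<dots> = (\<epsilon> * \<epsilon>) * (8 * real CARD('n option)) * (qre (pairing (snd (off_diagonal X)) (fst (off_diagonal Y))) +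
        qre (pairing (snd (off_diagonal Y)) (fst (off_diagonal X))))"
      by (simp add: \<epsilon>)
    also have "\<dots> = symp_form \<kappa> (off_diagonal X) (off_diagonal (ad Z0 Y))"
      unfolding ad[OF Y] off_diagonal_off_matrix symp_form_def \<kappa>_def fst_conv snd_conv pairing_scaleR quat_scaleR_sel
      by (simp only: algebra_simps)
    finally show ?thesis .
  qed
  have "omega Z0 (coset SLH.H g) (SLH.frame g x)
      (SLH.frame g y) = symp_form \<kappa> x y" if g: "g \<in> SL_H" for g x y
    unfolding omega_def L_H_eq
  proof (rule the_equality)
    let ?X = "off_matrix x :: quat^('n option)^('n option)"
    have X: "?X \<in> lie_m" by (rule off_matrix_in_lie_m)
    have Y: "ad Z0 (off_matrix y) \<in> lie_m"
      unfolding ad[OF off_matrix_in_lie_m] by (rule off_matrix_in_lie_m)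
    have Y': "ad Z0 (ad Z0 (off_matrix y)) = off_matrix y"
      by (rule assms(2)[OF off_matrix_in_lie_m])
    have "symp_form \<kappa> x y = killing_form ?X (ad Z0 (off_matrix y))"
      by (simp add: K[OF X Y] Y')
    then show "\<exists>h\<in>SL_H. \<exists>X\<in>lie_m. \<exists>Y\<in>lie_m. coset SLH.H g = coset SLH.H h \<and>
        SLH.frame g x = translated_vec h X \<and>
        SLH.frame g y = translated_vec h (ad Z0 Y) \<and> symp_form \<kappa> x y = killing_form X Y"
      \<comment> \<open>\<open>ad Z0\<close> is an involution on \<open>lie_m\<close>, so
        \<open>ad Z0 (off_matrix y)\<close> is the matrix that \<open>ad Z0\<close> sends to
        \<open>off_matrix y\<close>.\<close>
      using g X Y by (intro bexI[of _ g] bexI[of _ ?X] bexI[of _ "ad Z0 (off_matrix y)"])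
        (simp_all add: translated_vec_lie_m Y' off_matrix_in_lie_m)
  next
    fix r
    assume "\<exists>h\<in>SL_H. \<exists>X\<in>lie_m. \<exists>Y\<in>lie_m. coset SLH.H g = coset SLH.H h \<and>
        SLH.frame g x = translated_vec h X \<and>
        SLH.frame g y = translated_vec h (ad Z0 Y) \<and> r = killing_form X Y"
    then obtain h X Y where h: "h \<in> SL_H" "coset SLH.H g = coset SLH.H h" and X: "X \<in> lie_m" and Y: "Y \<in> lie_m"
      and x: "SLH.frame g x = translated_vec h X"
      and y: "SLH.frame g y = translated_vec h (ad Z0 Y)"
      and r: "r = killing_form X Y" by blast
    obtain l where l: "l \<in> SLH.H" "h = g ** l"
      using SLH.coset_eqD[OF h(2)] by blast
    have *: "z = isotropy quat_inv l (off_diagonal W)"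
      if "SLH.frame g z = translated_vec h W" "W \<in> lie_m" for z W
    proof -
      have "SLH.frame g z =
          coord_vec SLH.qspace (coset SLH.H g) (SLH.chart (g ** l)) (off_diagonal W)"
        using that translated_vec_lie_m[OF h(1) that(2)] h(2) l(2) by simp
      then show ?thesis
        unfolding SLH.coord_vec_isotropy[OF g l(1)] SLH.coord_vec_eq_iff[OF g] .
    qed
    have adY: "ad Z0 Y \<in> lie_m" unfolding ad[OF Y] by (rule off_matrix_in_lie_m)
    show "r = symp_form \<kappa> x y"
      unfolding r K[OF X Y] *[OF x X] *[OF y adY] symp_isotropy[OF l(1)] ..
  qed
  then show ?thesis using that \<open>\<kappa> \<noteq> 0\<close> by blast
qed

section \<open>Symplectic submanifolds\<close>

text \<open>The form enters only through its value in charts centred at the point, so the real and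
  the complex case share all that follows.\<close>

locale sl_inclusion = block_group_hom G ginv "SL_H :: (quat^('n::finite option)^('n option)) set" quat_inv f
  for G :: "('a::{real_normed_div_algebra,euclidean_space}^('n::finite option)^('n option)) set" and ginv f +
  fixes \<omega> :: "((quat^('n option)^('n option)) set, (quat^'n) \<times> (quat^'n)) two_form" and \<kappa> :: real
  assumes \<kappa>: "\<kappa> \<noteq> 0"
    and \<omega>: "g \<in> SL_H \<Longrightarrow> \<omega> (coset SLH.H g) (SLH.frame g x)
      (SLH.frame g y) = symp_form \<kappa> x y"
begin

abbreviation "\<omega>N \<equiv> pullback_form N.qspace M.qspace incl \<omega>"

text \<open>Away from the centre of the chart the vectors are moved to the chart centred at the
  point itself; this costs a shear, which preserves \<open>symp_form\<close>.\<close>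

lemma form_rep_M:
  assumes "g \<in> SL_H"
  shows "form_rep M.qspace \<omega> (M.chart g) y u v = symp_form \<kappa> u v"
proof -
  have m: "g ** sect y \<in> SL_H" using assms M.mult_mem M.sect_mem by blast
  have "form_rep M.qspace \<omega> (M.chart g) y u v = symp_form \<kappa> (shear_inv (snd y) u) (shear_inv (snd y) v)"
    by (simp add: form_rep_def Let_def M.chart_inv_std[OF assms] M.coord_vec_shear_inv[OF assms] \<omega>[OF m])
  then show ?thesis
    using symp_shear[of \<kappa> "snd y" "shear_inv (snd y) u" "shear_inv (snd y) v"] by simp
qed

lemma form_rep_N:
  assumes "g \<in> G"
  shows "form_rep N.qspace \<omega>N (N.chart g) y u v = symp_form \<kappa> (map_pair f u) (map_pair f v)"
proof -
  let ?p = "coset N.H (g ** sect y)"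
  have d: "M.chart (map_matrix f g) \<in> charts_at M.qspace (incl ?p)"
    unfolding incl_sect[OF assms] by (rule M.chart_at_sect[OF f_group[OF assms]])
  show ?thesis
    using form_rep_pullback[OF M.smooth_manifold_homogeneous N.smooth_manifold_homogeneous smooth_map_incl
        N.chart_at_sect[OF assms] d, of \<omega> u v]
    by (simp add: N.chart_sect[OF assms] chart_deriv_incl[OF assms] form_rep_M[OF f_group[OF assms]])
qed

lemma pullback_center:
  assumes "g \<in> G"
  shows "\<omega>N (coset N.H g) (N.frame g x)
    (N.frame g y) = symp_form \<kappa> (map_pair f x) (map_pair f y)"
  using form_rep_eq[OF N.smooth_manifold_homogeneous N.chart_at_center[OF assms], of \<omega>N x y] form_rep_N[OF assms]
  by simp

lemma closed_pullback: "closed_two_form N.qspace \<omega>N"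
proof (rule closed_two_formI[OF N.smooth_manifold_homogeneous])
  fix p assume "p \<in> points N.qspace"
  then obtain g where g: "g \<in> G" "p = coset N.H g" by auto
  have "linear (\<lambda>v. symp_form \<kappa> a (map_pair f v))" "linear (\<lambda>v. symp_form \<kappa> (map_pair f v) a)" for a
    using linear_compose[OF linear_map_pair, of "symp_form \<kappa> a", unfolded comp_def]
      linear_compose[OF linear_map_pair, of "\<lambda>x. symp_form \<kappa> x a", unfolded comp_def]
      bilinear_symp[of \<kappa>, unfolded bilinear_def] by blast+
  then have b: "bilinear (\<lambda>u v. symp_form \<kappa> (map_pair f u) (map_pair f v))"
    unfolding bilinear_def by blast
  have rep: "form_rep N.qspace \<omega>N (N.chart g) y = (\<lambda>u v. symp_form \<kappa> (map_pair f u) (map_pair f v))" for y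
    by (intro ext form_rep_N[OF g(1)])
  show "\<exists>d\<in>charts_at N.qspace p. \<exists>B. bilinear B \<and> (\<forall>u. B u u = 0) \<and> (\<forall>y\<in>snd d ` fst d. form_rep N.qspace \<omega>N d y = B)"
    unfolding g(2)
    by (rule bexI[OF _ N.chart_at_center[OF g(1)]], intro exI conjI allI ballI, rule b, rule symp_self, rule rep)
qed

text \<open>A nonzero component is paired with its inverse placed in the dual slot. The inverse
  exists in the smaller scalar algebra, so the test vector is tangent to the submanifold.\<close>

lemma symp_nondegenerate:
  fixes x :: "('a^'n) \<times> ('a^'n)"
  assumes "\<And>y. symp_form \<kappa> (map_pair f x) (map_pair f y) = 0"
  shows "x = 0"
proof -
  have one: "f q * f (inverse q) = 1" "f (inverse q) * f q = 1" if "q \<noteq> 0" for q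
    using that by (simp_all add: f_mult[symmetric] f_one)
  have ax: "map_pair f (axis i a, 0) = (axis i (f a), 0)" "map_pair f (0, axis i a) = (0, axis i (f a))" for i :: 'n and a
    by (simp_all add: map_pair_def vec_eq_iff axis_def f_zero)
  have pa: "pairing v (axis i a) = v $ i * a" "pairing (axis i a) v = a * v $ i" for v :: "quat^'n" and i a
    by (simp_all add: pairing_def axis_def if_distrib[of "\<lambda>x. _ * x"] if_distrib[of "\<lambda>x. x * _"] cong: if_cong)
  have p0: "pairing v 0 = 0" "pairing 0 v = 0" for v :: "quat^'n"
    by (simp_all add: pairing_def)
  have s: "symp_form \<kappa> X (axis i a, 0) = \<kappa> * qre (snd X $ i * a)" "symp_form \<kappa> X (0, axis i a) = - (\<kappa> * qre (a * fst X $ i))"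
    for X :: "(quat^'n) \<times> (quat^'n)" and i a
    by (simp_all add: symp_form_def pa p0 del: quat_times_sel)
  have nth: "snd (map_pair f x) $ i = f (snd x $ i)" "fst (map_pair f x) $ i = f (fst x $ i)" for i
    by (simp_all add: map_pair_def)
  have "snd x $ i = 0" for i
  proof (rule ccontr)
    assume "snd x $ i \<noteq> 0"
    then show False
      using assms[of "(axis i (inverse (snd x $ i)), 0)"] \<kappa> unfolding ax s nth by (simp add: one(1) del: quat_times_sel)
  qed
  moreover have "fst x $ i = 0" for i
  proof (rule ccontr)
    assume "fst x $ i \<noteq> 0"
    then show False
      using assms[of "(0, axis i (inverse (fst x $ i)))"] \<kappa> unfolding ax s nth by (simp add: one(2) del: quat_times_sel)
  qed
  ultimately show ?thesis
    by (simp add: prod_eq_iff vec_eq_iff)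
qed

lemma nondegenerate_pullback: "nondegenerate N.qspace \<omega>N"
  unfolding nondegenerate_def
proof (intro ballI impI)
  fix p v assume "p \<in> points N.qspace" and v: "v \<in> tangent_space N.qspace p"
    and 0: "\<forall>w\<in>tangent_space N.qspace p. \<omega>N p v w = 0"
  then obtain g where g: "g \<in> G" "p = coset N.H g" by auto
  note c = N.chart_at_center[OF g(1)]
  have v': "v = N.frame g (v (N.chart g))"
    using tangent_space_eq_coord_vec[OF v] c g by simp
  have "symp_form \<kappa> (map_pair f (v (N.chart g))) (map_pair f y) = 0" for y
    using 0 coord_vec_in_tangent_space[OF N.smooth_manifold_homogeneous c, of y] pullback_center[OF g(1), of "v (N.chart g)" y] v' g
    by metis
  then have "v (N.chart g) = 0" by (rule symp_nondegenerate)
  then show "v = (\<lambda>_. 0)"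
    using v' coord_vec_eq_zero_iff[OF N.smooth_manifold_homogeneous c] by metis
qed

lemma symplectic_incl: "symplectic_submanifold N.qspace M.qspace incl \<omega>"
  unfolding symplectic_submanifold_def
  using submanifold_incl nondegenerate_pullback closed_pullback by blast

end

section \<open>The complex structure\<close>

text \<open>The action on \<open>lie_m\<close> of \<open>ad\<close> of the matrix with corner
  \<open>c\<close> and zeros elsewhere, in terms of the two off-diagonal blocks.\<close>

definition jpair :: "'a::ring \<Rightarrow> ('a^'n) \<times> ('a^'n) \<Rightarrow> ('a^'n) \<times> ('a^'n)" where
  "jpair c x = (\<chi> a. - (fst x $ a * c), \<chi> b. c * snd x $ b)"

lemma linear_jpair: "linear (jpair c :: ('a::real_algebra^'n) \<times> ('a^'n) \<Rightarrow> _)"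
  by (rule linearI) (simp_all add: jpair_def vec_eq_iff distrib_left distrib_right)

lemma jpair_jpair:
  fixes c :: "'a::ring_1"
  assumes "c * c = - 1"
  shows "jpair c (jpair c x) = - x"
proof -
  have "c * (c * q) = - q" "q * c * c = - q" for q
    using assms by (simp_all add: mult.assoc[symmetric]) (simp add: mult.assoc)
  then show ?thesis
    by (simp add: jpair_def prod_eq_iff vec_eq_iff)
qed

lemma symp_jpair:
  assumes "c * c = - 1"
  shows "symp_form \<kappa> (jpair c x) (jpair c y) = symp_form \<kappa> x y"
proof -
  have 1: "qre (c * q * c) = - qre q" for q
    using qre_mult_commute[of c "q * c"] assms by (simp add: mult.assoc del: quat_times_sel)
  show ?thesis
    unfolding symp_form_def jpair_def fst_conv snd_conv pairing_mult(4) pairing_mult(1) quat_uminus_sel 1 by simp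
qed

text \<open>On each block \<open>c\<close> and the corner of \<open>l\<close> multiply from the same
  side, while the large block acts from the other, so commutation with the corner suffices.\<close>

lemma isotropy_jpair:
  assumes "l $ None $ None * c = c * l $ None $ None"
  shows "isotropy ginv l (jpair c x) = jpair c (isotropy ginv l x)"
proof -
  have i: "c * inverse (l $ None $ None) = inverse (l $ None $ None) * c"
  proof (cases "l $ None $ None = 0")
    case False
    have "c * inverse (l $ None $ None) = inverse (l $ None $ None) * (l $ None $ None * c) * inverse (l $ None $ None)"
      using False by (simp flip: mult.assoc)
    also have "\<dots> = inverse (l $ None $ None) * (c * (l $ None $ None * inverse (l $ None $ None)))"
      by (simp only: assms mult.assoc)
    finally show ?thesis
      using False by simp
  qed simp
  have 1: "(\<Sum>k\<in>UNIV. - (l $ Some a $ Some k * (fst x $ k * c))) * inverse (l $ None $ None) =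
      - ((\<Sum>k\<in>UNIV. l $ Some a $ Some k * fst x $ k) * inverse (l $ None $ None) * c)" for a
  proof -
    have "(\<Sum>k\<in>UNIV. - (l $ Some a $ Some k * (fst x $ k * c))) = - ((\<Sum>k\<in>UNIV. l $ Some a $ Some k * fst x $ k) * c)"
      by (simp add: sum_negf sum_distrib_right mult.assoc)
    then show ?thesis by (simp add: mult.assoc i)
  qed
  have 2: "l $ None $ None * (\<Sum>k\<in>UNIV. c * snd x $ k * ginv l $ Some k $ Some b) =
      c * (l $ None $ None * (\<Sum>k\<in>UNIV. snd x $ k * ginv l $ Some k $ Some b))" for b
  proof -
    have "(\<Sum>k\<in>UNIV. c * snd x $ k * ginv l $ Some k $ Some b) = c * (\<Sum>k\<in>UNIV. snd x $ k * ginv l $ Some k $ Some b)"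
      by (simp add: sum_distrib_left mult.assoc)
    then show ?thesis using assms by (simp flip: mult.assoc)
  qed
  show ?thesis
    by (simp add: isotropy_def jpair_def 1 2 vec_eq_iff)
qed

context block_group_hom
begin

text \<open>Multiplication by \<open>c\<close>, transported from the base point. The choice of \<open>g\<close> does not matter when \<open>c\<close> commutes with the image of \<open>f\<close>.\<close>

definition cstruct :: "'b \<Rightarrow> ('a^('n option)^('n option)) set \<Rightarrow>
    (('b^('n option)^('n option)) set, ('b^'n) \<times> ('b^'n)) endo" where
  "cstruct c p v = (let g = SOME g. g \<in> G \<and> p = coset N.H g in
     coord_vec M.qspace (incl p) (M.chart (map_matrix f g)) (jpair c (v (M.chart (map_matrix f g)))))"

text \<open>The representative picked by the definition is \<open>g ** l\<close> with
  \<open>l\<close> over the smaller scalars. The corner of its image is a value of \<open>f\<close>,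
  hence commutes with \<open>c\<close>, and the change of representative commutes with
  \<open>jpair c\<close>.\<close>

lemma cstruct_coords:
  assumes c: "\<And>x. f x * c = c * f x" and g: "g \<in> G"
  shows "cstruct c (coset N.H g) (M.frame (map_matrix f g) x) =
    M.frame (map_matrix f g) (jpair c x)"
proof -
  define h where "h = (SOME h. h \<in> G \<and> coset N.H g = coset N.H h)"
  have h: "h \<in> G" "coset N.H g = coset N.H h"
    using someI_ex[of "\<lambda>h. h \<in> G \<and> coset N.H g = coset N.H h"] g unfolding h_def by auto
  obtain l where l: "l \<in> N.H" "h = g ** l"
    using N.coset_eqD[OF h(2)] by blast
  let ?p = "coset M.H (map_matrix f g)" and ?l = "map_matrix f l" and ?c = "M.chart (map_matrix f g)" and ?d = "M.chart (map_matrix f h)"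
  have fg: "map_matrix f g \<in> G'" and fl: "?l \<in> M.H" and fh: "map_matrix f h \<in> G'" "map_matrix f h = map_matrix f g ** ?l"
    using f_group[OF g] map_matrix_H[OF l(1)] f_group[OF h(1)] l(2) map_matrix_mult by auto
  have d: "?d \<in> charts_at M.qspace ?p"
    using M.chart_at_center[OF fh(1)] unfolding fh(2) M.coset_mult_H[OF fl] .
  define v where "v = coord_vec M.qspace ?p ?c x"
  have vT: "v \<in> tangent_space M.qspace ?p"
    unfolding v_def by (rule coord_vec_in_tangent_space[OF M.smooth_manifold_homogeneous M.chart_at_center[OF fg]])
  have iso: "coord_vec M.qspace ?p ?d z = coord_vec M.qspace ?p ?c (isotropy ginv' ?l z)" for z
    unfolding fh(2) by (rule M.coord_vec_isotropy[OF fg fl])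
  have "coord_vec M.qspace ?p ?c (isotropy ginv' ?l (v ?d)) = v"
    using tangent_space_eq_coord_vec[OF vT d] iso by simp
  also have "v = coord_vec M.qspace ?p ?c x"
    by (rule v_def)
  finally have x: "isotropy ginv' ?l (v ?d) = x"
    using M.coord_vec_eq_iff[OF fg] by blast
  have "?l $ None $ None * c = c * ?l $ None $ None"
    using c by (simp add: map_matrix_def)
  then have "isotropy ginv' ?l (jpair c (v ?d)) = jpair c x"
    using isotropy_jpair x by metis
  then have "coord_vec M.qspace ?p ?d (jpair c (v ?d)) = coord_vec M.qspace ?p ?c (jpair c x)"
    unfolding iso by simp
  then show ?thesis
    unfolding cstruct_def Let_def h_def[symmetric] incl_coset v_def .
qed

lemma cstruct_tangent:
  assumes c: "\<And>x. f x * c = c * f x" and p: "p \<in> points N.qspace" and v: "v \<in> tangent_space M.qspace (incl p)"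
  shows "cstruct c p v \<in> tangent_space M.qspace (incl p)"
proof -
  obtain g where g: "g \<in> G" "p = coset N.H g" using p by auto
  have ch: "M.chart (map_matrix f g) \<in> charts_at M.qspace (coset M.H (map_matrix f g))"
    by (rule M.chart_at_center[OF f_group[OF g(1)]])
  have "v = M.frame (map_matrix f g) (v (M.chart (map_matrix f g)))"
    using tangent_space_eq_coord_vec[OF v] ch g incl_coset by simp
  then have "cstruct c p v = M.frame (map_matrix f g) (jpair c (v (M.chart (map_matrix f g))))"
    using cstruct_coords[OF c g(1)] g(2) by metis
  then show ?thesis
    using coord_vec_in_tangent_space[OF M.smooth_manifold_homogeneous ch] g incl_coset by simp
qed

text \<open>Passing from the chart at the point to a fixed standard chart conjugates by a shear that
  varies with the point. The result is polynomial in \<open>y\<close>, which gives smoothness, but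
  generally not constant.\<close>

lemma cstruct_std_chart:
  fixes y :: "('a^'n) \<times> ('a^'n)"
  assumes c: "\<And>x. f x * c = c * f x" and g: "g \<in> G"
  defines "d \<equiv> M.chart (map_matrix f g)" and "p \<equiv> coset N.H (g ** sect y)" and "v \<equiv> snd (map_pair f y)"
  shows "cstruct c p (coord_vec M.qspace (incl p) d u) d = shear v (jpair c (shear_inv v u))"
proof -
  let ?h = "g ** sect y"
  have h: "?h \<in> G" using g N.mult_mem N.sect_mem by blast
  have fh: "map_matrix f ?h = map_matrix f g ** sect (map_pair f y)"
    by (simp add: map_matrix_mult map_matrix_sect)
  have p: "incl p = coset M.H (map_matrix f g ** sect (map_pair f y))"
    unfolding p_def by (rule incl_sect[OF g])
  have "coord_vec M.qspace (incl p) d u = coord_vec M.qspace (incl p) (M.chart (map_matrix f ?h)) (shear_inv v u)"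
    unfolding p d_def v_def fh by (rule M.coord_vec_shear_inv[OF f_group[OF g]])
  then have "cstruct c p (coord_vec M.qspace (incl p) d u) =
      coord_vec M.qspace (incl p) (M.chart (map_matrix f ?h)) (jpair c (shear_inv v u))"
    using cstruct_coords[OF c h, of "shear_inv v u"] unfolding p_def incl_coset by metis
  also have "\<dots> = coord_vec M.qspace (incl p) d (shear v (jpair c (shear_inv v u)))"
    unfolding p d_def v_def fh by (rule M.coord_vec_shear[OF f_group[OF g]])
  finally show ?thesis
    using coord_vec_same[OF M.smooth_manifold_homogeneous M.chart_at_sect[OF f_group[OF g]]] unfolding p d_def by metis
qed

lemma cstruct_section:
  assumes c: "\<And>x. f x * c = c * f x"
    and Q: "\<And>p. p \<in> points N.qspace \<Longrightarrow> cstruct c p \<in> Q (incl p)"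
  shows "smooth_section_along N.qspace M.qspace incl Q (cstruct c)"
proof (rule smooth_section_alongI[OF N.smooth_manifold_homogeneous M.smooth_manifold_homogeneous smooth_map_incl])
  show "cstruct c p \<in> Q (incl p)" if "p \<in> points N.qspace" for p
    by (rule Q[OF that])
  show "cstruct c p v \<in> tangent_space M.qspace (incl p)" if "p \<in> points N.qspace" "v \<in> tangent_space M.qspace (incl p)" for p v
    by (rule cstruct_tangent[OF c that])
  fix p assume "p \<in> points N.qspace"
  then obtain g where g: "g \<in> G" "p = coset N.H g" by auto
  define R where "R y u = shear (snd (map_pair f y)) (jpair c (shear_inv (snd (map_pair f y)) u))" for y :: "('a^'n) \<times> ('a^'n)" and u
  have mp: "Cinf_on UNIV (map_pair f)"
    using linear_map_pair by (intro Cinf_on_bounded_linear_id) (simp_all add: linear_conv_bounded_linear)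
  have "Cinf_on UNIV (\<lambda>y. R y u)" for u
    unfolding R_def shear_def shear_inv_def jpair_def diff_conv_add_uminus
    by (intro Cinf_intros open_UNIV mp)
  moreover have "linear (R y)" for y
    using linear_compose[OF linear_compose[OF linear_shear_inv linear_jpair] linear_shear,
        of "snd (map_pair f y)" c "snd (map_pair f y)"]
    by (simp add: R_def[abs_def] comp_def)
  moreover have "incl q \<in> fst (M.chart (map_matrix f g)) \<and>
      cstruct c q (coord_vec M.qspace (incl q) (M.chart (map_matrix f g)) u) (M.chart (map_matrix f g)) = R (snd (N.chart g) q) u"
    if q: "q \<in> fst (N.chart g)" for q u
  proof -
    have q': "coset N.H (g ** sect (snd (N.chart g) q)) = q"
      by (rule N.coset_sect_chart[OF g(1) q])
    show ?thesis
      using cstruct_std_chart[OF c g(1), of "snd (N.chart g) q" u] incl_sect[OF g(1), of "snd (N.chart g) q"]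
        M.chart_sect(1)[OF f_group[OF g(1)]] unfolding q' R_def by metis
  qed
  ultimately show "\<exists>c'\<in>charts_at N.qspace p. \<exists>d\<in>charts M.qspace. \<exists>R. (\<forall>u. Cinf_on (snd c' ` fst c') (\<lambda>x. R x u)) \<and>
      (\<forall>q\<in>fst c'. incl q \<in> fst d \<and> linear (R (snd c' q)) \<and> (\<forall>u. cstruct c q (coord_vec M.qspace (incl q) d u) d = R (snd c' q) u))"
    using g N.chart_at_center[OF g(1)] M.std_chart_in_charts[OF f_group[OF g(1)]]
    by (intro bexI[of _ "N.chart g"] bexI[of _ "M.chart (map_matrix f g)"] exI[of _ R]) (auto simp: N.chart_image[OF g(1)])
qed

end

text \<open>Makes \<open>cstruct\<close> available on a space included in itself, where it becomes
  an endomorphism field of that space.\<close>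

lemma (in block_group) block_group_hom_id: "block_group_hom G ginv G ginv (\<lambda>x. x)"
  by (intro block_group_hom.intro block_group_axioms block_group_hom_axioms.intro)
    (auto simp: map_matrix_def bounded_linear_ident)

subsection \<open>Affine charts\<close>

text \<open>The passage from standard coordinates to the affine coordinates of the line and the
  hyperplane represented by a point. It is an involution.\<close>

definition affine_coords :: "('a::field^'n) \<times> ('a^'n) \<Rightarrow> ('a^'n) \<times> ('a^'n)" where
  "affine_coords x = (fst x, \<chi> b. - (snd x $ b * inverse (1 + pairing (snd x) (fst x))))"

text \<open>The hyperplane is the kernel of the first row of \<open>sect_inv x\<close>. Where its
  corner is nonzero the row can be scaled to start with 1, and the remaining entries are the second
  component of \<open>affine_coords x\<close>.\<close>

definition affine_domain :: "(('a::field^'n) \<times> ('a^'n)) set" where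
  "affine_domain = {x. 1 + pairing (snd x) (fst x) \<noteq> 0}"

text \<open>This is why the coordinate change is an involution: it inverts the very factor by which
  it divides.\<close>

lemma affine_pairing:
  assumes "x \<in> affine_domain"
  shows "1 + pairing (snd (affine_coords x)) (fst (affine_coords x)) = inverse (1 + pairing (snd x) (fst x))"
proof -
  have "pairing (snd (affine_coords x)) (fst (affine_coords x)) = - (pairing (snd x) (fst x) * inverse (1 + pairing (snd x) (fst x)))"
    by (simp add: affine_coords_def pairing_def sum_negf sum_distrib_right mult.assoc mult.left_commute mult.commute)
  then show ?thesis
    using assms by (simp add: affine_domain_def field_simps)
qed

lemma affine_domain_image: "affine_coords ` (affine_domain :: (('a::field^'b) \<times> ('a^'b)) set) \<subseteq> affine_domain"
proof (rule image_subsetI)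
  show "affine_coords x \<in> affine_domain" if "x \<in> affine_domain" for x :: "('a^'b) \<times> ('a^'b)"
    using affine_pairing[OF that] that by (simp add: affine_domain_def)
qed

lemma affine_affine:
  assumes "x \<in> affine_domain"
  shows "affine_coords (affine_coords x) = x"
proof -
  have fst: "fst (affine_coords x) = fst x" and snd: "snd (affine_coords x) $ b = - (snd x $ b * inverse (1 + pairing (snd x) (fst x)))" for b
    by (simp_all add: affine_coords_def)
  have "affine_coords (affine_coords x) = (fst x, \<chi> b. snd x $ b * inverse (1 + pairing (snd x) (fst x)) * (1 + pairing (snd x) (fst x)))"
    unfolding affine_coords_def[of "affine_coords x"] affine_pairing[OF assms] unfolding fst snd by simp
  then show ?thesis
    using assms by (simp add: affine_domain_def prod_eq_iff vec_eq_iff mult.assoc)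
qed

lemma open_affine_domain: "open (affine_domain :: (('a::{real_normed_field,euclidean_space}^'n) \<times> ('a^'n)) set)"
proof -
  have "continuous_on UNIV (\<lambda>x :: ('a^'n) \<times> ('a^'n). 1 + pairing (snd x) (fst x))"
    unfolding pairing_def by (rule Cinf_on_continuous) (intro Cinf_intros open_UNIV)
  then show ?thesis
    unfolding affine_domain_def by (intro open_Collect_neq continuous_on_const)
qed

lemma Cinf_on_affine: "Cinf_on (affine_domain :: (('a::{real_normed_field,euclidean_space}^'n) \<times> ('a^'n)) set) affine_coords"
  unfolding affine_coords_def[abs_def] pairing_def
  by (intro Cinf_intros open_affine_domain) (auto simp: affine_domain_def pairing_def)

definition affine_deriv :: "('a::field^'n) \<times> ('a^'n) \<Rightarrow> ('a^'n) \<times> ('a^'n) \<Rightarrow> ('a^'n) \<times> ('a^'n)" where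
  "affine_deriv x h = (fst h, \<chi> b. - (snd x $ b * - (inverse (1 + pairing (snd x) (fst x)) *
      (pairing (snd x) (fst h) + pairing (snd h) (fst x)) * inverse (1 + pairing (snd x) (fst x)))
    + snd h $ b * inverse (1 + pairing (snd x) (fst x))))"

lemma has_derivative_affine:
  fixes x :: "('a::{real_normed_field,euclidean_space}^'n) \<times> ('a^'n)"
  assumes "x \<in> affine_domain"
  shows "(affine_coords has_derivative affine_deriv x) (at x)"
proof -
  have q: "((\<lambda>x :: ('a^'n) \<times> ('a^'n). 1 + pairing (snd x) (fst x)) has_derivative (\<lambda>h. pairing (snd x) (fst h) + pairing (snd h) (fst x))) (at x)"
    unfolding pairing_def
    by (auto intro!: derivative_eq_intros has_derivative_comps simp: sum.distrib)
  have nz: "1 + pairing (snd x) (fst x) \<noteq> 0" using assms by (simp add: affine_domain_def)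
  note i = Deriv.has_derivative_inverse[OF nz q]
  have fst: "(fst has_derivative (\<lambda>h. fst h)) (at x)"
    by (rule bounded_linear_imp_has_derivative[OF bounded_linear_fst])
  show ?thesis
    unfolding affine_coords_def[abs_def] affine_deriv_def[abs_def]
    by (intro has_derivative_Pair has_derivative_vec_lambda has_derivative_minus fst
        has_derivative_mult[OF has_derivative_comps(2) i])
qed

text \<open>Contrary to the standard coordinates, the affine ones are compatible with the complex
  structure.\<close>

lemma affine_deriv_shear_jpair:
  fixes x :: "('a::field^'n) \<times> ('a^'n)"
  assumes "x \<in> affine_domain"
  shows "affine_deriv x (shear (snd x) (jpair c z)) = jpair c (affine_deriv x (shear (snd x) z))"
proof -
  define q where "q = 1 + pairing (snd x) (fst x)"
  have q: "q \<noteq> 0" "pairing (snd x) (fst x) = q - 1" using assms by (simp_all add: q_def affine_domain_def)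
  \<comment> \<open>After composition with the shear the second component no longer depends on
    \<open>fst z\<close>. The differential thus preserves the splitting into two halves, on which
    \<open>jpair c\<close> acts by the scalars \<open>- c\<close> and \<open>c\<close>.\<close>
  have *: "affine_deriv x (shear (snd x) z) =
      (fst z, \<chi> b. snd x $ b * pairing (snd z) (fst x) * inverse q * inverse q - snd z $ b * inverse q)" for z
  proof -
    have "snd x $ b * (inverse q * (A + (B + A * (q - 1))) * inverse q) - (s + A * snd x $ b) * inverse q =
        snd x $ b * B * inverse q * inverse q - s * inverse q" for A B s b
      using q(1) by (simp add: field_simps)
    then show ?thesis
      unfolding affine_deriv_def shear_pairing q_def[symmetric]
      by (simp add: pairing_mult q(2))
  qed
  have p: "pairing (snd (jpair c z)) (fst x) = c * pairing (snd z) (fst x)"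
    by (simp add: jpair_def pairing_mult)
  show ?thesis
    unfolding * p by (simp add: jpair_def vec_eq_iff algebra_simps)
qed

locale field_block_group = block_group G ginv
  for G :: "('a::{real_normed_field,euclidean_space}^('n::finite option)^('n option)) set" and ginv +
  fixes J :: "('a^('n option)^('n option)) set \<Rightarrow> (('a^('n option)^('n option)) set, ('a^'n) \<times> ('a^'n)) endo" and c :: 'a
  assumes J: "g \<in> G \<Longrightarrow>
      J (coset (diag_subgroup G) g)
        (coord_vec (homogeneous_space G (diag_subgroup G)) (coset (diag_subgroup G) g) (std_chart G ginv g) x) =
      coord_vec (homogeneous_space G (diag_subgroup G)) (coset (diag_subgroup G) g) (std_chart G ginv g) (jpair c x)"
    and c: "c * c = - 1"
begin

definition affine_chart :: "'a^('n option)^('n option) \<Rightarrow> (('a^('n option)^('n option)) set, ('a^'n) \<times> ('a^'n)) chart" where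
  "affine_chart g = ({p \<in> fst (chart g). snd (chart g) p \<in> affine_domain}, \<lambda>p. affine_coords (snd (chart g) p))"

lemma affine_chart:
  assumes "g \<in> G"
  shows "affine_chart g \<in> charts qspace" "snd (affine_chart g) ` fst (affine_chart g) = affine_domain"
    "y \<in> affine_domain \<Longrightarrow> chart_inv (affine_chart g) y = coset H (g ** sect (affine_coords y))"
  unfolding affine_chart_def
  using reparametrized_chart[OF assms Cinf_on_affine affine_domain_image affine_affine Cinf_on_affine affine_domain_image affine_affine]
  by auto

lemma chart_deriv_affine:
  assumes g: "g \<in> G" and y: "y \<in> affine_domain"
  shows "chart_deriv id (coset H (g ** sect y)) (chart (g ** sect y)) (affine_chart g) = affine_deriv y \<circ> shear (snd y)"
proof (rule chart_deriv_eqI)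
  let ?h = "g ** sect y"
  have h: "?h \<in> G" using g mult_mem sect_mem by blast
  have "(snd (affine_chart g) \<circ> id \<circ> chart_inv (chart ?h)) z = affine_coords (coords ginv (sect y ** sect z))" for z
  proof -
    have "snd (chart g) (coset H (?h ** sect z)) = coords ginv (sect y ** sect z)"
      using g h by (simp add: chart_apply mult_mem sect_mem) (simp add: matrix_mul_assoc[symmetric] inv_cancel)
    then show ?thesis
      by (simp add: affine_chart_def chart_inv_std[OF h])
  qed
  then have eq: "snd (affine_chart g) \<circ> id \<circ> chart_inv (chart ?h) = affine_coords \<circ> (\<lambda>z. coords ginv (sect y ** sect z))"
    by auto
  have 0: "coords ginv (sect y ** sect 0) = y"
    by (simp add: sect_zero coords_sect)
  show "(snd (affine_chart g) \<circ> id \<circ> chart_inv (chart ?h) has_derivative affine_deriv y \<circ> shear (snd y))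
      (at (snd (chart ?h) (coset H ?h)))"
    unfolding eq chart_center[OF h]
    by (rule diff_chain_at[OF has_derivative_coords_sect_mult]) (simp add: 0 has_derivative_affine[OF y])
qed

text \<open>In the chart centred at the point \<open>J\<close> is \<open>jpair c\<close>, and the
  differential from there to the affine chart commutes with \<open>jpair c\<close>.\<close>

lemma endo_rep_affine:
  assumes g: "g \<in> G" and z: "z \<in> affine_domain"
  shows "endo_rep qspace J (affine_chart g) z u = jpair c u"
proof -
  let ?y = "affine_coords z" and ?d = "affine_chart g"
  have y: "?y \<in> affine_domain" using z affine_domain_image by blast
  let ?h = "g ** sect ?y"
  have h: "?h \<in> G" using g mult_mem sect_mem by blast
  let ?p = "coset H ?h"
  have p: "chart_inv ?d z = ?p" by (rule affine_chart(3)[OF g z])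
  have d: "?d \<in> charts_at qspace ?p"
    using affine_chart[OF g] chart_inv_right(1)[of z ?d] z p by (simp add: charts_at_def)
  note ch = chart_at_center[OF h] and sm = smooth_manifold_homogeneous
  define x where "x = chart_deriv id ?p ?d (chart ?h) u"
  have u: "coord_vec qspace ?p ?d u = coord_vec qspace ?p (chart ?h) x"
    unfolding x_def by (rule coord_vec_change[OF sm d ch])
  have cv: "coord_vec qspace ?p (chart ?h) w ?d = (affine_deriv ?y \<circ> shear (snd ?y)) w" for w
    using d chart_deriv_affine[OF g y] by (simp add: coord_vec_alt)
  have "endo_rep qspace J ?d z u = coord_vec qspace ?p (chart ?h) (jpair c x) ?d"
    by (simp add: endo_rep_def Let_def p u J[OF h])
  also have "\<dots> = jpair c (coord_vec qspace ?p (chart ?h) x ?d)"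
    unfolding cv comp_def by (rule affine_deriv_shear_jpair[OF y])
  also have "\<dots> = jpair c u"
    using coord_vec_same[OF sm d, of u] u by simp
  finally show ?thesis .
qed

lemma complex_structure:
  "p \<in> points qspace \<Longrightarrow> v \<in> tangent_space qspace p \<Longrightarrow> J p v \<in> tangent_space qspace p \<and> J p (J p v) = (\<lambda>c. - v c)"
proof -
  assume "p \<in> points qspace" and v: "v \<in> tangent_space qspace p"
  then obtain g where g: "g \<in> G" "p = coset H g" by auto
  note ch = chart_at_center[OF g(1)] and sm = smooth_manifold_homogeneous
  obtain x where x: "v = coord_vec qspace p (chart g) x"
    using tangent_space_eq_coord_vec[OF v, of "chart g"] ch g by metis
  have "J p (J p v) = coord_vec qspace p (chart g) (- x)"
    using g x J[OF g(1)] by (simp add: jpair_jpair[OF c])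
  also have "\<dots> = (\<lambda>c. - v c)"
    using coord_vec_scaleR[OF sm ch, of "-1" x] g x by simp
  finally show "J p v \<in> tangent_space qspace p \<and> J p (J p v) = (\<lambda>c. - v c)"
    using g x J[OF g(1)] coord_vec_in_tangent_space[OF sm ch] by simp
qed

lemma integrable_complex_structure: "almost_complex_structure qspace J" "integrable_structure qspace J"
proof -
  have const: "\<exists>d\<in>charts_at qspace p. \<exists>J0. linear J0 \<and> (\<forall>y\<in>snd d ` fst d. endo_rep qspace J d y = J0)"
    if p: "p \<in> points qspace" for p
  proof -
    obtain g where g: "g \<in> G" "p = coset H g" using p by auto
    have "p \<in> fst (affine_chart g)"
      using g chart_at_center[OF g(1)] chart_center[OF g(1)]
      by (simp add: affine_chart_def charts_at_def affine_domain_def pairing_def)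
    then have "affine_chart g \<in> charts_at qspace p"
      using affine_chart(1)[OF g(1)] by (simp add: charts_at_def)
    moreover have "\<forall>y\<in>snd (affine_chart g) ` fst (affine_chart g). endo_rep qspace J (affine_chart g) y = jpair c"
      unfolding affine_chart(2)[OF g(1)] using endo_rep_affine[OF g(1)] by blast
    ultimately show ?thesis
      using linear_jpair by blast
  qed
  show "almost_complex_structure qspace J" "integrable_structure qspace J"
    using integrable_almost_complex_structureI[OF smooth_manifold_homogeneous complex_structure const] by auto
qed

end

section \<open>Identification with the given spaces and assembly of the two assertions\<close>

lemma N_space_eq:
  "N_space = homogeneous_space SL (diag_subgroup (SL :: ('a::{comm_ring_1,real_algebra_1,euclidean_space}^('n::finite option)^('n option)) set))"
  by (simp add: N_space_def L_K_def diag_subgroup_def)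

lemma inclusion_eq:
  fixes G :: "('a::{real_normed_div_algebra,euclidean_space}^('n::finite option)^('n option)) set"
  assumes "block_group_hom G ginv SL_H quat_inv f"
  shows "(inclusion f :: ('a^('n option)^('n option)) set \<Rightarrow> _) = block_group_hom.incl SL_H f"
proof
  fix C :: "('a^('n option)^('n option)) set"
  show "inclusion f C = block_group_hom.incl SL_H f C"
    unfolding inclusion_def block_group_hom.incl_def[OF assms] L_H_eq map_matrix_def ..
qed

theorem proposition3p1:
  fixes Z0 :: "quat^('n::finite option)^('n option)"
  assumes "Z0 \<in> center_l"
    and "\<And>X. X \<in> lie_m \<Longrightarrow> ad Z0 (ad Z0 X) = X"
  shows "symplectic_submanifold
           (N_space :: ((real^('n option)^('n option)) set, (real^'n) \<times> (real^'n)) manifold)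
           M_space (inclusion of_real) (omega Z0) \<and>
         pseudo_kaehler_submanifold
           (N_space :: ((complex^('n option)^('n option)) set, (complex^'n) \<times> (complex^'n)) manifold)
           M_space (inclusion quat_of_complex) Q_structure (omega Z0)"
proof
  obtain \<kappa> where \<kappa>: "\<kappa> \<noteq> 0" "\<And>g x y. g \<in> SL_H \<Longrightarrow>
    omega Z0 (coset SLH.H g) (SLH.frame g x)
      (SLH.frame g y) = symp_form \<kappa> x y"
    using omega_coords[OF assms] by blast
  interpret R: sl_inclusion "SL :: (real^('n option)^('n option)) set" cramer_inv of_real "omega Z0" \<kappa>
    by (intro sl_inclusion.intro sl_inclusion_axioms.intro block_group_hom_real) (use \<kappa> in auto)
  show "symplectic_submanifold
       (N_space :: ((real^('n option)^('n option)) set, (real^'n) \<times> (real^'n)) manifold)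
       M_space (inclusion of_real) (omega Z0)"
    unfolding N_space_eq M_space_eq inclusion_eq[OF block_group_hom_real] by (rule R.symplectic_incl)
  interpret C: sl_inclusion "SL :: (complex^('n option)^('n option)) set" cramer_inv quat_of_complex "omega Z0" \<kappa>
    by (intro sl_inclusion.intro sl_inclusion_axioms.intro block_group_hom_complex) (use \<kappa> in auto)
  \<comment> \<open>The identity inclusion: the intrinsic complex structure is built by the same
    construction as its extension along the submanifold.\<close>
  interpret I: block_group_hom "SL :: (complex^('n option)^('n option)) set" cramer_inv SL cramer_inv "\<lambda>x. x"
    by (rule C.N.block_group_hom_id)
  have mm: "map_matrix (\<lambda>x. x) A = A" for A :: "complex^('n option)^('n option)"
    by (simp add: map_matrix_def)
  interpret F: field_block_group "SL :: (complex^('n option)^('n option)) set" cramer_inv "I.cstruct \<i>" \<i>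
  proof
    show "I.cstruct \<i> (coset C.N.H g) (coord_vec C.N.qspace (coset C.N.H g) (C.N.chart g) x) =
        coord_vec C.N.qspace (coset C.N.H g) (C.N.chart g) (jpair \<i> x)" if "g \<in> SL" for g x
      using I.cstruct_coords[of \<i> g x] that by (simp add: mm mult.commute)
  qed simp
  let ?J' = "I.cstruct \<i>" and ?i = "quat_of_complex \<i>"
  have comm: "quat_of_complex x * ?i = ?i * quat_of_complex x" for x
    by (simp flip: quat_of_complex_simps(2) add: mult.commute)
  have ii: "?i * ?i = - 1"
    by (simp add: quat_eq_iff)
  have jf: "map_pair quat_of_complex (jpair \<i> x) = jpair ?i (map_pair quat_of_complex x)" for x :: "(complex^'n) \<times> (complex^'n)"
    by (simp add: map_pair_def jpair_def)
  let ?J = "C.cstruct ?i"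
  have Q: "?J p \<in> Q_structure (C.incl p)" if p: "p \<in> points C.N.qspace" for p
  proof -
    obtain g where g: "g \<in> SL" "p = coset C.N.H g" using p by auto
    \<comment> \<open>The element of \<open>sp1\<close> whose \<open>ad\<close> is
      \<open>jpair\<close> of the quaternion \<open>i\<close>; it witnesses that the extension lies
      in the invariant quaternionic structure.\<close>
    define A :: "quat^('n option)^('n option)" where "A = (\<chi> i j. if i = None \<and> j = None then ?i else 0)"
    have A: "A \<in> sp1" by (simp add: A_def sp1_def)
    have fg: "map_matrix quat_of_complex g \<in> SL_H" by (rule C.f_group[OF g(1)])
    have "?J p (translated_vec (map_matrix quat_of_complex g) X) = translated_vec (map_matrix quat_of_complex g) (ad A X)"
      if X: "X \<in> lie_m" for X
    proof -
      have "ad A X = off_matrix (jpair ?i (off_diagonal X))"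
        unfolding sp1_ad[OF A X] by (simp add: jpair_def A_def)
      then show ?thesis
        using C.cstruct_coords[OF comm g(1), of "off_diagonal X"]
        by (simp add: translated_vec_lie_m[OF fg] X off_matrix_in_lie_m g(2))
    qed
    then show ?thesis
      unfolding Q_structure_def L_H_eq using fg A g(2) C.incl_coset by blast
  qed
  have sec: "smooth_section_along C.N.qspace SLH.qspace C.incl Q_structure ?J"
    by (rule C.cstruct_section[OF comm Q])
  have compat: "?J p (pushforward C.N.qspace SLH.qspace C.incl p v) = pushforward C.N.qspace SLH.qspace C.incl p (?J' p v)"
    if p: "p \<in> points C.N.qspace" and v: "v \<in> tangent_space C.N.qspace p" for p v
  proof -
    obtain g where g: "g \<in> SL" "p = coset C.N.H g" using p by auto
    note ch = C.N.chart_at_center[OF g(1)] and sm = C.N.smooth_manifold_homogeneous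
    obtain x where x: "v = coord_vec C.N.qspace (coset C.N.H g) (C.N.chart g) x"
      using tangent_space_eq_coord_vec[OF v, of "C.N.chart g"] ch g by metis
    show ?thesis
      unfolding x g(2) F.J[OF g(1)]
      by (simp add: C.pushforward_incl[OF g(1)] coord_vec_in_tangent_space[OF sm ch] coord_vec_same[OF sm ch]
          C.cstruct_coords[OF comm g(1)] jf)
  qed
  have herm: "pseudo_hermitian C.N.qspace ?J' (\<lambda>p v w. C.\<omega>N p v (?J' p w))"
  proof -
    have sym: "C.\<omega>N p v (?J' p w) = C.\<omega>N p w (?J' p v) \<and> C.\<omega>N p (?J' p v) (?J' p (?J' p w)) = C.\<omega>N p v (?J' p w)"
      if p: "p \<in> points C.N.qspace" and v: "v \<in> tangent_space C.N.qspace p" and w: "w \<in> tangent_space C.N.qspace p" for p v w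
    proof -
      obtain g where g: "g \<in> SL" "p = coset C.N.H g" using p by auto
      note ch = C.N.chart_at_center[OF g(1)] and sm = C.N.smooth_manifold_homogeneous
      obtain x y where x: "v = coord_vec C.N.qspace (coset C.N.H g) (C.N.chart g) x"
        and y: "w = coord_vec C.N.qspace (coset C.N.H g) (C.N.chart g) y"
        using tangent_space_eq_coord_vec[OF v, of "C.N.chart g"] tangent_space_eq_coord_vec[OF w, of "C.N.chart g"] ch g by metis
      let ?x = "map_pair quat_of_complex x" and ?y = "map_pair quat_of_complex y"
      \<comment> \<open>Applying the structure to both arguments preserves the form and squares to
        minus the identity on one of them; skewness of the form then yields symmetry of the
        metric.\<close>
      have "symp_form \<kappa> ?x (jpair ?i ?y) = symp_form \<kappa> (jpair ?i ?x) (- ?y)"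
        using symp_jpair[OF ii, of \<kappa> ?x "jpair ?i ?y"] by (simp add: jpair_jpair[OF ii])
      also have "\<dots> = symp_form \<kappa> ?y (jpair ?i ?x)"
        using symp_skew[of \<kappa> "jpair ?i ?x" ?y] by (simp add: bilinear_rneg[OF bilinear_symp])
      finally show ?thesis
        unfolding x y g(2) F.J[OF g(1)] C.pullback_center[OF g(1)] jf by (simp add: symp_jpair[OF ii])
    qed
    have "nondegenerate C.N.qspace (\<lambda>p v w. C.\<omega>N p v (?J' p w))"
      unfolding nondegenerate_def
    proof (intro ballI impI)
      fix p v assume p: "p \<in> points C.N.qspace" and v: "v \<in> tangent_space C.N.qspace p"
        and 0: "\<forall>w\<in>tangent_space C.N.qspace p. C.\<omega>N p v (?J' p w) = 0"
      obtain g where g: "g \<in> SL" "p = coset C.N.H g" using p by auto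
      note ch = C.N.chart_at_center[OF g(1)] and sm = C.N.smooth_manifold_homogeneous
      have "C.\<omega>N p v w = 0" if w: "w \<in> tangent_space C.N.qspace p" for w
      proof -
        obtain y where y: "w = coord_vec C.N.qspace (coset C.N.H g) (C.N.chart g) y"
          using tangent_space_eq_coord_vec[OF w, of "C.N.chart g"] ch g by metis
        \<comment> \<open>Since the structure squares to minus the identity it is onto, so the
          metric inherits non-degeneracy from the form.\<close>
        have "w = ?J' p (coord_vec C.N.qspace (coset C.N.H g) (C.N.chart g) (jpair \<i> (- y)))"
          unfolding y g(2) F.J[OF g(1)] by (simp add: jpair_jpair)
        then show ?thesis
          using 0 coord_vec_in_tangent_space[OF sm ch] g(2) by metis
      qed
      then show "v = (\<lambda>_. 0)"
        using C.nondegenerate_pullback p v unfolding nondegenerate_def by blast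
    qed
    then show ?thesis
      unfolding pseudo_hermitian_def using sym by blast
  qed
  show "pseudo_kaehler_submanifold
       (N_space :: ((complex^('n option)^('n option)) set, (complex^'n) \<times> (complex^'n)) manifold)
       M_space (inclusion quat_of_complex) Q_structure (omega Z0)"
    unfolding N_space_eq M_space_eq inclusion_eq[OF block_group_hom_complex] pseudo_kaehler_submanifold_def
    using C.submanifold_incl F.integrable_complex_structure sec compat herm C.nondegenerate_pullback C.closed_pullback
    by blast
qed

end
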